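(* Let $T$ be a complete first-order theory with monster model $\bar M$ and let $M$ be a small elementary submodel of $\bar M$. Suppose that $(\mathfrak p(x),\phi_{\mathfrak p}(x))$ and $(\mathfrak q(x),\phi_{\mathfrak q}(x))$ are $M$-invariant pairs which are strongly regular, and that $\mathfrak p$ and $\mathfrak q$ are generically stable. Then the following conditions are all equivalent: (1) $\mathfrak p$ and $\mathfrak q$ are orthogonal; (2) $\mathfrak p\upharpoonright M$ and $\mathfrak q\upharpoonright M$ are weakly orthogonal; (3) for some small set $C\supseteq M$, $\mathfrak p\upharpoonright C$ and $\mathfrak q\upharpoonright C$ are weakly orthogonal.
   Context: $T$ is a complete first-order theory with monster model $\bar M$; "small" means of cardinality less than the saturation of $\bar M$. A global type is a complete type over $\bar M$; $\mathfrak p\upharpoonright A$ is the restriction of $\mathfrak p$ to $A$. For small $A$, $\mathfrak p(x)$ is $A$-invariant if for all $\bar b_1\equiv\bar b_2\,(A)$ and all formulas $\phi(x;\bar y)$ over $A$: $\phi(x,\bar b_1)\in\mathfrak p$ iff $\phi(x,\bar b_2)\in\mathfrak p$. Morley sequence: $(a_i\mid i<\alpha)$ is a Morley sequence in $\mathfrak p$ over $A$ if $a_i\models\mathfrak p\upharpoonright Aa_{<i}$ for all $i<\alpha$. Generic stability: a non-algebraic global type $\mathfrak p$ is generically stable if for some small $A$ it is $A$-invariant and, for every infinite $\alpha$ and every Morley sequence $(a_i\mid i<\alpha)$ in $\mathfrak p$ over $A$, for every formula $\phi(x)$ with parameters from $\bar M$ the set $\{i\mid\ \models\phi(a_i)\}$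 is finite or co-finite. Strong regularity (for types in a single variable, possibly of a sort of $\bar M^{eq}$): $(\mathfrak p(x),\phi(x))$ is an $A$-invariant pair if $\mathfrak p$ is $A$-invariant and $\phi(x)\in\mathfrak p\upharpoonright A$. $(\mathfrak p,\phi)$ is strongly regular if for some small $A$ it is an $A$-invariant pair and for all small $B\supseteq A$ and all $a$ satisfying $\phi(x)$: either $a\models\mathfrak p\upharpoonright B$ or $\mathfrak p\upharpoonright B\vdash\mathfrak p\upharpoonright Ba$. Orthogonality: complete types $p,q$ over the same domain are weakly orthogonal if $p(x)\cup q(y)$ (disjoint variables) determines a complete type over that domain. Global types are orthogonal if they are weakly orthogonal as types over $\bar M$. *)

theory Defs
  imports Main
begin

unbundle cardinal_syntax

text \<open>
  Logic is many-sorted. A one-sorted theory \<open>T\<close> is the case of a one-element type of sorts, and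
  \<open>T\<^sup>e\<^sup>q\<close>, with monster model \<open>M\<^sup>e\<^sup>q\<close>, is again a many-sorted theory, so that a single variable of
  an arbitrary sort covers variables ranging over an imaginary sort.

  Variables and elements of structures carry their sort as first component; in particular the
  sorts of a structure are disjoint.
\<close>

type_synonym 's var = "'s \<times> nat"
type_synonym ('s, 'a) elem = "'s \<times> 'a"

record ('s, 'f, 'r) language =
  fun_syms :: "'f set"
  rel_syms :: "'r set"
  fun_dom :: "'f \<Rightarrow> 's list"
  fun_cod :: "'f \<Rightarrow> 's"
  rel_dom :: "'r \<Rightarrow> 's list"

text \<open>Terms and formulas may contain elements of a structure as parameters.\<close>

datatype ('s, 'f, 'a) trm =
    Var "'s var"
  | Param "('s, 'a) elem"
  | Fun 'f "('s, 'f, 'a) trm list"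

datatype ('s, 'f, 'r, 'a) form =
    Eq "('s, 'f, 'a) trm" "('s, 'f, 'a) trm"
  | Rel 'r "('s, 'f, 'a) trm list"
  | Neg "('s, 'f, 'r, 'a) form"
  | Conj "('s, 'f, 'r, 'a) form" "('s, 'f, 'r, 'a) form"
  | Exists "'s var" "('s, 'f, 'r, 'a) form"

primrec sort_of :: "('s, 'f, 'r) language \<Rightarrow> ('s, 'f, 'a) trm \<Rightarrow> 's" where
  "sort_of L (Var v) = fst v"
| "sort_of L (Param c) = fst c"
| "sort_of L (Fun f ts) = fun_cod L f"

fun wf_trm :: "('s, 'f, 'r) language \<Rightarrow> ('s, 'f, 'a) trm \<Rightarrow> bool" where
  "wf_trm L (Var v) \<longleftrightarrow> True"
| "wf_trm L (Param c) \<longleftrightarrow> True"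
| "wf_trm L (Fun f ts) \<longleftrightarrow>
     f \<in> fun_syms L \<and> map (sort_of L) ts = fun_dom L f \<and> (\<forall>t\<in>set ts. wf_trm L t)"

primrec wf_form :: "('s, 'f, 'r) language \<Rightarrow> ('s, 'f, 'r, 'a) form \<Rightarrow> bool" where
  "wf_form L (Eq t u) \<longleftrightarrow> wf_trm L t \<and> wf_trm L u \<and> sort_of L t = sort_of L u"
| "wf_form L (Rel R ts) \<longleftrightarrow>
     R \<in> rel_syms L \<and> map (sort_of L) ts = rel_dom L R \<and> (\<forall>t\<in>set ts. wf_trm L t)"
| "wf_form L (Neg \<phi>) \<longleftrightarrow> wf_form L \<phi>"
| "wf_form L (Conj \<phi> \<psi>) \<longleftrightarrow> wf_form L \<phi> \<and> wf_form L \<psi>"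
| "wf_form L (Exists v \<phi>) \<longleftrightarrow> wf_form L \<phi>"

fun vars_trm :: "('s, 'f, 'a) trm \<Rightarrow> 's var set" where
  "vars_trm (Var v) = {v}"
| "vars_trm (Param c) = {}"
| "vars_trm (Fun f ts) = (\<Union>t\<in>set ts. vars_trm t)"

primrec free_vars :: "('s, 'f, 'r, 'a) form \<Rightarrow> 's var set" where
  "free_vars (Eq t u) = vars_trm t \<union> vars_trm u"
| "free_vars (Rel R ts) = (\<Union>t\<in>set ts. vars_trm t)"
| "free_vars (Neg \<phi>) = free_vars \<phi>"
| "free_vars (Conj \<phi> \<psi>) = free_vars \<phi> \<union> free_vars \<psi>"
| "free_vars (Exists v \<phi>) = free_vars \<phi> - {v}"

fun params_trm :: "('s, 'f, 'a) trm \<Rightarrow> ('s, 'a) elem set" where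
  "params_trm (Var v) = {}"
| "params_trm (Param c) = {c}"
| "params_trm (Fun f ts) = (\<Union>t\<in>set ts. params_trm t)"

primrec params :: "('s, 'f, 'r, 'a) form \<Rightarrow> ('s, 'a) elem set" where
  "params (Eq t u) = params_trm t \<union> params_trm u"
| "params (Rel R ts) = (\<Union>t\<in>set ts. params_trm t)"
| "params (Neg \<phi>) = params \<phi>"
| "params (Conj \<phi> \<psi>) = params \<phi> \<union> params \<psi>"
| "params (Exists v \<phi>) = params \<phi>"

definition formulas ::
    "('s, 'f, 'r) language \<Rightarrow> ('s, 'a) elem set \<Rightarrow> 's var set \<Rightarrow> ('s, 'f, 'r, 'a) form set" where
  "formulas L A X = {\<phi>. wf_form L \<phi> \<and> params \<phi> \<subseteq> A \<and> free_vars \<phi> \<subseteq> X}"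

text \<open>
  \<open>inst b \<phi>\<close> is \<open>\<phi>(b)\<close>: the free variables in the domain of \<open>b\<close> are replaced by parameters. Finite
  tuples of elements are finite maps from the variables they are substituted for.
\<close>

fun inst_trm :: "('s var \<rightharpoonup> ('s, 'a) elem) \<Rightarrow> ('s, 'f, 'a) trm \<Rightarrow> ('s, 'f, 'a) trm" where
  "inst_trm b (Var v) = (case b v of None \<Rightarrow> Var v | Some c \<Rightarrow> Param c)"
| "inst_trm b (Param c) = Param c"
| "inst_trm b (Fun f ts) = Fun f (map (inst_trm b) ts)"

primrec inst :: "('s var \<rightharpoonup> ('s, 'a) elem) \<Rightarrow> ('s, 'f, 'r, 'a) form \<Rightarrow> ('s, 'f, 'r, 'a) form" where
  "inst b (Eq t u) = Eq (inst_trm b t) (inst_trm b u)"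
| "inst b (Rel R ts) = Rel R (map (inst_trm b) ts)"
| "inst b (Neg \<phi>) = Neg (inst b \<phi>)"
| "inst b (Conj \<phi> \<psi>) = Conj (inst b \<phi>) (inst b \<psi>)"
| "inst b (Exists v \<phi>) = Exists v (inst (b(v := None)) \<phi>)"

definition tuple :: "('s, 'a) elem set \<Rightarrow> ('s var \<rightharpoonup> ('s, 'a) elem) \<Rightarrow> bool" where
  "tuple A b \<longleftrightarrow> finite (dom b) \<and> (\<forall>v c. b v = Some c \<longrightarrow> c \<in> A \<and> fst c = fst v)"


record ('s, 'f, 'r, 'a) struct =
  univ :: "('s, 'a) elem set"
  fun_int :: "'f \<Rightarrow> ('s, 'a) elem list \<Rightarrow> ('s, 'a) elem"
  rel_int :: "'r \<Rightarrow> ('s, 'a) elem list \<Rightarrow> bool"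

definition is_structure :: "('s, 'f, 'r) language \<Rightarrow> ('s, 'f, 'r, 'a) struct \<Rightarrow> bool" where
  "is_structure L M \<longleftrightarrow>
     (\<forall>s. \<exists>c\<in>univ M. fst c = s) \<and>
     (\<forall>f\<in>fun_syms L. \<forall>cs. set cs \<subseteq> univ M \<longrightarrow> map fst cs = fun_dom L f \<longrightarrow>
        fun_int M f cs \<in> univ M \<and> fst (fun_int M f cs) = fun_cod L f)"

definition assignment :: "('s, 'f, 'r, 'a) struct \<Rightarrow> ('s var \<Rightarrow> ('s, 'a) elem) \<Rightarrow> bool" where
  "assignment M e \<longleftrightarrow> (\<forall>v. e v \<in> univ M \<and> fst (e v) = fst v)"

fun val :: "('s, 'f, 'r, 'a) struct \<Rightarrow> ('s var \<Rightarrow> ('s, 'a) elem) \<Rightarrow> ('s, 'f, 'a) trm \<Rightarrow> ('s, 'a) elem"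
where
  "val M e (Var v) = e v"
| "val M e (Param c) = c"
| "val M e (Fun f ts) = fun_int M f (map (val M e) ts)"

primrec sat ::
    "('s, 'f, 'r, 'a) struct \<Rightarrow> ('s var \<Rightarrow> ('s, 'a) elem) \<Rightarrow> ('s, 'f, 'r, 'a) form \<Rightarrow> bool" where
  "sat M e (Eq t u) \<longleftrightarrow> val M e t = val M e u"
| "sat M e (Rel R ts) \<longleftrightarrow> rel_int M R (map (val M e) ts)"
| "sat M e (Neg \<phi>) \<longleftrightarrow> \<not> sat M e \<phi>"
| "sat M e (Conj \<phi> \<psi>) \<longleftrightarrow> sat M e \<phi> \<and> sat M e \<psi>"
| "sat M e (Exists v \<phi>) \<longleftrightarrow> (\<exists>c\<in>univ M. fst c = fst v \<and> sat M (e(v := c)) \<phi>)"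

definition holds :: "('s, 'f, 'r, 'a) struct \<Rightarrow> ('s, 'f, 'r, 'a) form \<Rightarrow> bool"  (infix "\<Turnstile>" 50) where
  "M \<Turnstile> \<phi> \<longleftrightarrow> (\<forall>e. assignment M e \<longrightarrow> sat M e \<phi>)"

text \<open>Theories are taken to be closed under consequence.\<close>

definition complete_theory ::
    "('s, 'f, 'r) language \<Rightarrow> ('s, 'f, 'r, 'a) form set \<Rightarrow> bool" where
  "complete_theory L T \<longleftrightarrow>
     T \<subseteq> formulas L {} {} \<and> (\<forall>\<sigma>\<in>formulas L {} {}. \<sigma> \<in> T \<or> Neg \<sigma> \<in> T)"

definition models :: "('s, 'f, 'r, 'a) struct \<Rightarrow> ('s, 'f, 'r, 'a) form set \<Rightarrow> bool" where
  "models M T \<longleftrightarrow> (\<forall>\<sigma>\<in>T. M \<Turnstile> \<sigma>)"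

text \<open>A submodel is given by its universe.\<close>

definition elementary_submodel ::
    "('s, 'f, 'r) language \<Rightarrow> ('s, 'a) elem set \<Rightarrow> ('s, 'f, 'r, 'a) struct \<Rightarrow> bool" where
  "elementary_submodel L N M \<longleftrightarrow>
     N \<subseteq> univ M \<and> is_structure L (M\<lparr>univ := N\<rparr>) \<and>
     (\<forall>\<phi>\<in>formulas L N {}. M\<lparr>univ := N\<rparr> \<Turnstile> \<phi> \<longleftrightarrow> M \<Turnstile> \<phi>)"

definition finitely_satisfiable ::
    "('s, 'f, 'r, 'a) struct \<Rightarrow> ('s, 'f, 'r, 'a) form set \<Rightarrow> bool" where
  "finitely_satisfiable M \<Sigma> \<longleftrightarrow>
     (\<forall>F\<subseteq>\<Sigma>. finite F \<longrightarrow> (\<exists>e. assignment M e \<and> (\<forall>\<phi>\<in>F. sat M e \<phi>)))"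

definition complete_type ::
    "('s, 'f, 'r) language \<Rightarrow> ('s, 'f, 'r, 'a) struct \<Rightarrow> ('s, 'a) elem set \<Rightarrow> 's var set \<Rightarrow>
     ('s, 'f, 'r, 'a) form set \<Rightarrow> bool" where
  "complete_type L M A X p \<longleftrightarrow>
     p \<subseteq> formulas L A X \<and> finitely_satisfiable M p \<and>
     (\<forall>\<phi>\<in>formulas L A X. \<phi> \<in> p \<or> Neg \<phi> \<in> p)"

definition restrict_type ::
    "('s, 'f, 'r, 'a) form set \<Rightarrow> ('s, 'a) elem set \<Rightarrow> ('s, 'f, 'r, 'a) form set"
    (infixl "\<restriction>" 90) where
  "p \<restriction> A = {\<phi>\<in>p. params \<phi> \<subseteq> A}"

definition realizes ::
    "('s, 'f, 'r, 'a) struct \<Rightarrow> 's var \<Rightarrow> ('s, 'a) elem \<Rightarrow> ('s, 'f, 'r, 'a) form set \<Rightarrow> bool" where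
  "realizes M x a \<Sigma> \<longleftrightarrow> a \<in> univ M \<and> fst a = fst x \<and> (\<forall>\<phi>\<in>\<Sigma>. M \<Turnstile> inst [x \<mapsto> a] \<phi>)"

text \<open>
  Deduction from sets of formulas over a structure is modulo the elementary diagram of the
  structure; by compactness, finitely many hypotheses suffice.
\<close>

definition entails ::
    "('s, 'f, 'r, 'a) struct \<Rightarrow> ('s, 'f, 'r, 'a) form set \<Rightarrow> ('s, 'f, 'r, 'a) form \<Rightarrow> bool" where
  "entails M \<Sigma> \<psi> \<longleftrightarrow>
     (\<exists>F\<subseteq>\<Sigma>. finite F \<and> (\<forall>e. assignment M e \<longrightarrow> (\<forall>\<phi>\<in>F. sat M e \<phi>) \<longrightarrow> sat M e \<psi>))"


text \<open>Cardinals are represented, as in the library, by cardinal order relations.\<close>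

definition small :: "'k rel \<Rightarrow> 'b set \<Rightarrow> bool" where
  "small \<kappa> A \<longleftrightarrow> |A| <o \<kappa>"

definition saturated ::
    "('s, 'f, 'r) language \<Rightarrow> 'k rel \<Rightarrow> ('s, 'f, 'r, 'a) struct \<Rightarrow> bool" where
  "saturated L \<kappa> M \<longleftrightarrow>
     (\<forall>A x \<Sigma>. A \<subseteq> univ M \<longrightarrow> small \<kappa> A \<longrightarrow> \<Sigma> \<subseteq> formulas L A {x} \<longrightarrow>
        finitely_satisfiable M \<Sigma> \<longrightarrow> (\<exists>a. realizes M x a \<Sigma>))"

definition elementary_map ::
    "('s, 'f, 'r) language \<Rightarrow> ('s, 'f, 'r, 'a) struct \<Rightarrow> ('s, 'a) elem set \<Rightarrow>
     (('s, 'a) elem \<Rightarrow> ('s, 'a) elem) \<Rightarrow> bool" where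
  "elementary_map L M A g \<longleftrightarrow>
     (\<forall>a\<in>A. g a \<in> univ M \<and> fst (g a) = fst a) \<and>
     (\<forall>b \<phi>. tuple A b \<longrightarrow> \<phi> \<in> formulas L {} (dom b) \<longrightarrow>
        (M \<Turnstile> inst b \<phi> \<longleftrightarrow> M \<Turnstile> inst (map_option g \<circ> b) \<phi>))"

definition automorphism ::
    "('s, 'f, 'r) language \<Rightarrow> ('s, 'f, 'r, 'a) struct \<Rightarrow>
     (('s, 'a) elem \<Rightarrow> ('s, 'a) elem) \<Rightarrow> bool" where
  "automorphism L M g \<longleftrightarrow>
     bij_betw g (univ M) (univ M) \<and> (\<forall>a\<in>univ M. fst (g a) = fst a) \<and>
     (\<forall>f\<in>fun_syms L. \<forall>cs. set cs \<subseteq> univ M \<longrightarrow> map fst cs = fun_dom L f \<longrightarrow>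
        g (fun_int M f cs) = fun_int M f (map g cs)) \<and>
     (\<forall>R\<in>rel_syms L. \<forall>cs. set cs \<subseteq> univ M \<longrightarrow> map fst cs = rel_dom L R \<longrightarrow>
        rel_int M R (map g cs) = rel_int M R cs)"

definition strongly_homogeneous ::
    "('s, 'f, 'r) language \<Rightarrow> 'k rel \<Rightarrow> ('s, 'f, 'r, 'a) struct \<Rightarrow> bool" where
  "strongly_homogeneous L \<kappa> M \<longleftrightarrow>
     (\<forall>A g. A \<subseteq> univ M \<longrightarrow> small \<kappa> A \<longrightarrow> elementary_map L M A g \<longrightarrow>
        (\<exists>h. automorphism L M h \<and> (\<forall>a\<in>A. h a = g a)))"

text \<open>The set of all parameter-free formulas of \<open>L\<close> has cardinality \<open>|L| + \<aleph>\<^sub>0\<close>.\<close>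

definition monster_model ::
    "('s, 'f, 'r) language \<Rightarrow> ('s, 'f, 'r, 'a) form set \<Rightarrow> 'k rel \<Rightarrow>
     ('s, 'f, 'r, 'a) struct \<Rightarrow> bool" where
  "monster_model L T \<kappa> U \<longleftrightarrow>
     is_structure L U \<and> models U T \<and> Card_order \<kappa> \<and>
     small \<kappa> (formulas L {} UNIV :: ('s, 'f, 'r, 'a) form set) \<and>
     saturated L \<kappa> U \<and> strongly_homogeneous L \<kappa> U"


text \<open>
  In the following, \<open>U\<close> is the monster model and \<open>p\<close> is a global type in the variable \<open>x\<close>.
\<close>

definition global_type ::
    "('s, 'f, 'r) language \<Rightarrow> ('s, 'f, 'r, 'a) struct \<Rightarrow> 's var \<Rightarrow>
     ('s, 'f, 'r, 'a) form set \<Rightarrow> bool" where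
  "global_type L U x p \<longleftrightarrow> complete_type L U (univ U) {x} p"

definition same_type ::
    "('s, 'f, 'r) language \<Rightarrow> ('s, 'f, 'r, 'a) struct \<Rightarrow> ('s, 'a) elem set \<Rightarrow>
     ('s var \<rightharpoonup> ('s, 'a) elem) \<Rightarrow> ('s var \<rightharpoonup> ('s, 'a) elem) \<Rightarrow> bool" where
  "same_type L U A b1 b2 \<longleftrightarrow>
     dom b1 = dom b2 \<and> (\<forall>\<psi>\<in>formulas L A (dom b1). U \<Turnstile> inst b1 \<psi> \<longleftrightarrow> U \<Turnstile> inst b2 \<psi>)"

definition invariant_type ::
    "('s, 'f, 'r) language \<Rightarrow> ('s, 'f, 'r, 'a) struct \<Rightarrow> ('s, 'a) elem set \<Rightarrow> 's var \<Rightarrow>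
     ('s, 'f, 'r, 'a) form set \<Rightarrow> bool" where
  "invariant_type L U A x p \<longleftrightarrow>
     (\<forall>b1 b2 \<phi>. tuple (univ U) b1 \<longrightarrow> tuple (univ U) b2 \<longrightarrow> same_type L U A b1 b2 \<longrightarrow>
        x \<notin> dom b1 \<longrightarrow> \<phi> \<in> formulas L A (insert x (dom b1)) \<longrightarrow>
        (inst b1 \<phi> \<in> p \<longleftrightarrow> inst b2 \<phi> \<in> p))"

definition nonalgebraic ::
    "('s, 'f, 'r, 'a) struct \<Rightarrow> 's var \<Rightarrow> ('s, 'f, 'r, 'a) form set \<Rightarrow> bool" where
  "nonalgebraic U x p \<longleftrightarrow> (\<forall>\<phi>\<in>p. infinite {a. realizes U x a {\<phi>}})"

text \<open>
  Ordinals indexing sequences are represented by well-orders \<open>r\<close>, with \<open>underS r i\<close> the set of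
  strict predecessors of \<open>i\<close>.
\<close>

definition morley_sequence ::
    "('s, 'f, 'r, 'a) struct \<Rightarrow> ('s, 'a) elem set \<Rightarrow> 's var \<Rightarrow> ('s, 'f, 'r, 'a) form set \<Rightarrow>
     'i rel \<Rightarrow> ('i \<Rightarrow> ('s, 'a) elem) \<Rightarrow> bool" where
  "morley_sequence U A x p r a \<longleftrightarrow>
     (\<forall>i\<in>Field r. realizes U x (a i) (p \<restriction> (A \<union> a ` underS r i)))"

text \<open>
  The members of a Morley sequence in a non-algebraic invariant type are pairwise distinct, so
  every infinite ordinal indexing one is the order type of a well-order on a set of elements.
  Hence it is no restriction that the index type is the type of elements.
\<close>

definition generically_stable ::
    "('s, 'f, 'r) language \<Rightarrow> 'k rel \<Rightarrow> ('s, 'f, 'r, 'a) struct \<Rightarrow> 's var \<Rightarrow>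
     ('s, 'f, 'r, 'a) form set \<Rightarrow> bool" where
  "generically_stable L \<kappa> U x p \<longleftrightarrow>
     nonalgebraic U x p \<and>
     (\<exists>A\<subseteq>univ U. small \<kappa> A \<and> invariant_type L U A x p \<and>
        (\<forall>(r :: ('s, 'a) elem rel) a.
           Well_order r \<longrightarrow> infinite (Field r) \<longrightarrow> morley_sequence U A x p r a \<longrightarrow>
           (\<forall>\<phi>\<in>formulas L (univ U) {x}.
              finite {i\<in>Field r. U \<Turnstile> inst [x \<mapsto> a i] \<phi>} \<or>
              finite (Field r - {i\<in>Field r. U \<Turnstile> inst [x \<mapsto> a i] \<phi>}))))"

definition invariant_pair ::
    "('s, 'f, 'r) language \<Rightarrow> ('s, 'f, 'r, 'a) struct \<Rightarrow> ('s, 'a) elem set \<Rightarrow> 's var \<Rightarrow>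
     ('s, 'f, 'r, 'a) form set \<Rightarrow> ('s, 'f, 'r, 'a) form \<Rightarrow> bool" where
  "invariant_pair L U A x p \<phi> \<longleftrightarrow> invariant_type L U A x p \<and> \<phi> \<in> p \<restriction> A"

definition strongly_regular ::
    "('s, 'f, 'r) language \<Rightarrow> 'k rel \<Rightarrow> ('s, 'f, 'r, 'a) struct \<Rightarrow> 's var \<Rightarrow>
     ('s, 'f, 'r, 'a) form set \<Rightarrow> ('s, 'f, 'r, 'a) form \<Rightarrow> bool" where
  "strongly_regular L \<kappa> U x p \<phi> \<longleftrightarrow>
     (\<exists>A\<subseteq>univ U. small \<kappa> A \<and> invariant_pair L U A x p \<phi> \<and>
        (\<forall>B a. A \<subseteq> B \<longrightarrow> B \<subseteq> univ U \<longrightarrow> small \<kappa> B \<longrightarrow> realizes U x a {\<phi>} \<longrightarrow>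
           realizes U x a (p \<restriction> B) \<or> (\<forall>\<psi>\<in>p \<restriction> insert a B. entails U (p \<restriction> B) \<psi>)))"

definition weakly_orthogonal ::
    "('s, 'f, 'r) language \<Rightarrow> ('s, 'f, 'r, 'a) struct \<Rightarrow> ('s, 'a) elem set \<Rightarrow>
     's var \<Rightarrow> ('s, 'f, 'r, 'a) form set \<Rightarrow> 's var \<Rightarrow> ('s, 'f, 'r, 'a) form set \<Rightarrow> bool" where
  "weakly_orthogonal L U A x p y q \<longleftrightarrow>
     complete_type L U A {x, y} {\<psi>\<in>formulas L A {x, y}. entails U (p \<union> q) \<psi>}"

definition orthogonal ::
    "('s, 'f, 'r) language \<Rightarrow> ('s, 'f, 'r, 'a) struct \<Rightarrow>
     's var \<Rightarrow> ('s, 'f, 'r, 'a) form set \<Rightarrow> 's var \<Rightarrow> ('s, 'f, 'r, 'a) form set \<Rightarrow> bool" where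
  "orthogonal L U x p y q \<longleftrightarrow> weakly_orthogonal L U (univ U) x p y q"

end

theory Submission
  imports Defs
begin

text \<open>
  A generically stable type that is invariant over \<open>M\<close> is definable over \<open>M\<close>, and it commutes with
  itself. Definability gives the passage from global orthogonality to weak orthogonality over
  \<open>M\<close>: the parameters of the formulas that decide a given formula over \<open>M\<close> can be chosen in \<open>M\<close>.

  Conversely, let \<open>\<psi>(x, y, d)\<close> witness that \<open>\<pp>\<close> and \<open>\<qq>\<close> are not orthogonal: over a small set
  \<open>B\<close> containing everything relevant there are \<open>a \<Turnstile> \<pp> \<restriction> B\<close> and \<open>b \<Turnstile> \<qq> \<restriction> B\<close> with \<open>\<psi>(a, b, d)\<close>
  and \<open>\<psi>(a, y, d) \<notin> \<qq>\<close>. By definability of \<open>\<qq>\<close> there are \<open>m\<close> in \<open>M\<close> and \<open>a'\<close> in \<open>\<phi>\<^sub>\<pp>\<close> with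
  \<open>\<psi>(a', b, m)\<close> and \<open>\<psi>(a', y, m) \<notin> \<qq>\<close>. Weak orthogonality over \<open>C\<close> prevents \<open>a'\<close> from realizing
  \<open>\<pp> \<restriction> C\<close>, so \<open>\<pp> \<restriction> B \<turnstile> \<pp> \<restriction> Ba'\<close> by strong regularity of \<open>\<pp>\<close>. Thus \<open>b\<close> depends over \<open>B\<close> on \<open>a\<close>
  and on \<open>a'\<close>, which are orthogonal over \<open>B\<close>. Strong regularity of \<open>\<qq>\<close> turns this into an infinite
  Morley sequence in \<open>\<qq>\<close> over \<open>B\<close> all of whose members depend on \<open>a\<close>, against generic stability.
\<close>

text \<open>Both properties of \<open>q\<close> rest on one consequence of generic stability: a
  formula outside \<open>q\<close> holds at only finitely many members of a Morley sequence over
  \<open>A\<close>. Definability then comes from compactness, and symmetry from copying one failure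
  of symmetry to infinitely many pairs. The obstacle is that the sets witnessing generic stability
  and strong regularity, and the parameters of \<open>\<psi>\<close>, need not lie in
  \<open>C\<close>, where alone weak orthogonality is known. Hence the dependence is rewritten with
  parameters in \<open>M\<close>. The price is that \<open>a'\<close> comes from an existential
  quantifier, with only \<open>\<phi>\<^sub>p(a')\<close> known about its relation to
  \<open>p\<close>. If \<open>a'\<close> realizes \<open>p\<close> over \<open>C\<close>, then
  \<open>b\<close> and a realization of \<open>q\<close> over \<open>Ba'\<close> have the same type
  over \<open>C\<close> but are separated by a formula over \<open>M\<close> and \<open>a'\<close>,
  against weak orthogonality. If not, strong regularity applies even over \<open>B\<close>. Symmetry
  is needed because strong regularity of \<open>q\<close> only makes the earlier members of the
  sequence independent from the new one, whereas a Morley sequence requires the converse.\<close>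

subsection \<open>Substitution for parameters\<close>

text \<open>Variables and elements are pairs, but there is never a need to take them apart.\<close>

declare split_paired_All [simp del] split_paired_Ex [simp del]

text \<open>Arbitrary terms are allowed so that one function covers maps acting on parameters,
  abstraction of parameters by variables, and mixtures of the two. Bound variables are never
  renamed; capture is excluded by side conditions.\<close>

fun psub_trm ::
    "(('s, 'a) elem \<Rightarrow> ('s, 'f, 'a) trm) \<Rightarrow> ('s, 'f, 'a) trm \<Rightarrow> ('s, 'f, 'a) trm" where
  "psub_trm s (Var v) = Var v"
| "psub_trm s (Param c) = s c"
| "psub_trm s (Fun f ts) = Fun f (map (psub_trm s) ts)"

primrec psub ::
    "(('s, 'a) elem \<Rightarrow> ('s, 'f, 'a) trm) \<Rightarrow> ('s, 'f, 'r, 'a) form \<Rightarrow> ('s, 'f, 'r, 'a) form" where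
  "psub s (Eq t u) = Eq (psub_trm s t) (psub_trm s u)"
| "psub s (Rel R ts) = Rel R (map (psub_trm s) ts)"
| "psub s (Neg \<phi>) = Neg (psub s \<phi>)"
| "psub s (Conj \<phi> \<psi>) = Conj (psub s \<phi>) (psub s \<psi>)"
| "psub s (Exists v \<phi>) = Exists v (psub s \<phi>)"

abbreviation pmap ::
    "(('s, 'a) elem \<Rightarrow> ('s, 'a) elem) \<Rightarrow> ('s, 'f, 'r, 'a) form \<Rightarrow> ('s, 'f, 'r, 'a) form" where
  "pmap h \<equiv> psub (\<lambda>c. Param (h c))"

text \<open>Bound variables are included: a variable outside this set can be inserted anywhere in
  the formula without being captured.\<close>

primrec all_vars :: "('s, 'f, 'r, 'a) form \<Rightarrow> 's var set" where
  "all_vars (Eq t u) = vars_trm t \<union> vars_trm u"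
| "all_vars (Rel R ts) = (\<Union>t\<in>set ts. vars_trm t)"
| "all_vars (Neg \<phi>) = all_vars \<phi>"
| "all_vars (Conj \<phi> \<psi>) = all_vars \<phi> \<union> all_vars \<psi>"
| "all_vars (Exists v \<phi>) = insert v (all_vars \<phi>)"

definition override ::
    "('s var \<Rightarrow> ('s, 'a) elem) \<Rightarrow> ('s var \<rightharpoonup> ('s, 'a) elem) \<Rightarrow> 's var \<Rightarrow> ('s, 'a) elem" where
  "override e b v = (case b v of None \<Rightarrow> e v | Some c \<Rightarrow> c)"

section \<open>Free variables, satisfaction and instantiation\<close>

lemma finite_vars_trm: "finite (vars_trm t)"
  by (induction t) auto

lemma finite_all_vars: "finite (all_vars \<phi>)"
  by (induction \<phi>) (auto simp: finite_vars_trm)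

lemma free_vars_subset_all_vars: "free_vars \<phi> \<subseteq> all_vars \<phi>"
  by (induction \<phi>) auto

lemma finite_params_trm: "finite (params_trm t)"
  by (induction t) auto

lemma finite_params: "finite (params \<phi>)"
  by (induction \<phi>) (auto simp: finite_params_trm)

lemma val_cong: "(\<And>v. v \<in> vars_trm t \<Longrightarrow> e v = e' v) \<Longrightarrow> val M e t = val M e' t"
proof (induction t)
  case (Fun f ts)
  have "map (val M e) ts = map (val M e') ts"
    by (rule map_cong[OF refl], rule Fun.IH) (use Fun.prems in auto)
  then show ?case by (simp only: val.simps)
qed auto

lemma map_val_cong:
  "(\<And>v. v \<in> (\<Union>t\<in>set ts. vars_trm t) \<Longrightarrow> e v = e' v) \<Longrightarrow> map (val M e) ts = map (val M e') ts"
  by (rule map_cong[OF refl], rule val_cong) auto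

lemma sat_cong: "(\<And>v. v \<in> free_vars \<phi> \<Longrightarrow> e v = e' v) \<Longrightarrow> sat M e \<phi> = sat M e' \<phi>"
proof (induction \<phi> arbitrary: e e')
  case (Eq t u)
  then have "val M e t = val M e' t" "val M e u = val M e' u"
    by (auto intro!: val_cong)
  then show ?case by simp
next
  case (Rel R ts)
  then have "map (val M e) ts = map (val M e') ts" by (intro map_val_cong) auto
  then show ?case by (simp only: sat.simps)
next
  case (Neg \<phi>)
  have "sat M e \<phi> = sat M e' \<phi>" by (rule Neg.IH) (use Neg.prems in auto)
  then show ?case by simp
next
  case (Conj \<phi> \<psi>)
  have "sat M e \<phi> = sat M e' \<phi>" by (rule Conj.IH) (use Conj.prems in auto)
  moreover have "sat M e \<psi> = sat M e' \<psi>" by (rule Conj.IH) (use Conj.prems in auto)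
  ultimately show ?case by simp
next
  case (Exists v \<phi>)
  have "sat M (e(v := c)) \<phi> = sat M (e'(v := c)) \<phi>" for c
    by (rule Exists.IH) (use Exists.prems in auto)
  then show ?case by simp
qed

lemma val_inst: "val M e (inst_trm b t) = val M (override e b) t"
  by (induction t) (auto simp: override_def split: option.splits intro!: arg_cong[where f = "fun_int M _"])

lemma map_val_inst: "map (val M e) (map (inst_trm b) ts) = map (val M (override e b)) ts"
  by (simp add: val_inst)

lemma sat_inst: "sat M e (inst b \<phi>) = sat M (override e b) \<phi>"
proof (induction \<phi> arbitrary: e b)
  case (Rel R ts)
  show ?case by (simp only: inst.simps sat.simps map_val_inst)
next
  case (Exists v \<phi>)
  have "override (e(v := c)) (b(v := None)) = (override e b)(v := c)" for c
    by (rule ext) (simp add: override_def split: option.split)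
  then show ?case by (simp add: Exists del: fun_upd_apply)
qed (simp_all add: val_inst)

lemma override_single: "override e [x \<mapsto> a] = e(x := a)"
  by (auto simp: override_def fun_eq_iff)

lemma inst_trm_cong: "(\<And>v. v \<in> vars_trm t \<Longrightarrow> b v = b' v) \<Longrightarrow> inst_trm b t = inst_trm b' t"
  by (induction t) auto

lemma inst_cong: "(\<And>v. v \<in> free_vars \<phi> \<Longrightarrow> b v = b' v) \<Longrightarrow> inst b \<phi> = inst b' \<phi>"
proof (induction \<phi> arbitrary: b b')
  case (Eq t u)
  then show ?case by (auto intro!: inst_trm_cong)
next
  case (Rel R ts)
  then show ?case by (auto intro!: inst_trm_cong)
next
  case (Neg \<phi>)
  have "inst b \<phi> = inst b' \<phi>" by (rule Neg.IH) (use Neg.prems in auto)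
  then show ?case by simp
next
  case (Conj \<phi> \<psi>)
  have "inst b \<phi> = inst b' \<phi>" by (rule Conj.IH) (use Conj.prems in auto)
  moreover have "inst b \<psi> = inst b' \<psi>" by (rule Conj.IH) (use Conj.prems in auto)
  ultimately show ?case by simp
next
  case (Exists v \<phi>)
  have "inst (b(v := None)) \<phi> = inst (b'(v := None)) \<phi>"
    by (rule Exists.IH) (use Exists.prems in auto)
  then show ?case by simp
qed

lemma sort_of_inst_trm:
  "(\<And>v c. b v = Some c \<Longrightarrow> fst c = fst v) \<Longrightarrow> sort_of L (inst_trm b t) = sort_of L t"
  by (cases t) (auto split: option.splits)

lemma wf_inst_trm:
  assumes "\<And>v c. b v = Some c \<Longrightarrow> fst c = fst v" "wf_trm L t"
  shows "wf_trm L (inst_trm b t)"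
  using assms(2)
proof (induction t)
  case (Fun f ts)
  have "map (sort_of L) (map (inst_trm b) ts) = map (sort_of L) ts"
    by (simp add: sort_of_inst_trm[OF assms(1)])
  then show ?case using Fun by (auto simp del: map_map)
qed (auto split: option.splits)

lemma wf_inst:
  assumes "\<And>v c. b v = Some c \<Longrightarrow> fst c = fst v" "wf_form L \<phi>"
  shows "wf_form L (inst b \<phi>)"
  using assms
proof (induction \<phi> arbitrary: b)
  case (Eq t u)
  then show ?case by (simp add: wf_inst_trm sort_of_inst_trm)
next
  case (Rel R ts)
  have "map (sort_of L) (map (inst_trm b) ts) = map (sort_of L) ts"
    by (simp add: sort_of_inst_trm[OF Rel(1)])
  then show ?case using Rel by (auto simp del: map_map simp: wf_inst_trm)
next
  case (Exists v \<phi>)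
  have "wf_form L (inst (b(v := None)) \<phi>)"
    by (rule Exists.IH) (use Exists.prems in \<open>auto split: if_splits\<close>)
  then show ?case by simp
qed auto

lemma params_inst_trm:
  "params_trm (inst_trm b t) \<subseteq> params_trm t \<union> {c. \<exists>v\<in>vars_trm t. b v = Some c}"
proof (induction t)
  case (Fun f ts)
  then show ?case by simp blast
qed (auto split: option.splits)

lemma params_inst: "params (inst b \<phi>) \<subseteq> params \<phi> \<union> {c. \<exists>v\<in>free_vars \<phi>. b v = Some c}"
proof (induction \<phi> arbitrary: b)
  case (Eq t u)
  then show ?case using params_inst_trm[of b t] params_inst_trm[of b u] by auto
next
  case (Rel R ts)
  show ?case using params_inst_trm[of b] by simp blast
next
  case (Neg \<phi>)
  then show ?case by simp
next
  case (Conj \<phi> \<psi>)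
  show ?case using Conj.IH(1)[of b] Conj.IH(2)[of b] by simp blast
next
  case (Exists v \<phi>)
  have "{c. \<exists>w\<in>free_vars \<phi>. (b(v := None)) w = Some c} \<subseteq>
      {c. \<exists>w\<in>free_vars \<phi> - {v}. b w = Some c}"
    by (auto split: if_splits simp del: Product_Type.split_paired_Ex split_paired_All)
  then show ?case using Exists.IH[of "b(v := None)"]
    by (simp del: fun_upd_apply) blast
qed

lemma vars_inst_trm: "vars_trm (inst_trm b t) = vars_trm t - dom b"
  by (induction t) (auto split: option.splits)

lemma free_vars_inst: "free_vars (inst b \<phi>) = free_vars \<phi> - dom b"
  by (induction \<phi> arbitrary: b) (auto simp: vars_inst_trm split: if_splits)

lemma inst_formulas:
  assumes "\<phi> \<in> formulas L A X" "\<And>v c. b v = Some c \<Longrightarrow> fst c = fst v"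
    "\<And>v c. v \<in> free_vars \<phi> \<Longrightarrow> b v = Some c \<Longrightarrow> c \<in> B" "A \<subseteq> B" "X - dom b \<subseteq> Y"
  shows "inst b \<phi> \<in> formulas L B Y"
proof -
  have "wf_form L (inst b \<phi>)"
    using assms(1,2) by (intro wf_inst) (auto simp: formulas_def)
  moreover have "params (inst b \<phi>) \<subseteq> B"
    using params_inst[of b \<phi>] assms(1,3,4) unfolding formulas_def by blast
  moreover have "free_vars (inst b \<phi>) \<subseteq> Y"
    using assms(1,5) unfolding free_vars_inst formulas_def by blast
  ultimately show ?thesis by (simp add: formulas_def)
qed

section \<open>Terms and maps substituted for parameters\<close>

lemma sort_of_psub_trm:
  "(\<And>c. c \<in> params_trm t \<Longrightarrow> sort_of L (s c) = fst c) \<Longrightarrow> sort_of L (psub_trm s t) = sort_of L t"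
  by (cases t) auto

lemma wf_psub_trm:
  assumes "\<And>c. c \<in> params_trm t \<Longrightarrow> sort_of L (s c) = fst c \<and> wf_trm L (s c)" "wf_trm L t"
  shows "wf_trm L (psub_trm s t)"
  using assms
proof (induction t)
  case (Fun f ts)
  have "map (sort_of L) (map (psub_trm s) ts) = map (sort_of L) ts"
    using Fun.prems(1) by (auto intro!: sort_of_psub_trm)
  moreover have "wf_trm L (psub_trm s t)" if "t \<in> set ts" for t
    using that Fun by auto
  ultimately show ?case using Fun by (auto simp del: map_map)
qed auto

lemma wf_psub:
  assumes "\<And>c. c \<in> params \<phi> \<Longrightarrow> sort_of L (s c) = fst c \<and> wf_trm L (s c)" "wf_form L \<phi>"
  shows "wf_form L (psub s \<phi>)"
  using assms
proof (induction \<phi>)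
  case (Eq t u)
  have "sort_of L (psub_trm s t) = sort_of L t" "sort_of L (psub_trm s u) = sort_of L u"
    by (rule sort_of_psub_trm; use Eq.prems in force)+
  moreover have "wf_trm L (psub_trm s t)" "wf_trm L (psub_trm s u)"
    using Eq by (auto intro!: wf_psub_trm)
  ultimately show ?case using Eq.prems(2) by simp
next
  case (Rel R ts)
  have "map (sort_of L) (map (psub_trm s) ts) = map (sort_of L) ts"
    using Rel.prems(1) by (auto intro!: sort_of_psub_trm)
  then show ?case using Rel by (auto simp del: map_map intro!: wf_psub_trm)
qed auto

lemma params_psub_trm: "params_trm (psub_trm s t) = (\<Union>c\<in>params_trm t. params_trm (s c))"
  by (induction t) auto

lemma params_psub: "params (psub s \<phi>) = (\<Union>c\<in>params \<phi>. params_trm (s c))"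
  by (induction \<phi>) (auto simp: params_psub_trm)

lemma vars_psub_trm: "vars_trm (psub_trm s t) = vars_trm t \<union> (\<Union>c\<in>params_trm t. vars_trm (s c))"
  by (induction t) auto

lemma free_vars_psub: "free_vars (psub s \<phi>) \<subseteq> free_vars \<phi> \<union> (\<Union>c\<in>params \<phi>. vars_trm (s c))"
  by (induction \<phi>) (auto simp: vars_psub_trm)

lemma pmap_formulas:
  assumes "\<phi> \<in> formulas L A X" "\<And>c. c \<in> A \<Longrightarrow> fst (h c) = fst c" "h ` A \<subseteq> B"
  shows "pmap h \<phi> \<in> formulas L B X"
proof -
  have "wf_form L (pmap h \<phi>)"
    using assms(1,2) by (intro wf_psub) (auto simp: formulas_def)
  moreover have "params (pmap h \<phi>) \<subseteq> B"
    using assms(1,3) by (auto simp: formulas_def params_psub)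
  moreover have "free_vars (pmap h \<phi>) \<subseteq> X"
    using assms(1) free_vars_psub[of "\<lambda>c. Param (h c)" \<phi>] by (auto simp: formulas_def)
  ultimately show ?thesis by (simp add: formulas_def)
qed

lemma psub_trm_cong: "(\<And>c. c \<in> params_trm t \<Longrightarrow> s c = s' c) \<Longrightarrow> psub_trm s t = psub_trm s' t"
  by (induction t) auto

lemma psub_cong: "(\<And>c. c \<in> params \<phi> \<Longrightarrow> s c = s' c) \<Longrightarrow> psub s \<phi> = psub s' \<phi>"
  by (induction \<phi>) (auto intro!: psub_trm_cong)

lemma pmap_trm_id: "(\<And>c. c \<in> params_trm t \<Longrightarrow> h c = c) \<Longrightarrow> psub_trm (\<lambda>c. Param (h c)) t = t"
  by (induction t) (auto intro!: map_idI)

lemma pmap_id: "(\<And>c. c \<in> params \<phi> \<Longrightarrow> h c = c) \<Longrightarrow> pmap h \<phi> = \<phi>"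
  by (induction \<phi>) (auto intro!: pmap_trm_id map_idI)

lemma pmap_trm_comp:
  "psub_trm (\<lambda>c. Param (h c)) (psub_trm (\<lambda>c. Param (k c)) t) = psub_trm (\<lambda>c. Param (h (k c))) t"
  by (induction t) auto

lemma pmap_comp: "pmap h (pmap k \<phi>) = pmap (\<lambda>c. h (k c)) \<phi>"
  by (induction \<phi>) (auto simp: pmap_trm_comp)

lemma pmap_inst_trm:
  "psub_trm (\<lambda>c. Param (h c)) (inst_trm b t) =
    inst_trm (map_option h \<circ> b) (psub_trm (\<lambda>c. Param (h c)) t)"
  by (induction t) (auto split: option.splits)

text \<open>If \<open>h\<close> fixes the parameters of \<open>\<phi>\<close>, this makes
  \<open>pmap h\<close> act on the inserted tuple alone.\<close>

lemma pmap_inst: "pmap h (inst b \<phi>) = inst (map_option h \<circ> b) (pmap h \<phi>)"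
proof (induction \<phi> arbitrary: b)
  case (Exists v \<phi>)
  have "map_option h \<circ> b(v := None) = (map_option h \<circ> b)(v := None)"
    by (auto simp: fun_eq_iff)
  then show ?case using Exists[of "b(v := None)"] by (simp del: fun_upd_apply o_apply)
qed (auto simp: pmap_inst_trm)

lemma inst_psub_trm:
  assumes "\<And>c. c \<in> params_trm t \<Longrightarrow> inst_trm b (s c) = Param (h c)" "dom b \<inter> vars_trm t = {}"
  shows "inst_trm b (psub_trm s t) = psub_trm (\<lambda>c. Param (h c)) t"
  using assms
proof (induction t)
  case (Fun f ts)
  have "inst_trm b (psub_trm s t) = psub_trm (\<lambda>c. Param (h c)) t" if "t \<in> set ts" for t
    using that Fun.prems by (intro Fun.IH) auto
  then show ?case by simp
qed (auto split: option.splits)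

text \<open>Serves to undo an abstraction by fresh variables. Sending them back to the old elements
  recovers \<open>\<phi>\<close>; sending them to the images under an automorphism gives the
  conjugate formula.\<close>

lemma inst_psub:
  assumes "\<And>c. c \<in> params \<phi> \<Longrightarrow> inst_trm b (s c) = Param (h c)" "dom b \<inter> all_vars \<phi> = {}"
  shows "inst b (psub s \<phi>) = pmap h \<phi>"
  using assms
proof (induction \<phi>)
  case (Rel R ts)
  have "inst_trm b (psub_trm s t) = psub_trm (\<lambda>c. Param (h c)) t" if "t \<in> set ts" for t
    using that Rel.prems by (intro inst_psub_trm) auto
  then show ?case by simp
next
  case (Eq t u)
  then show ?case by (auto intro!: inst_psub_trm)
next
  case (Conj \<phi> \<psi>)
  then show ?case by auto
next
  case (Exists v \<phi>)
  then have "b(v := None) = b" by (auto simp: fun_eq_iff)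
  then show ?case using Exists by auto
qed auto

lemma val_psub:
  "val M e (psub_trm s t) = val M e (psub_trm (\<lambda>c. Param (val M e (s c))) t)"
  by (induction t) (auto intro!: arg_cong[where f = "fun_int M _"])

text \<open>No quantifier of \<open>\<phi>\<close> binds a variable of an inserted term, so the
  values of these terms stay constant throughout the recursion.\<close>

lemma sat_psub:
  assumes "\<And>c. c \<in> params \<phi> \<Longrightarrow> vars_trm (s c) \<inter> all_vars \<phi> = {}"
  shows "sat M e (psub s \<phi>) = sat M e (pmap (\<lambda>c. val M e (s c)) \<phi>)"
  using assms
proof (induction \<phi> arbitrary: e)
  case (Eq t u)
  show ?case by (simp add: val_psub[of M e s])
next
  case (Rel R ts)
  have "map (val M e) (map (psub_trm s) ts) =
      map (val M e) (map (psub_trm (\<lambda>c. Param (val M e (s c)))) ts)"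
    by (simp add: val_psub[of M e s])
  then show ?case by (simp only: psub.simps sat.simps)
next
  case (Neg \<phi>)
  then show ?case by simp
next
  case (Conj \<phi> \<psi>)
  have "sat M e (psub s \<phi>) = sat M e (pmap (\<lambda>c. val M e (s c)) \<phi>)"
    "sat M e (psub s \<psi>) = sat M e (pmap (\<lambda>c. val M e (s c)) \<psi>)"
    by (rule Conj.IH, use Conj.prems in \<open>simp; blast\<close>)+
  then show ?case by simp
next
  case (Exists v \<phi>)
  have "sat M (e(v := d)) (psub s \<phi>) = sat M (e(v := d)) (pmap (\<lambda>c. val M e (s c)) \<phi>)" for d
  proof -
    have "sat M (e(v := d)) (psub s \<phi>) = sat M (e(v := d)) (pmap (\<lambda>c. val M (e(v := d)) (s c)) \<phi>)"
      by (rule Exists.IH) (use Exists.prems in \<open>simp; blast\<close>)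
    also have "pmap (\<lambda>c. val M (e(v := d)) (s c)) \<phi> = pmap (\<lambda>c. val M e (s c)) \<phi>"
    proof (rule psub_cong)
      fix c assume "c \<in> params \<phi>"
      then have "v \<notin> vars_trm (s c)" using Exists.prems[of c] by auto
      then show "Param (val M (e(v := d)) (s c)) = Param (val M e (s c))"
        by (auto intro!: val_cong)
    qed
    finally show ?thesis .
  qed
  then show ?case by simp
qed

lemma fresh_variables:
  fixes P :: "('s, 'a) elem set" and V :: "'s var set"
  assumes "finite P" "finite V"
  shows "\<exists>g. inj_on g P \<and> (\<forall>c. fst (g c) = fst c) \<and> (\<forall>c. g c \<notin> V)"
proof -
  obtain f :: "('s, 'a) elem \<Rightarrow> nat" where f: "inj_on f P"
    using finite_imp_inj_to_nat_seg[OF assms(1)] by blast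
  obtain k where k: "\<And>v. v \<in> V \<Longrightarrow> snd v \<le> k"
    using finite_nat_set_iff_bounded_le[of "snd ` V"] assms(2) by auto
  \<comment> \<open>Keeping the sort makes the variable substitutable for the element;
    \<open>f\<close> separates elements, and the offset lifts the index above every index in
    \<open>V\<close>.\<close>
  have "inj_on (\<lambda>c. (fst c, Suc (k + f c))) P" using f by (auto simp: inj_on_def)
  moreover have "(fst c, Suc (k + f c)) \<notin> V" for c using k by fastforce
  ultimately show ?thesis by (intro exI[of _ "\<lambda>c. (fst c, Suc (k + f c))"]) simp
qed

text \<open>Morley sequences constrain each member by the set of all earlier ones. The recursion
  therefore carries the list of earlier values, and the hypothesis may assume that these were
  already well chosen.\<close>

lemma nat_history_choice:
  assumes "\<And>n (s :: nat \<Rightarrow> 'b). (\<And>i. i < n \<Longrightarrow> Q (s ` {..<i}) (s i)) \<Longrightarrow> \<exists>a. Q (s ` {..<n}) a"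
  obtains s :: "nat \<Rightarrow> 'b" where "\<And>n. Q (s ` {..<n}) (s n)"
proof -
  define l where "l = rec_nat [] (\<lambda>_ xs. xs @ [SOME a. Q (set xs) a])"
  define s where "s n = (SOME a. Q (set (l n)) a)" for n
  have l: "set (l n) = s ` {..<n}" for n
    by (induction n) (auto simp: l_def s_def lessThan_Suc)
  have "Q (s ` {..<n}) (s n)" for n
  proof (induction n rule: less_induct)
    case (less n)
    then have "\<exists>a. Q (s ` {..<n}) a" by (rule assms)
    then show ?case unfolding s_def[of n] l by (rule someI_ex)
  qed
  then show thesis by (rule that)
qed


lemma formulas_params_mono: "\<phi> \<in> formulas L A X \<Longrightarrow> A \<subseteq> B \<Longrightarrow> \<phi> \<in> formulas L B X"
  by (auto simp: formulas_def)

lemma formulas_simps [simp]: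
  "Neg \<phi> \<in> formulas L A X \<longleftrightarrow> \<phi> \<in> formulas L A X"
  "Conj \<phi> \<psi> \<in> formulas L A X \<longleftrightarrow> \<phi> \<in> formulas L A X \<and> \<psi> \<in> formulas L A X"
  "Exists v \<phi> \<in> formulas L A X \<longleftrightarrow> \<phi> \<in> formulas L A (insert v X)"
  by (auto simp: formulas_def)

subsection \<open>Automorphisms and saturation of the monster model\<close>

locale monster =
  fixes L :: "('s, 'f, 'r) language"
    and T :: "('s, 'f, 'r, 'a) form set"
    and \<kappa> :: "'k rel"
    and U :: "('s, 'f, 'r, 'a) struct"
  assumes monster: "monster_model L T \<kappa> U"
begin

text \<open>A default assignment: it serves to evaluate sentences, and formulas whose free variables
  are reassigned explicitly.\<close>

definition e0 :: "'s var \<Rightarrow> ('s, 'a) elem" where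
  "e0 = (SOME e. assignment U e)"

lemma U_structure: "is_structure L U"
  using monster by (simp add: monster_model_def)

lemma assignment_e0: "assignment U e0"
proof -
  have "assignment U (\<lambda>v. SOME c. c \<in> univ U \<and> fst c = fst v)"
    unfolding assignment_def
  proof
    fix v :: "'s var"
    have "\<exists>c. c \<in> univ U \<and> fst c = fst v"
      using U_structure unfolding is_structure_def by blast
    then show "(SOME c. c \<in> univ U \<and> fst c = fst v) \<in> univ U \<and>
        fst (SOME c. c \<in> univ U \<and> fst c = fst v) = fst v"
      by (rule someI_ex)
  qed
  then show ?thesis unfolding e0_def by (rule someI[of "assignment U"])
qed

lemma assignment_upd:
  "assignment U e \<Longrightarrow> c \<in> univ U \<Longrightarrow> fst c = fst v \<Longrightarrow> assignment U (e(v := c))"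
  by (auto simp: assignment_def)

text \<open>\<open>\<kappa>\<close> exceeds the number of formulas, and the variables of a single
  sort already give infinitely many. Hence countable Morley sequences can be added to small
  parameter sets.\<close>

lemma small_nat: "small \<kappa> (UNIV :: nat set)"
proof -
  have "inj (\<lambda>n :: nat. Eq (Var (undefined, n)) (Var (undefined, n)) :: ('s, 'f, 'r, 'a) form)"
    by (auto simp: inj_def)
  moreover have "(\<lambda>n :: nat. Eq (Var (undefined, n)) (Var (undefined, n))) ` UNIV
      \<subseteq> (formulas L {} UNIV :: ('s, 'f, 'r, 'a) form set)"
    by (auto simp: formulas_def)
  ultimately have "|UNIV :: nat set| \<le>o |formulas L {} UNIV :: ('s, 'f, 'r, 'a) form set|"
    using card_of_ordLeq by blast
  then show ?thesis
    using monster unfolding monster_model_def small_def by (blast intro: ordLeq_ordLess_trans)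
qed

section \<open>Closure properties of smallness\<close>

lemma small_subset: "small \<kappa> B \<Longrightarrow> A \<subseteq> B \<Longrightarrow> small \<kappa> A"
  unfolding small_def by (blast intro: ordLeq_ordLess_trans card_of_mono1)

lemma small_image: "small \<kappa> A \<Longrightarrow> small \<kappa> (f ` A)"
  unfolding small_def by (blast intro: ordLeq_ordLess_trans card_of_image)

lemma small_range: "small \<kappa> ((s :: nat \<Rightarrow> 'b) ` N)"
  using small_image[OF small_nat, of s] by (rule small_subset) auto

lemma small_finite:
  assumes "finite A"
  shows "small \<kappa> A"
proof -
  obtain xs where "set xs = A" using finite_list[OF assms] by blast
  then have "A = (\<lambda>i. xs ! i) ` {..<length xs}" by (auto simp: in_set_conv_nth)
  then show ?thesis using small_range by metis
qed

lemma small_Un: "small \<kappa> A \<Longrightarrow> small \<kappa> B \<Longrightarrow> small \<kappa> (A \<union> B)"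
proof -
  have card: "Card_order \<kappa>" using monster by (simp add: monster_model_def)
  have "|UNIV :: nat set| \<le>o \<kappa>" using small_nat unfolding small_def by (rule ordLess_imp_ordLeq)
  then have "|UNIV :: nat set| \<le>o |Field \<kappa>|"
    using card_of_Field_ordIso[OF card] ordIso_symmetric ordLeq_ordIso_trans by blast
  then have "infinite (Field \<kappa>)"
    using card_of_ordLeq_finite infinite_UNIV_nat by blast
  then show "small \<kappa> A \<Longrightarrow> small \<kappa> B \<Longrightarrow> small \<kappa> (A \<union> B)"
    unfolding small_def using card by (rule card_of_Un_ordLess_infinite_Field)
qed

lemma small_insert: "small \<kappa> A \<Longrightarrow> small \<kappa> (insert a A)"
  using small_Un[OF small_finite[of "{a}"]] by simp

lemma holds_iff:
  assumes "\<phi> \<in> formulas L A {}" "assignment U e"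
  shows "U \<Turnstile> \<phi> \<longleftrightarrow> sat U e \<phi>"
proof -
  have "sat U e' \<phi> = sat U e \<phi>" for e'
    using assms(1) by (intro sat_cong) (auto simp: formulas_def)
  then show ?thesis using assms(2) unfolding holds_def by blast
qed

lemma holds_inst_iff:
  assumes "\<phi> \<in> formulas L A {x}" "assignment U e"
  shows "U \<Turnstile> inst [x \<mapsto> a] \<phi> \<longleftrightarrow> sat U (e(x := a)) \<phi>"
proof -
  have "sat U e' (inst [x \<mapsto> a] \<phi>) = sat U (e(x := a)) \<phi>" for e'
    unfolding sat_inst override_single
    using assms(1) by (intro sat_cong) (auto simp: formulas_def)
  then show ?thesis using assms(2) unfolding holds_def by blast
qed

lemma realizes_iff:
  assumes "\<Phi> \<subseteq> formulas L A {x}" "assignment U e"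
  shows "realizes U x a \<Phi> \<longleftrightarrow> a \<in> univ U \<and> fst a = fst x \<and> (\<forall>\<phi>\<in>\<Phi>. sat U (e(x := a)) \<phi>)"
  using holds_inst_iff[OF _ assms(2)] assms(1) unfolding realizes_def by blast

lemma realizes_mono: "realizes U x a \<Phi> \<Longrightarrow> \<Psi> \<subseteq> \<Phi> \<Longrightarrow> realizes U x a \<Psi>"
  by (auto simp: realizes_def)

text \<open>This is the empty conjunction. Since \<open>A\<close> and \<open>X\<close> may be empty,
  it has to be a sentence without parameters; it holds because every sort is inhabited.\<close>

lemma ex_true_formula: "\<exists>\<chi>\<in>formulas L A X. \<forall>e. assignment U e \<longrightarrow> sat U e \<chi>"
proof
  let ?v = "undefined :: 's var"
  show "Exists ?v (Eq (Var ?v) (Var ?v)) \<in> formulas L A X" by (auto simp: formulas_def)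
  show "\<forall>e. assignment U e \<longrightarrow> sat U e (Exists ?v (Eq (Var ?v) (Var ?v)))"
    using U_structure by (auto simp: is_structure_def)
qed

lemma finite_conj:
  assumes "finite F" "F \<subseteq> formulas L A X"
  shows "\<exists>\<chi>\<in>formulas L A X. \<forall>e. assignment U e \<longrightarrow> (sat U e \<chi> \<longleftrightarrow> (\<forall>\<phi>\<in>F. sat U e \<phi>))"
  using assms
proof (induction F)
  case empty
  then show ?case using ex_true_formula by simp
next
  case (insert \<phi> F)
  then obtain \<chi> where "\<chi> \<in> formulas L A X"
    "\<forall>e. assignment U e \<longrightarrow> (sat U e \<chi> \<longleftrightarrow> (\<forall>\<phi>\<in>F. sat U e \<phi>))" by auto
  then show ?case using insert.prems by (intro bexI[of _ "Conj \<phi> \<chi>"]) auto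
qed

section \<open>Automorphisms preserve satisfaction\<close>

lemma val_in_univ:
  assumes "assignment U e" "wf_trm L t" "params_trm t \<subseteq> univ U"
  shows "val U e t \<in> univ U \<and> fst (val U e t) = sort_of L t"
  using assms(2,3)
proof (induction t)
  case (Var v)
  then show ?case using assms(1) by (simp add: assignment_def)
next
  case (Fun f ts)
  have ts: "val U e t \<in> univ U \<and> fst (val U e t) = sort_of L t" if "t \<in> set ts" for t
    using that Fun by auto
  then have "map fst (map (val U e) ts) = map (sort_of L) ts" by auto
  then have "map fst (map (val U e) ts) = fun_dom L f" using Fun.prems by (simp del: map_map)
  moreover have "set (map (val U e) ts) \<subseteq> univ U" using ts by auto
  moreover have "f \<in> fun_syms L" using Fun.prems by simp
  ultimately show ?case using U_structure unfolding is_structure_def by simp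
qed auto

lemma val_automorphism:
  assumes "automorphism L U h" "assignment U e" "wf_trm L t" "params_trm t \<subseteq> univ U"
  shows "val U (h \<circ> e) (psub_trm (\<lambda>c. Param (h c)) t) = h (val U e t)"
  using assms(3,4)
proof (induction t)
  case (Fun f ts)
  have IH: "val U (h \<circ> e) (psub_trm (\<lambda>c. Param (h c)) t) = h (val U e t)" if "t \<in> set ts" for t
    using that Fun.prems by (intro Fun.IH) auto
  have ts: "val U e t \<in> univ U \<and> fst (val U e t) = sort_of L t" if "t \<in> set ts" for t
    using that Fun.prems by (intro val_in_univ[OF assms(2)]) auto
  then have "map fst (map (val U e) ts) = map (sort_of L) ts" by auto
  then have "map fst (map (val U e) ts) = fun_dom L f" using Fun.prems by (simp del: map_map)
  moreover have "set (map (val U e) ts) \<subseteq> univ U" using ts by auto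
  moreover have "f \<in> fun_syms L" using Fun.prems by simp
  ultimately have "h (fun_int U f (map (val U e) ts)) = fun_int U f (map h (map (val U e) ts))"
    using assms(1) unfolding automorphism_def by blast
  moreover have "map (val U (h \<circ> e)) (map (psub_trm (\<lambda>c. Param (h c))) ts) =
      map h (map (val U e) ts)"
    using IH by simp
  ultimately show ?case by (simp only: psub_trm.simps val.simps)
qed auto

lemma automorphism_fst: "automorphism L U h \<Longrightarrow> c \<in> univ U \<Longrightarrow> fst (h c) = fst c"
  by (simp add: automorphism_def)

lemma automorphism_in: "automorphism L U h \<Longrightarrow> c \<in> univ U \<Longrightarrow> h c \<in> univ U"
  by (auto simp: automorphism_def bij_betw_def)

lemma automorphism_inj:
  "automorphism L U h \<Longrightarrow> c \<in> univ U \<Longrightarrow> d \<in> univ U \<Longrightarrow> h c = h d \<Longrightarrow> c = d"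
  by (auto simp: automorphism_def bij_betw_def inj_on_def)

lemma automorphism_surj: "automorphism L U h \<Longrightarrow> d \<in> univ U \<Longrightarrow> \<exists>c\<in>univ U. h c = d"
  unfolding automorphism_def bij_betw_def by (metis imageE)

lemma automorphism_assignment: "automorphism L U h \<Longrightarrow> assignment U e \<Longrightarrow> assignment U (h \<circ> e)"
  using automorphism_fst automorphism_in by (auto simp: assignment_def)

lemma automorphism_comp:
  assumes h: "automorphism L U h" and k: "automorphism L U k"
  shows "automorphism L U (k \<circ> h)"
  unfolding automorphism_def
proof (intro conjI ballI allI impI)
  show "bij_betw (k \<circ> h) (univ U) (univ U)"
    using h k unfolding automorphism_def by (blast intro: bij_betw_trans)
  fix a assume "a \<in> univ U"
  then show "fst ((k \<circ> h) a) = fst a"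
    using h k by (simp add: automorphism_fst automorphism_in)
next
  fix f cs assume f: "f \<in> fun_syms L" "set cs \<subseteq> univ U" "map fst cs = fun_dom L f"
  have "set (map h cs) \<subseteq> univ U" using f automorphism_in[OF h] by auto
  moreover have "map fst (map h cs) = map fst cs"
    unfolding map_map by (rule map_cong) (use f automorphism_fst[OF h] in auto)
  ultimately have "k (fun_int U f (map h cs)) = fun_int U f (map k (map h cs))"
    using k f unfolding automorphism_def by metis
  moreover have "h (fun_int U f cs) = fun_int U f (map h cs)"
    using h f unfolding automorphism_def by blast
  ultimately show "(k \<circ> h) (fun_int U f cs) = fun_int U f (map (k \<circ> h) cs)" by simp
next
  fix R cs assume R: "R \<in> rel_syms L" "set cs \<subseteq> univ U" "map fst cs = rel_dom L R"
  have "set (map h cs) \<subseteq> univ U" using R automorphism_in[OF h] by auto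
  moreover have "map fst (map h cs) = map fst cs"
    unfolding map_map by (rule map_cong) (use R automorphism_fst[OF h] in auto)
  ultimately have "rel_int U R (map k (map h cs)) = rel_int U R (map h cs)"
    using k R unfolding automorphism_def by metis
  moreover have "rel_int U R (map h cs) = rel_int U R cs"
    using h R unfolding automorphism_def by blast
  ultimately show "rel_int U R (map (k \<circ> h) cs) = rel_int U R cs" by simp
qed

lemma sat_automorphism:
  assumes "automorphism L U h" "assignment U e" "wf_form L \<phi>" "params \<phi> \<subseteq> univ U"
  shows "sat U (h \<circ> e) (pmap h \<phi>) \<longleftrightarrow> sat U e \<phi>"
  using assms(2-4)
proof (induction \<phi> arbitrary: e)
  case (Eq t u)
  then have "val U e t \<in> univ U" "val U e u \<in> univ U"
    using val_in_univ by auto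
  moreover have "val U (h \<circ> e) (psub_trm (\<lambda>c. Param (h c)) t) = h (val U e t)"
    "val U (h \<circ> e) (psub_trm (\<lambda>c. Param (h c)) u) = h (val U e u)"
    using Eq by (auto intro!: val_automorphism[OF assms(1)])
  ultimately show ?case
    using automorphism_inj[OF assms(1)] unfolding psub.simps sat.simps by metis
next
  case (Rel R ts)
  have ts: "val U e t \<in> univ U \<and> fst (val U e t) = sort_of L t" if "t \<in> set ts" for t
    using that Rel.prems by (intro val_in_univ) auto
  then have "map fst (map (val U e) ts) = map (sort_of L) ts" by auto
  then have "map fst (map (val U e) ts) = rel_dom L R" using Rel.prems by (simp del: map_map)
  moreover have "set (map (val U e) ts) \<subseteq> univ U" using ts by auto
  moreover have "R \<in> rel_syms L" using Rel.prems by simp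
  ultimately have "rel_int U R (map h (map (val U e) ts)) = rel_int U R (map (val U e) ts)"
    using assms(1) unfolding automorphism_def by blast
  moreover have "val U (h \<circ> e) (psub_trm (\<lambda>c. Param (h c)) t) = h (val U e t)" if "t \<in> set ts" for t
    using that Rel.prems by (intro val_automorphism[OF assms(1)]) auto
  then have "map (val U (h \<circ> e)) (map (psub_trm (\<lambda>c. Param (h c))) ts) =
      map h (map (val U e) ts)"
    by simp
  ultimately show ?case by (simp only: psub.simps sat.simps)
next
  case (Neg \<phi>)
  then show ?case by simp
next
  case (Conj \<phi> \<psi>)
  then show ?case by simp
next
  case (Exists v \<phi>)
  have eq: "sat U ((h \<circ> e)(v := h c)) (pmap h \<phi>) \<longleftrightarrow> sat U (e(v := c)) \<phi>"
    if "c \<in> univ U" "fst c = fst v" for c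
  proof -
    have "(h \<circ> e)(v := h c) = h \<circ> e(v := c)" by (auto simp: fun_eq_iff)
    then show ?thesis
      using Exists.IH[OF assignment_upd[OF Exists.prems(1) that]] Exists.prems(2,3)
      by (simp del: fun_upd_apply o_apply)
  qed
  have "(\<exists>d\<in>univ U. fst d = fst v \<and> sat U ((h \<circ> e)(v := d)) (pmap h \<phi>)) \<longleftrightarrow>
      (\<exists>c\<in>univ U. fst c = fst v \<and> sat U (e(v := c)) \<phi>)"
  proof
    assume "\<exists>d\<in>univ U. fst d = fst v \<and> sat U ((h \<circ> e)(v := d)) (pmap h \<phi>)"
    then obtain d where d: "d \<in> univ U" "fst d = fst v" "sat U ((h \<circ> e)(v := d)) (pmap h \<phi>)"
      by blast
    then obtain c where "c \<in> univ U" "h c = d" using automorphism_surj[OF assms(1)] by blast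
    then show "\<exists>c\<in>univ U. fst c = fst v \<and> sat U (e(v := c)) \<phi>"
      using d eq automorphism_fst[OF assms(1)] by metis
  next
    assume "\<exists>c\<in>univ U. fst c = fst v \<and> sat U (e(v := c)) \<phi>"
    then show "\<exists>d\<in>univ U. fst d = fst v \<and> sat U ((h \<circ> e)(v := d)) (pmap h \<phi>)"
      using eq automorphism_fst[OF assms(1)] automorphism_in[OF assms(1)] by metis
  qed
  then show ?case by (simp del: fun_upd_apply o_apply)
qed

text \<open>Saturation is given for one variable only. To handle \<open>x\<close> together with
  \<open>X\<close>, the projections of the finite subsets along \<open>x\<close> are realized first;
  this keeps the set finitely satisfiable in \<open>x\<close> once the values for \<open>X\<close>
  are inserted.\<close>

lemma finitely_satisfiable_realized:
  assumes "finite X" "A \<subseteq> univ U" "small \<kappa> A" "\<Sigma> \<subseteq> formulas L A X" "finitely_satisfiable U \<Sigma>"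
  shows "\<exists>e. assignment U e \<and> (\<forall>\<phi>\<in>\<Sigma>. sat U e \<phi>)"
  using assms(1,4,5)
proof (induction X arbitrary: \<Sigma>)
  case empty
  have "sat U e0 \<phi>" if \<phi>: "\<phi> \<in> \<Sigma>" for \<phi>
  proof -
    obtain e where "assignment U e" "sat U e \<phi>"
      using empty.prems(2)[unfolded finitely_satisfiable_def, rule_format, of "{\<phi>}"] \<phi> by auto
    then show ?thesis using holds_iff[of \<phi> A] empty.prems(1) \<phi> assignment_e0 by blast
  qed
  then show ?case using assignment_e0 by blast
next
  case (insert x X)
  have "\<exists>\<chi>. \<forall>F. finite F \<and> F \<subseteq> \<Sigma> \<longrightarrow> \<chi> F \<in> formulas L A (insert x X) \<and>
      (\<forall>e. assignment U e \<longrightarrow> (sat U e (\<chi> F) \<longleftrightarrow> (\<forall>\<phi>\<in>F. sat U e \<phi>)))"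
  proof (intro choice allI)
    fix F
    show "\<exists>\<chi>. finite F \<and> F \<subseteq> \<Sigma> \<longrightarrow> \<chi> \<in> formulas L A (insert x X) \<and>
        (\<forall>e. assignment U e \<longrightarrow> (sat U e \<chi> \<longleftrightarrow> (\<forall>\<phi>\<in>F. sat U e \<phi>)))"
    proof (cases "finite F \<and> F \<subseteq> \<Sigma>")
      case True
      then show ?thesis using finite_conj[of F A "insert x X"] insert.prems(1) by blast
    qed blast
  qed
  then obtain \<chi> where \<chi>0: "\<forall>F. finite F \<and> F \<subseteq> \<Sigma> \<longrightarrow> \<chi> F \<in> formulas L A (insert x X) \<and>
      (\<forall>e. assignment U e \<longrightarrow> (sat U e (\<chi> F) \<longleftrightarrow> (\<forall>\<phi>\<in>F. sat U e \<phi>)))" ..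
  then have \<chi>: "\<And>F. finite F \<Longrightarrow> F \<subseteq> \<Sigma> \<Longrightarrow> \<chi> F \<in> formulas L A (insert x X)"
    "\<And>F e. finite F \<Longrightarrow> F \<subseteq> \<Sigma> \<Longrightarrow> assignment U e \<Longrightarrow> sat U e (\<chi> F) \<longleftrightarrow> (\<forall>\<phi>\<in>F. sat U e \<phi>)"
    by auto
  \<comment> \<open>Taking all finite subsets, and not only single formulas, preserves their joint
    consistency.\<close>
  define \<Sigma>1 where "\<Sigma>1 = (\<lambda>F. Exists x (\<chi> F)) ` {F. finite F \<and> F \<subseteq> \<Sigma>}"
  have sub1: "\<Sigma>1 \<subseteq> formulas L A X" using \<chi>(1) by (auto simp: \<Sigma>1_def)
  have fin1: "finitely_satisfiable U \<Sigma>1"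
    unfolding finitely_satisfiable_def
  proof (intro allI impI)
    fix G assume G: "G \<subseteq> \<Sigma>1" "finite G"
    then obtain \<F> where \<F>: "\<F> \<subseteq> {F. finite F \<and> F \<subseteq> \<Sigma>}" "finite \<F>"
      "G = (\<lambda>F. Exists x (\<chi> F)) ` \<F>"
      unfolding \<Sigma>1_def by (meson finite_subset_image)
    then have "finite (\<Union>\<F>)" "\<Union>\<F> \<subseteq> \<Sigma>" by auto
    then obtain e where e: "assignment U e" "\<forall>\<phi>\<in>\<Union>\<F>. sat U e \<phi>"
      using insert.prems(2) unfolding finitely_satisfiable_def by blast
    have "sat U e (Exists x (\<chi> F))" if "F \<in> \<F>" for F
    proof -
      have "sat U e (\<chi> F)" using that e \<F>(1) \<chi>(2)[of F e] by blast
      then have "e x \<in> univ U \<and> fst (e x) = fst x \<and> sat U (e(x := e x)) (\<chi> F)"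
        using e(1) by (simp add: assignment_def)
      then show ?thesis unfolding sat.simps by blast
    qed
    then show "\<exists>e. assignment U e \<and> (\<forall>\<phi>\<in>G. sat U e \<phi>)" using e(1) \<F>(3) by blast
  qed
  obtain e where e: "assignment U e" "\<forall>\<phi>\<in>\<Sigma>1. sat U e \<phi>"
    using insert.IH[OF sub1 fin1] by blast
  \<comment> \<open>The variables in \<open>X\<close> are frozen at the values found. Only finitely
    many parameters are added, so the parameter set stays small.\<close>
  define b where "b = (\<lambda>v. if v \<in> X then Some (e v) else None)"
  have ov: "override e' b = (\<lambda>v. if v \<in> X then e v else e' v)" for e'
    by (auto simp: override_def b_def fun_eq_iff)
  have sat_b: "sat U (e(x := c)) (inst b \<phi>) = sat U (e(x := c)) \<phi>" for c \<phi>
  proof -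
    have "override (e(x := c)) b = e(x := c)" using insert.hyps(2) by (auto simp: ov fun_eq_iff)
    then show ?thesis by (simp add: sat_inst)
  qed
  define A2 where "A2 = A \<union> e ` X"
  have A2: "A2 \<subseteq> univ U" "small \<kappa> A2"
    using assms(2) e(1) small_Un[OF assms(3) small_finite[of "e ` X"]] insert.hyps(1)
    by (auto simp: A2_def assignment_def)
  have sub2: "inst b ` \<Sigma> \<subseteq> formulas L A2 {x}"
  proof
    fix \<psi> assume "\<psi> \<in> inst b ` \<Sigma>"
    then obtain \<phi> where \<phi>: "\<phi> \<in> \<Sigma>" "\<psi> = inst b \<phi>" by blast
    have "\<phi> \<in> formulas L A (insert x X)" using \<phi>(1) insert.prems(1) by blast
    moreover have "fst c = fst v" "c \<in> A2" if "b v = Some c" for v c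
      using e(1) that unfolding b_def A2_def assignment_def by (metis option.distinct(1)
        option.inject imageI UnI2)+
    moreover have "A \<subseteq> A2" "insert x X - dom b \<subseteq> {x}" by (auto simp: A2_def b_def)
    ultimately show "\<psi> \<in> formulas L A2 {x}"
      unfolding \<phi>(2) by (blast intro: inst_formulas)
  qed
  have fin2: "finitely_satisfiable U (inst b ` \<Sigma>)"
    unfolding finitely_satisfiable_def
  proof (intro allI impI)
    fix G assume "G \<subseteq> inst b ` \<Sigma>" "finite G"
    then obtain F where F: "F \<subseteq> \<Sigma>" "finite F" "G = inst b ` F" by (meson finite_subset_image)
    then have "sat U e (Exists x (\<chi> F))" using e(2) by (auto simp: \<Sigma>1_def)
    then obtain c where c: "c \<in> univ U" "fst c = fst x" "sat U (e(x := c)) (\<chi> F)" by auto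
    then have as: "assignment U (e(x := c))" using e(1) by (intro assignment_upd)
    then have "\<forall>\<phi>\<in>F. sat U (e(x := c)) \<phi>" using \<chi>(2) F c(3) by blast
    then show "\<exists>e. assignment U e \<and> (\<forall>\<phi>\<in>G. sat U e \<phi>)"
      using as F(3) sat_b by blast
  qed
  have "saturated L \<kappa> U" using monster by (simp add: monster_model_def)
  then obtain a where a: "realizes U x a (inst b ` \<Sigma>)"
    using A2 sub2 fin2 unfolding saturated_def by blast
  then have "a \<in> univ U" "fst a = fst x" "\<forall>\<phi>\<in>\<Sigma>. sat U (e(x := a)) \<phi>"
    using realizes_iff[OF sub2 e(1)] sat_b by auto
  then show ?case using assignment_upd[OF e(1)] by blast
qed

abbreviation sat1 :: "'s var \<Rightarrow> ('s, 'a) elem \<Rightarrow> ('s, 'f, 'r, 'a) form \<Rightarrow> bool" where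
  "sat1 x a \<phi> \<equiv> sat U (e0(x := a)) \<phi>"

lemma sat1_iff: "\<phi> \<in> formulas L A {x} \<Longrightarrow> sat U (e(x := a)) \<phi> \<longleftrightarrow> sat1 x a \<phi>"
  by (rule sat_cong) (auto simp: formulas_def)

text \<open>
  Substituting the variable \<open>x\<close> directly for the parameter could lead to capture; hence the
  detour through a fresh variable.
\<close>

lemma param_to_variable:
  assumes "\<phi> \<in> formulas L (insert a A) X" "fst a = fst x"
  obtains \<phi>' where "\<phi>' \<in> formulas L A (insert x X)"
    "\<And>e. assignment U e \<Longrightarrow> sat U e \<phi>' \<longleftrightarrow> sat U e (pmap (id(a := e x)) \<phi>)"
proof -
  obtain g :: "('s, 'a) elem \<Rightarrow> 's var"
    where g: "\<And>c. fst (g c) = fst c" "\<And>c. g c \<notin> insert x (all_vars \<phi>)"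
    using fresh_variables[of "{a}" "insert x (all_vars \<phi>)"] by (auto simp: finite_all_vars)
  define w where "w = g a"
  have w: "fst w = fst x" "w \<noteq> x" "w \<notin> all_vars \<phi>" "fst w = fst a"
    using g assms(2) by (auto simp: w_def)
  define s where "s = (\<lambda>c. if c = a then Var w else Param c :: ('s, 'f, 'a) trm)"
  have "wf_form L (psub s \<phi>)"
    using assms(1) w by (intro wf_psub) (auto simp: s_def formulas_def)
  moreover have "params (psub s \<phi>) \<subseteq> A"
    using assms(1) by (auto simp: params_psub s_def formulas_def split: if_splits)
  moreover have "free_vars (psub s \<phi>) \<subseteq> insert w X"
    using assms(1) free_vars_psub[of s \<phi>] by (auto simp: s_def formulas_def split: if_splits)
  ultimately have s: "psub s \<phi> \<in> formulas L A (insert w X)" by (simp add: formulas_def)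
  show thesis
  proof
    show "Exists w (Conj (Eq (Var w) (Var x)) (psub s \<phi>)) \<in> formulas L A (insert x X)"
      using s w by (auto simp: formulas_def)
    fix e assume e: "assignment U e"
    have "sat U (e(w := e x)) (psub s \<phi>) \<longleftrightarrow>
        sat U (e(w := e x)) (pmap (\<lambda>c. val U (e(w := e x)) (s c)) \<phi>)"
      using w by (intro sat_psub) (auto simp: s_def)
    also have "(\<lambda>c. val U (e(w := e x)) (s c)) = id(a := e x)"
      by (auto simp: s_def fun_eq_iff)
    also have "sat U (e(w := e x)) (pmap (id(a := e x)) \<phi>) \<longleftrightarrow> sat U e (pmap (id(a := e x)) \<phi>)"
    proof (rule sat_cong)
      fix v assume "v \<in> free_vars (pmap (id(a := e x)) \<phi>)"
      then have "v \<in> free_vars \<phi>" using free_vars_psub[of "\<lambda>c. Param ((id(a := e x)) c)" \<phi>] by auto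
      then show "(e(w := e x)) v = e v" using w(3) free_vars_subset_all_vars by auto
    qed
    finally have 1: "sat U (e(w := e x)) (psub s \<phi>) \<longleftrightarrow> sat U e (pmap (id(a := e x)) \<phi>)" .
    have "e x \<in> univ U" "fst (e x) = fst w" using e w(1) by (auto simp: assignment_def)
    moreover have "sat U e (Exists w (Conj (Eq (Var w) (Var x)) (psub s \<phi>))) \<longleftrightarrow>
        (\<exists>c\<in>univ U. fst c = fst w \<and> c = e x \<and> sat U (e(w := c)) (psub s \<phi>))"
      using w(2) by simp
    ultimately have "sat U e (Exists w (Conj (Eq (Var w) (Var x)) (psub s \<phi>))) \<longleftrightarrow>
        sat U (e(w := e x)) (psub s \<phi>)"
      by metis
    then show "sat U e (Exists w (Conj (Eq (Var w) (Var x)) (psub s \<phi>))) \<longleftrightarrow>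
        sat U e (pmap (id(a := e x)) \<phi>)"
      using 1 by blast
  qed
qed

text \<open>Homogeneity speaks of tuples inserted into parameter-free formulas. Such formulas are
  fixed by \<open>pmap g\<close>, so agreement on formulas with parameters in \<open>A\<close> is
  enough.\<close>

lemma extend_to_automorphism:
  assumes "A \<subseteq> univ U" "small \<kappa> A"
    and g: "\<And>c. c \<in> A \<Longrightarrow> g c \<in> univ U" "\<And>c. c \<in> A \<Longrightarrow> fst (g c) = fst c"
    and sat: "\<And>\<phi>. \<phi> \<in> formulas L A {} \<Longrightarrow> sat U e0 (pmap g \<phi>) \<longleftrightarrow> sat U e0 \<phi>"
  obtains h where "automorphism L U h" "\<And>c. c \<in> A \<Longrightarrow> h c = g c"
proof -
  have "elementary_map L U A g"
    unfolding elementary_map_def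
  proof (intro conjI ballI allI impI)
    fix b and \<phi> :: "('s, 'f, 'r, 'a) form"
    assume b: "tuple A b" and \<phi>: "\<phi> \<in> formulas L {} (dom b)"
    have in_A: "inst b \<phi> \<in> formulas L A {}"
      using b by (intro inst_formulas[OF \<phi>]) (auto simp: tuple_def)
    then have "pmap g (inst b \<phi>) \<in> formulas L (univ U) {}"
      using g by (intro pmap_formulas) auto
    moreover have "pmap g (inst b \<phi>) = inst (map_option g \<circ> b) \<phi>"
    proof -
      have "pmap g \<phi> = \<phi>" using \<phi> by (intro pmap_id) (auto simp: formulas_def)
      then show ?thesis by (simp only: pmap_inst)
    qed
    ultimately show "U \<Turnstile> inst b \<phi> \<longleftrightarrow> U \<Turnstile> inst (map_option g \<circ> b) \<phi>"
      using sat[OF in_A] holds_iff[OF in_A assignment_e0] holds_iff[OF _ assignment_e0] by metis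
  qed (use g in auto)
  moreover have "strongly_homogeneous L \<kappa> U" using monster by (simp add: monster_model_def)
  ultimately have "\<exists>h. automorphism L U h \<and> (\<forall>a\<in>A. h a = g a)"
    using assms(1,2) unfolding strongly_homogeneous_def by simp
  then show thesis using that by metis
qed

lemma conjugate_elements:
  assumes "B \<subseteq> univ U" "small \<kappa> B" "a \<in> univ U" "b \<in> univ U" "fst a = fst x" "fst b = fst x"
    and sat: "\<And>\<phi>. \<phi> \<in> formulas L B {x} \<Longrightarrow> sat1 x a \<phi> \<longleftrightarrow> sat1 x b \<phi>"
  obtains h where "automorphism L U h" "\<And>c. c \<in> B \<Longrightarrow> h c = c" "h a = b"
proof -
  \<comment> \<open>The formula \<open>x = a\<close> forces this. It keeps \<open>g\<close> below
    the identity on \<open>B\<close> even when \<open>a\<close> lies in \<open>B\<close>.\<close>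
  have ab: "a = b" if "a \<in> B"
    using sat[of "Eq (Var x) (Param a)"] that assms(5) by (auto simp: formulas_def)
  define g where "g = id(a := b)"
  have "sat U e0 (pmap g \<phi>) \<longleftrightarrow> sat U e0 \<phi>" if \<phi>: "\<phi> \<in> formulas L (insert a B) {}" for \<phi>
  proof -
    obtain \<phi>' where \<phi>': "\<phi>' \<in> formulas L B {x}"
      "\<And>e. assignment U e \<Longrightarrow> sat U e \<phi>' \<longleftrightarrow> sat U e (pmap (id(a := e x)) \<phi>)"
      using param_to_variable[OF \<phi> assms(5)] by blast
    have "free_vars (pmap (id(a := c)) \<phi>) = {}" for c
      using free_vars_psub[of "\<lambda>d. Param ((id(a := c)) d)" \<phi>] \<phi> by (auto simp: formulas_def)
    then have "sat U e (pmap (id(a := c)) \<phi>) = sat U e0 (pmap (id(a := c)) \<phi>)" for c e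
      by (intro sat_cong) auto
    moreover have "assignment U (e0(x := a))" "assignment U (e0(x := b))"
      using assms(3-6) assignment_e0 by (auto intro!: assignment_upd)
    ultimately have "sat1 x a \<phi>' \<longleftrightarrow> sat U e0 (pmap (id(a := a)) \<phi>)"
      "sat1 x b \<phi>' \<longleftrightarrow> sat U e0 (pmap g \<phi>)"
      using \<phi>'(2)[of "e0(x := a)"] \<phi>'(2)[of "e0(x := b)"] unfolding g_def fun_upd_same by metis+
    moreover have "pmap (id(a := a)) \<phi> = \<phi>" by (rule pmap_id) auto
    ultimately show ?thesis using sat[OF \<phi>'(1)] by simp
  qed
  moreover have "g c \<in> univ U \<and> fst (g c) = fst c" if "c \<in> insert a B" for c
    using that assms by (auto simp: g_def)
  moreover have "insert a B \<subseteq> univ U" "small \<kappa> (insert a B)"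
    using assms(1-3) small_insert by auto
  ultimately obtain h where h: "automorphism L U h" "\<And>c. c \<in> insert a B \<Longrightarrow> h c = g c"
    using extend_to_automorphism[of "insert a B" g] by metis
  show thesis
  proof (rule that[OF h(1)])
    show "h a = b" using h(2)[of a] by (simp add: g_def)
    show "h c = c" if "c \<in> B" for c
      using h(2)[of c] ab that by (cases "c = a") (simp_all add: g_def)
  qed
qed

lemma sat1_automorphism:
  assumes "automorphism L U h" "\<phi> \<in> formulas L (univ U) {x}" "a \<in> univ U" "fst a = fst x"
  shows "sat1 x (h a) (pmap h \<phi>) \<longleftrightarrow> sat1 x a \<phi>"
proof -
  have "pmap h \<phi> \<in> formulas L (univ U) {x}"
    using assms(1,2) automorphism_in automorphism_fst by (intro pmap_formulas) auto
  then have "sat1 x (h a) (pmap h \<phi>) \<longleftrightarrow> sat U ((h \<circ> e0)(x := h a)) (pmap h \<phi>)"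
    using sat1_iff by metis
  also have "(h \<circ> e0)(x := h a) = h \<circ> e0(x := a)" by (auto simp: fun_eq_iff)
  also have "sat U (h \<circ> e0(x := a)) (pmap h \<phi>) \<longleftrightarrow> sat1 x a \<phi>"
    using assms assignment_upd[OF assignment_e0]
    by (intro sat_automorphism) (auto simp: formulas_def)
  finally show ?thesis .
qed

subsection \<open>Global types\<close>

lemma global_type_sub: "global_type L U x p \<Longrightarrow> p \<subseteq> formulas L (univ U) {x}"
  by (simp add: global_type_def complete_type_def)

lemma global_type_finite:
  assumes "global_type L U x p" "F \<subseteq> p" "finite F"
  shows "\<exists>e. assignment U e \<and> (\<forall>\<phi>\<in>F. sat U e \<phi>)"
  using assms unfolding global_type_def complete_type_def finitely_satisfiable_def by simp

lemma global_type_closed: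
  assumes "global_type L U x p" "F \<subseteq> p" "finite F" "\<phi> \<in> formulas L (univ U) {x}"
    and "\<And>e. assignment U e \<Longrightarrow> (\<And>\<psi>. \<psi> \<in> F \<Longrightarrow> sat U e \<psi>) \<Longrightarrow> sat U e \<phi>"
  shows "\<phi> \<in> p"
proof (rule ccontr)
  assume "\<phi> \<notin> p"
  then have "Neg \<phi> \<in> p"
    using assms(1,4) unfolding global_type_def complete_type_def by blast
  then have "insert (Neg \<phi>) F \<subseteq> p" "finite (insert (Neg \<phi>) F)" using assms(2,3) by auto
  then have "\<exists>e. assignment U e \<and> (\<forall>\<psi>\<in>insert (Neg \<phi>) F. sat U e \<psi>)"
    by (rule global_type_finite[OF assms(1)])
  then obtain e where "assignment U e" "\<forall>\<psi>\<in>insert (Neg \<phi>) F. sat U e \<psi>" by blast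
  then show False using assms(5)[of e] by simp
qed

lemma global_type_Neg:
  assumes "global_type L U x p" "\<phi> \<in> formulas L (univ U) {x}"
  shows "Neg \<phi> \<in> p \<longleftrightarrow> \<phi> \<notin> p"
proof -
  have False if "\<phi> \<in> p" "Neg \<phi> \<in> p"
    using global_type_finite[OF assms(1), of "{\<phi>, Neg \<phi>}"] that by auto
  then show ?thesis using assms unfolding global_type_def complete_type_def by blast
qed

lemma restrict_sub: "p \<subseteq> formulas L A X \<Longrightarrow> p \<restriction> B \<subseteq> formulas L B X"
  by (auto simp: restrict_type_def formulas_def)

lemma restrict_mono: "A \<subseteq> B \<Longrightarrow> p \<restriction> A \<subseteq> p \<restriction> B"
  by (auto simp: restrict_type_def)

lemma restriction_realized:
  assumes "global_type L U x p" "B \<subseteq> univ U" "small \<kappa> B"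
  obtains a where "realizes U x a (p \<restriction> B)"
proof -
  have "finitely_satisfiable U (p \<restriction> B)"
    using assms(1) unfolding global_type_def complete_type_def finitely_satisfiable_def
    by (auto simp: restrict_type_def)
  moreover have "p \<restriction> B \<subseteq> formulas L B {x}"
    using restrict_sub[OF global_type_sub[OF assms(1)]] .
  moreover have "saturated L \<kappa> U" using monster by (simp add: monster_model_def)
  ultimately have "\<exists>a. realizes U x a (p \<restriction> B)"
    using assms(2,3) unfolding saturated_def by simp
  then show thesis using that by blast
qed

lemma realizes_restriction_iff:
  assumes "global_type L U x p" "B \<subseteq> univ U"
  shows "realizes U x a (p \<restriction> B) \<longleftrightarrow>
    a \<in> univ U \<and> fst a = fst x \<and> (\<forall>\<phi>\<in>formulas L B {x}. sat1 x a \<phi> \<longleftrightarrow> \<phi> \<in> p)"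
proof -
  have sub: "p \<restriction> B \<subseteq> formulas L B {x}"
    using restrict_sub[OF global_type_sub[OF assms(1)]] .
  have "(\<forall>\<phi>\<in>p \<restriction> B. sat1 x a \<phi>) \<longleftrightarrow> (\<forall>\<phi>\<in>formulas L B {x}. sat1 x a \<phi> \<longleftrightarrow> \<phi> \<in> p)"
  proof
    assume L: "\<forall>\<phi>\<in>p \<restriction> B. sat1 x a \<phi>"
    show "\<forall>\<phi>\<in>formulas L B {x}. sat1 x a \<phi> \<longleftrightarrow> \<phi> \<in> p"
    proof
      fix \<phi> assume \<phi>: "\<phi> \<in> formulas L B {x}"
      then have "params \<phi> \<subseteq> B" by (simp add: formulas_def)
      moreover have "\<phi> \<in> formulas L (univ U) {x}" using \<phi> assms(2) by (rule formulas_params_mono)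
      ultimately show "sat1 x a \<phi> \<longleftrightarrow> \<phi> \<in> p"
        using L[rule_format, of \<phi>] L[rule_format, of "Neg \<phi>"] global_type_Neg[OF assms(1), of \<phi>]
        unfolding restrict_type_def by auto
    qed
  next
    assume "\<forall>\<phi>\<in>formulas L B {x}. sat1 x a \<phi> \<longleftrightarrow> \<phi> \<in> p"
    then show "\<forall>\<phi>\<in>p \<restriction> B. sat1 x a \<phi>" using sub by (auto simp: restrict_type_def)
  qed
  then show ?thesis using realizes_iff[OF sub assignment_e0] by simp
qed

lemma realizes_univ: "realizes U x a \<Phi> \<Longrightarrow> a \<in> univ U"
  by (simp add: realizes_def)

lemma realizes_sort: "realizes U x a \<Phi> \<Longrightarrow> fst a = fst x"
  by (simp add: realizes_def)

lemma realizes_restrict_mono: "realizes U x a (p \<restriction> B) \<Longrightarrow> A \<subseteq> B \<Longrightarrow> realizes U x a (p \<restriction> A)"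
  by (erule realizes_mono) (rule restrict_mono)

lemma realizes_sat1:
  assumes "global_type L U x p" "B \<subseteq> univ U" "realizes U x a (p \<restriction> B)" "\<phi> \<in> formulas L B {x}"
  shows "sat1 x a \<phi> \<longleftrightarrow> \<phi> \<in> p"
  using realizes_restriction_iff[OF assms(1,2), of a] assms(3,4) by simp

lemma realizations_conjugate:
  assumes "global_type L U x p" "B \<subseteq> univ U" "small \<kappa> B"
    "realizes U x a (p \<restriction> B)" "realizes U x b (p \<restriction> B)"
  obtains h where "automorphism L U h" "\<And>c. c \<in> B \<Longrightarrow> h c = c" "h a = b"
proof -
  have "sat1 x a \<phi> \<longleftrightarrow> sat1 x b \<phi>" if "\<phi> \<in> formulas L B {x}" for \<phi>
    using realizes_sat1[OF assms(1,2) _ that] assms(4,5) by metis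
  then show thesis
    using conjugate_elements[of B a b x] assms(2-5) that
      realizes_univ[OF assms(4)] realizes_univ[OF assms(5)]
      realizes_sort[OF assms(4)] realizes_sort[OF assms(5)] by metis
qed

text \<open>The formula is written as an instance of a parameter-free \<open>\<phi>0\<close>; its
  conjugate is then the instance at the image tuple, which has the same type over
  \<open>A\<close>.\<close>

lemma invariant_automorphism:
  assumes "invariant_type L U A x p" "A \<subseteq> univ U"
    "automorphism L U h" "\<And>c. c \<in> A \<Longrightarrow> h c = c" "\<phi> \<in> formulas L (univ U) {x}"
  shows "pmap h \<phi> \<in> p \<longleftrightarrow> \<phi> \<in> p"
proof -
  obtain g where g: "inj_on g (params \<phi>)" "\<And>c. fst (g c) = fst c"
    "\<And>c. g c \<notin> insert x (all_vars \<phi>)"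
    using fresh_variables[of "params \<phi>" "insert x (all_vars \<phi>)"] finite_params[of \<phi>]
      finite_all_vars[of \<phi>] by auto
  \<comment> \<open>The inverse of the abstraction \<open>g\<close>: it puts the original parameters
    back.\<close>
  define b where "b = (\<lambda>v. if v \<in> g ` params \<phi> then Some (inv_into (params \<phi>) g v) else None)"
  have b_g: "b (g c) = Some c" if "c \<in> params \<phi>" for c using that g(1) by (auto simp: b_def)
  have b_D: "c \<in> params \<phi> \<and> v = g c" if "b v = Some c" for v c
    using that b_g by (auto simp: b_def split: if_splits)
  have dom_b: "dom b = g ` params \<phi>" by (auto simp: b_def split: if_splits)
  define \<phi>0 where "\<phi>0 = psub (\<lambda>c. Var (g c)) \<phi>"
  have params: "params \<phi> \<subseteq> univ U" using assms(5) by (simp add: formulas_def)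
  have b1: "tuple (univ U) b"
    unfolding tuple_def
  proof (intro conjI allI impI)
    show "finite (dom b)" by (simp add: dom_b finite_params)
    fix v c assume "b v = Some c"
    from b_D[OF this] show "c \<in> univ U" "fst c = fst v" using params g(2)[of c] by auto
  qed
  have b2: "tuple (univ U) (map_option h \<circ> b)"
    unfolding tuple_def
  proof (intro conjI allI impI)
    have "dom (map_option h \<circ> b) = dom b" by (auto simp: dom_def)
    then show "finite (dom (map_option h \<circ> b))" using b1 by (simp add: tuple_def)
    fix v c assume "(map_option h \<circ> b) v = Some c"
    then obtain d where d: "b v = Some d" "c = h d" by auto
    then have "d \<in> univ U" "fst d = fst v" using b1 by (auto simp: tuple_def)
    then show "c \<in> univ U" "fst c = fst v"
      using d(2) automorphism_in[OF assms(3)] automorphism_fst[OF assms(3)] by auto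
  qed
  have "wf_form L \<phi>0" unfolding \<phi>0_def
    using assms(5) g(2) by (intro wf_psub) (auto simp: formulas_def)
  moreover have "params \<phi>0 = {}" by (simp add: \<phi>0_def params_psub)
  moreover have "free_vars \<phi>0 \<subseteq> insert x (dom b)"
    using assms(5) free_vars_psub[of "\<lambda>c. Var (g c)" \<phi>] by (auto simp: \<phi>0_def dom_b formulas_def)
  ultimately have \<phi>0: "\<phi>0 \<in> formulas L A (insert x (dom b))" by (simp add: formulas_def)
  have "inst b \<phi>0 = pmap id \<phi>" unfolding \<phi>0_def
    using g(3) by (intro inst_psub) (auto simp: b_g dom_b)
  also have "pmap id \<phi> = \<phi>" by (rule pmap_id) simp
  finally have inst1: "inst b \<phi>0 = \<phi>" .
  have inst2: "inst (map_option h \<circ> b) \<phi>0 = pmap h \<phi>" unfolding \<phi>0_def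
    using g(3) by (intro inst_psub) (auto simp: b_g dom_b dom_def[symmetric])
  \<comment> \<open>An automorphism fixing \<open>A\<close> does not change formulas over
    \<open>A\<close>, so it preserves types of tuples over \<open>A\<close>.\<close>
  have "same_type L U A b (map_option h \<circ> b)"
    unfolding same_type_def
  proof (intro conjI ballI)
    show "dom b = dom (map_option h \<circ> b)" by (auto simp: dom_def)
    fix \<psi> assume \<psi>: "\<psi> \<in> formulas L A (dom b)"
    have in_U: "inst b \<psi> \<in> formulas L (univ U) {}"
      using b1 assms(2) by (intro inst_formulas[OF \<psi>]) (auto simp: tuple_def)
    have "pmap h \<psi> = \<psi>" using \<psi> assms(4) by (intro pmap_id) (auto simp: formulas_def)
    then have eq: "inst (map_option h \<circ> b) \<psi> = pmap h (inst b \<psi>)" by (simp only: pmap_inst)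
    have "pmap h (inst b \<psi>) \<in> formulas L (univ U) {}"
      using in_U automorphism_in[OF assms(3)] automorphism_fst[OF assms(3)]
      by (intro pmap_formulas) auto
    moreover have "sat U (h \<circ> e0) (pmap h (inst b \<psi>)) \<longleftrightarrow> sat U e0 (inst b \<psi>)"
      using in_U assms(3) assignment_e0 by (intro sat_automorphism) (auto simp: formulas_def)
    ultimately show "U \<Turnstile> inst b \<psi> \<longleftrightarrow> U \<Turnstile> inst (map_option h \<circ> b) \<psi>"
      unfolding eq using holds_iff[OF in_U assignment_e0]
        holds_iff[OF _ automorphism_assignment[OF assms(3) assignment_e0]] by metis
  qed
  moreover have "x \<notin> dom b" using g(3) by (auto simp: dom_b)
  ultimately have "inst b \<phi>0 \<in> p \<longleftrightarrow> inst (map_option h \<circ> b) \<phi>0 \<in> p"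
    using assms(1) b1 b2 \<phi>0 unfolding invariant_type_def by blast
  then show ?thesis by (simp add: inst1 inst2)
qed

lemma realizes_automorphism:
  assumes p: "global_type L U x p" "invariant_type L U A x p" "A \<subseteq> univ U"
    and h: "automorphism L U h" "\<And>c. c \<in> A \<Longrightarrow> h c = c"
    and "C \<subseteq> univ U" "a \<in> univ U"
  shows "realizes U x (h a) (p \<restriction> (h ` C)) \<longleftrightarrow> realizes U x a (p \<restriction> C)"
proof (cases "fst a = fst x")
  case True
  have hC: "h ` C \<subseteq> univ U" using assms(6) automorphism_in[OF h(1)] by auto
  \<comment> \<open>A section of \<open>h\<close> on \<open>C\<close> pulls every formula over the
    image back to one over \<open>C\<close>.\<close>
  have image: "formulas L (h ` C) {x} = pmap h ` formulas L C {x}"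
  proof
    show "pmap h ` formulas L C {x} \<subseteq> formulas L (h ` C) {x}"
      using assms(6) automorphism_fst[OF h(1)] by (auto intro!: pmap_formulas)
    show "formulas L (h ` C) {x} \<subseteq> pmap h ` formulas L C {x}"
    proof
      fix \<phi> assume \<phi>: "\<phi> \<in> formulas L (h ` C) {x}"
      have k: "inv_into C h c \<in> C" "h (inv_into C h c) = c" if "c \<in> h ` C" for c
        using that by (auto simp: inv_into_into f_inv_into_f)
      then have "fst (inv_into C h c) = fst c" if "c \<in> h ` C" for c
        using that automorphism_fst[OF h(1)] assms(6) by (metis subsetD)
      moreover have "inv_into C h ` (h ` C) \<subseteq> C" using k(1) by blast
      ultimately have "pmap (inv_into C h) \<phi> \<in> formulas L C {x}"
        using \<phi> by (intro pmap_formulas) auto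
      moreover have "pmap h (pmap (inv_into C h) \<phi>) = \<phi>"
        unfolding pmap_comp
      proof (rule pmap_id)
        fix c assume "c \<in> params \<phi>"
        then have "c \<in> h ` C" using \<phi> by (auto simp: formulas_def)
        then show "h (inv_into C h c) = c" by (rule k(2))
      qed
      ultimately show "\<phi> \<in> pmap h ` formulas L C {x}" by (metis imageI)
    qed
  qed
  have "sat1 x (h a) (pmap h \<phi>) \<longleftrightarrow> sat1 x a \<phi>" "pmap h \<phi> \<in> p \<longleftrightarrow> \<phi> \<in> p"
    if "\<phi> \<in> formulas L C {x}" for \<phi>
  proof -
    have "\<phi> \<in> formulas L (univ U) {x}" using that assms(6) by (rule formulas_params_mono)
    then show "sat1 x (h a) (pmap h \<phi>) \<longleftrightarrow> sat1 x a \<phi>" "pmap h \<phi> \<in> p \<longleftrightarrow> \<phi> \<in> p"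
      using sat1_automorphism[OF h(1)] invariant_automorphism[OF p(2,3) h] assms(7) True by auto
  qed
  then show ?thesis
    using realizes_restriction_iff[OF p(1) hC] realizes_restriction_iff[OF p(1) assms(6)]
      automorphism_in[OF h(1)] automorphism_fst[OF h(1)] assms(7) True
    by (simp add: image)
next
  case False
  then show ?thesis using automorphism_fst[OF h(1) assms(7)] by (simp add: realizes_def)
qed

subsection \<open>Morley sequences\<close>

abbreviation aut_over :: "('s, 'a) elem set \<Rightarrow> (('s, 'a) elem \<Rightarrow> ('s, 'a) elem) \<Rightarrow> bool" where
  "aut_over B h \<equiv> automorphism L U h \<and> (\<forall>c\<in>B. h c = c)"

lemma realizes_aut_over:
  assumes "global_type L U x p" "invariant_type L U A x p" "A \<subseteq> univ U" "aut_over A h"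
    and "C \<subseteq> univ U" "a \<in> univ U" "h ` C = D"
  shows "realizes U x (h a) (p \<restriction> D) \<longleftrightarrow> realizes U x a (p \<restriction> C)"
  using realizes_automorphism[of x p A h C a] assms by auto

lemma morley_exists:
  assumes q: "global_type L U y q" and B: "B \<subseteq> univ U" "small \<kappa> B"
  shows "\<exists>s :: nat \<Rightarrow> ('s, 'a) elem. \<forall>i. realizes U y (s i) (q \<restriction> (B \<union> s ` {..<i}))"
proof -
  have "\<exists>a. realizes U y a (q \<restriction> (B \<union> s ` {..<n}))"
    if "\<And>i. i < n \<Longrightarrow> realizes U y (s i) (q \<restriction> (B \<union> s ` {..<i}))" for n and s :: "nat \<Rightarrow> ('s, 'a) elem"
  proof -
    have "B \<union> s ` {..<n} \<subseteq> univ U" using that realizes_univ B(1) by blast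
    moreover have "small \<kappa> (B \<union> s ` {..<n})" using B(2) small_Un small_range by blast
    ultimately show ?thesis using restriction_realized[OF q] by metis
  qed
  then show ?thesis
    using nat_history_choice[of "\<lambda>S a. realizes U y a (q \<restriction> (B \<union> S))"] by metis
qed

text \<open>A back-step at each stage: after \<open>h\<close> has matched the first \<open>n\<close>
  members, invariance makes \<open>h (s n)\<close> and \<open>t n\<close> realize the same type over
  \<open>B\<close> and these members, so a further automorphism corrects the last one without
  disturbing the rest.\<close>

lemma morley_conjugate:
  assumes q: "global_type L U y q" "invariant_type L U A y q" "A \<subseteq> B"
    and B: "B \<subseteq> univ U" "small \<kappa> B"
    and "\<And>i. i < n \<Longrightarrow> realizes U y (s i) (q \<restriction> (B \<union> s ` {..<i}))"
    and "\<And>i. i < n \<Longrightarrow> realizes U y (t i) (q \<restriction> (B \<union> t ` {..<i}))"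
  shows "\<exists>h. aut_over B h \<and> (\<forall>i<n :: nat. h (s i) = t i)"
  using assms(6,7)
proof (induction n)
  case 0
  have "automorphism L U (\<lambda>c. c)" by (simp add: automorphism_def bij_betw_def)
  then show ?case by (intro exI[of _ "\<lambda>c. c"]) simp
next
  case (Suc n)
  then obtain h where h: "aut_over B h" "\<forall>i<n. h (s i) = t i" by auto
  define C where "C = B \<union> t ` {..<n}"
  have "t i \<in> univ U" "s i \<in> univ U" if "i < n" for i
    using realizes_univ[OF Suc.prems(1)[of i]] realizes_univ[OF Suc.prems(2)[of i]] that by auto
  then have C: "C \<subseteq> univ U" "small \<kappa> C" and sU: "B \<union> s ` {..<n} \<subseteq> univ U"
    using B(1) small_Un[OF B(2) small_range] by (auto simp: C_def)
  moreover have "h ` (B \<union> s ` {..<n}) = C"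
    using h by (auto simp: C_def image_Un image_image)
  moreover have "aut_over A h" using h(1) q(3) by blast
  moreover have "A \<subseteq> univ U" using q(3) B(1) by blast
  ultimately have "realizes U y (h (s n)) (q \<restriction> C)"
    using realizes_aut_over[OF q(1,2) _ _ sU realizes_univ[OF Suc.prems(1)[of n]]]
      Suc.prems(1)[of n] by simp
  moreover have "realizes U y (t n) (q \<restriction> C)" using Suc.prems(2)[of n] by (simp add: C_def)
  ultimately obtain k where k: "automorphism L U k" "\<And>c. c \<in> C \<Longrightarrow> k c = c" "k (h (s n)) = t n"
    using realizations_conjugate[OF q(1) C] by metis
  have "automorphism L U (k \<circ> h)" using h(1) k(1) automorphism_comp by blast
  moreover have "(k \<circ> h) c = c" if "c \<in> B" for c using that h(1) k(2) by (simp add: C_def)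
  moreover have "(k \<circ> h) (s i) = t i" if "i < Suc n" for i
    using that h(2) k(2,3) by (cases "i = n") (simp_all add: C_def)
  ultimately show ?case by blast
qed

end

section \<open>Consequences of generic stability\<close>

text \<open>
  The base \<open>N\<close> of invariance and the witness \<open>A\<close> of generic stability need not be related.
\<close>

locale gs_type = monster L T \<kappa> U
  for L :: "('s, 'f, 'r) language"
    and T :: "('s, 'f, 'r, 'a) form set"
    and \<kappa> :: "'k rel"
    and U :: "('s, 'f, 'r, 'a) struct" +
  fixes y :: "'s var" and q :: "('s, 'f, 'r, 'a) form set" and N A :: "('s, 'a) elem set"
  assumes q: "global_type L U y q"
    and q_invariant: "invariant_type L U N y q"
    and N: "N \<subseteq> univ U" "small \<kappa> N"
    and A: "A \<subseteq> univ U" "small \<kappa> A"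
    and infinite_elem: "infinite (UNIV :: ('s, 'a) elem set)"
    and morley_dichotomy: "\<And>(r :: ('s, 'a) elem rel) a \<phi>.
      Well_order r \<Longrightarrow> infinite (Field r) \<Longrightarrow> morley_sequence U A y q r a \<Longrightarrow>
      \<phi> \<in> formulas L (univ U) {y} \<Longrightarrow>
      finite {i\<in>Field r. U \<Turnstile> inst [y \<mapsto> a i] \<phi>} \<or>
      finite (Field r - {i\<in>Field r. U \<Turnstile> inst [y \<mapsto> a i] \<phi>})"
begin

text \<open>
  If \<open>\<phi> \<notin> q\<close>, a Morley sequence of order type \<open>\<omega>\<close> is prolonged by \<open>\<omega>\<close> many elements that
  do not satisfy \<open>\<phi>\<close>. The order \<open>\<omega> + \<omega>\<close> is realized on the natural numbers, with the even
  numbers preceding the odd ones.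
\<close>

lemma finite_nongeneric:
  fixes s :: "nat \<Rightarrow> ('s, 'a) elem"
  assumes s: "\<And>i. realizes U y (s i) (q \<restriction> (A \<union> s ` {..<i}))"
    and \<phi>: "\<phi> \<in> formulas L (univ U) {y}" "\<phi> \<notin> q"
  shows "finite {k. sat1 y (s k) \<phi>}"
proof -
  \<comment> \<open>With the parameters of \<open>\<phi>\<close> in the base, every member of the
    prolongation \<open>t\<close> decides \<open>\<phi>\<close> as \<open>q\<close> does, that is,
    negatively.\<close>
  define B where "B = A \<union> range s \<union> params \<phi>"
  have B: "B \<subseteq> univ U" "small \<kappa> B"
  proof -
    have "range s \<subseteq> univ U" using realizes_univ[OF s] by blast
    then show "B \<subseteq> univ U" using A(1) \<phi>(1) by (auto simp: B_def formulas_def)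
    show "small \<kappa> B" unfolding B_def
      using A(2) small_Un small_range small_finite[OF finite_params] by blast
  qed
  obtain t where t: "\<And>i. realizes U y (t i) (q \<restriction> (B \<union> t ` {..<i :: nat}))"
    using morley_exists[OF q B] by blast
  have "\<phi> \<in> formulas L B {y}" using \<phi>(1) by (auto simp: formulas_def B_def)
  then have not_t: "\<not> sat1 y (t i) \<phi>" for i
    using realizes_sat1[OF q B(1) realizes_restrict_mono[OF t[of i]]] \<phi>(2) by blast
  \<comment> \<open>Generic stability indexes sequences by elements of the structure, so the order
    on the natural numbers is transported along an injection.\<close>
  obtain \<iota> :: "nat \<Rightarrow> ('s, 'a) elem" where \<iota>: "inj \<iota>"
    using infinite_countable_subset[OF infinite_elem] by blast
  define c where "c e = (let n = inv \<iota> e in if even n then s (n div 2) else t (n div 2))" for e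
  have c: "c (\<iota> n) = (if even n then s (n div 2) else t (n div 2))" for n
    by (simp add: c_def \<iota>)
  define S where "S = {(i :: nat, j). even i \<and> odd j \<or> even i = even j \<and> i \<le> j}"
  have FS: "Field S = UNIV" by (auto simp: S_def Field_def)
  have "wf (S - Id)"
  proof (rule wf_subset)
    show "wf (inv_image (less_than <*lex*> less_than) (\<lambda>n :: nat. (n mod 2, n)))"
      by (intro wf_inv_image wf_lex_prod wf_less_than)
    show "S - Id \<subseteq> inv_image (less_than <*lex*> less_than) (\<lambda>n :: nat. (n mod 2, n))"
      by (auto simp: S_def even_iff_mod_2_eq_zero odd_iff_mod_2_eq_one)
  qed
  moreover have "Linear_order S"
    unfolding FS order_on_defs
    by (auto simp: S_def refl_on_def trans_def antisym_def total_on_def)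
  ultimately have "Well_order S" by (simp add: well_order_on_def)
  then have wo: "Well_order (dir_image S \<iota>)"
    using \<iota> by (intro Well_order_dir_image) (auto simp: FS)
  have F: "Field (dir_image S \<iota>) = range \<iota>" by (simp add: dir_image_Field FS)
  have "morley_sequence U A y q (dir_image S \<iota>) c"
    unfolding morley_sequence_def F
  proof
    fix e assume "e \<in> range \<iota>"
    then obtain j where j: "e = \<iota> j" by blast
    have under: "\<exists>i. d = \<iota> i \<and> i \<noteq> j \<and> (i, j) \<in> S" if "d \<in> underS (dir_image S \<iota>) e" for d
      using that \<iota> by (auto simp: underS_def dir_image_def j inj_eq)
    show "realizes U y (c e) (q \<restriction> (A \<union> c ` underS (dir_image S \<iota>) e))"
    proof (cases "even j")
      case True
      have "c d \<in> s ` {..<j div 2}" if d: "d \<in> underS (dir_image S \<iota>) e" for d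
      proof -
        obtain i where i: "d = \<iota> i" "i \<noteq> j" "(i, j) \<in> S" using under[OF d] by blast
        then have "even i" "i < j" using True by (auto simp: S_def)
        then have "i div 2 < j div 2" using True by (auto elim!: evenE)
        then show ?thesis using i(1) \<open>even i\<close> by (simp add: c)
      qed
      then have "A \<union> c ` underS (dir_image S \<iota>) e \<subseteq> A \<union> s ` {..<j div 2}" by blast
      then show ?thesis
        using realizes_restrict_mono[OF s] True by (simp add: c j)
    next
      case False
      have "c d \<in> range s \<union> t ` {..<j div 2}" if d: "d \<in> underS (dir_image S \<iota>) e" for d
      proof -
        obtain i where i: "d = \<iota> i" "i \<noteq> j" "(i, j) \<in> S" using under[OF d] by blast
        show ?thesis
        proof (cases "even i")
          case False
          then have "i < j" using i \<open>odd j\<close> by (auto simp: S_def)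
          then have "i div 2 < j div 2" using False \<open>odd j\<close> by (auto elim!: oddE)
          then show ?thesis using i(1) False by (simp add: c)
        qed (simp add: i(1) c)
      qed
      then have "A \<union> c ` underS (dir_image S \<iota>) e \<subseteq> B \<union> t ` {..<j div 2}"
        unfolding B_def by blast
      then show ?thesis
        using realizes_restrict_mono[OF t] False by (simp add: c j)
    qed
  qed
  moreover have "infinite (range \<iota>)" using \<iota> by (simp add: finite_image_iff)
  ultimately have dich: "finite {i\<in>range \<iota>. U \<Turnstile> inst [y \<mapsto> c i] \<phi>} \<or>
      finite (range \<iota> - {i\<in>range \<iota>. U \<Turnstile> inst [y \<mapsto> c i] \<phi>})"
    using morley_dichotomy[OF wo _ _ \<phi>(1)] unfolding F by blast
  have sat: "U \<Turnstile> inst [y \<mapsto> d] \<phi> \<longleftrightarrow> sat1 y d \<phi>" for d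
    by (rule holds_inst_iff[OF \<phi>(1) assignment_e0])
  have inj: "inj (\<lambda>k. \<iota> (2 * k + i))" for i
    by (rule injI) (drule injD[OF \<iota>], simp)
  \<comment> \<open>The prolongation contributes infinitely many failures of \<open>\<phi>\<close>,
    which excludes the cofinite alternative.\<close>
  have "(\<lambda>k. \<iota> (2 * k + 1)) ` UNIV \<subseteq> range \<iota> - {i\<in>range \<iota>. U \<Turnstile> inst [y \<mapsto> c i] \<phi>}"
    using not_t by (auto simp: sat c)
  moreover have "infinite ((\<lambda>k. \<iota> (2 * k + 1)) ` UNIV)"
    using inj[of 1] by (subst finite_image_iff) simp_all
  ultimately have "finite {i\<in>range \<iota>. U \<Turnstile> inst [y \<mapsto> c i] \<phi>}"
    using dich finite_subset by blast
  moreover have "(\<lambda>k. \<iota> (2 * k)) ` {k. sat1 y (s k) \<phi>} \<subseteq> {i\<in>range \<iota>. U \<Turnstile> inst [y \<mapsto> c i] \<phi>}"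
    by (auto simp: sat c)
  ultimately have "finite ((\<lambda>k. \<iota> (2 * k)) ` {k. sat1 y (s k) \<phi>})" by (rule finite_subset[rotated])
  then show ?thesis
    using inj[of 0] inj_on_subset by (subst (asm) finite_image_iff) auto
qed

text \<open>A failure is a formula \<open>\<phi>\<close> over \<open>Bb\<close> that holds at
  \<open>a\<close> but is not in \<open>q\<close>. If \<open>s\<close> is a Morley sequence over
  \<open>B\<close> and \<open>d\<close> realizes \<open>q\<close> over \<open>B\<close> and all of
  \<open>s\<close>, every pair of \<open>s i\<close> and \<open>d\<close> is conjugate to
  \<open>a\<close> and \<open>b\<close>. The conjugate of \<open>\<phi>\<close> over
  \<open>Bd\<close> then holds at all \<open>s i\<close> although it is outside
  \<open>q\<close>.\<close>

lemma symmetry: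
  assumes B: "N \<subseteq> B" "A \<subseteq> B" "B \<subseteq> univ U" "small \<kappa> B"
    and a: "realizes U y a (q \<restriction> B)" and b: "realizes U y b (q \<restriction> (insert a B))"
  shows "realizes U y a (q \<restriction> (insert b B))"
proof (rule ccontr)
  assume "\<not> realizes U y a (q \<restriction> (insert b B))"
  moreover have bB: "insert b B \<subseteq> univ U" using B(3) realizes_univ[OF b] by blast
  ultimately have "\<exists>\<phi>\<in>formulas L (insert b B) {y}. sat1 y a \<phi> \<noteq> (\<phi> \<in> q)"
    using realizes_restriction_iff[OF q bB, of a] realizes_univ[OF a] realizes_sort[OF a] by simp
  then obtain \<phi>' where \<phi>': "\<phi>' \<in> formulas L (insert b B) {y}" "sat1 y a \<phi>' \<noteq> (\<phi>' \<in> q)"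
    by (rule bexE)
  have "\<phi>' \<in> formulas L (univ U) {y}" using \<phi>'(1) bB by (rule formulas_params_mono)
  then have "Neg \<phi>' \<in> q \<longleftrightarrow> \<phi>' \<notin> q" by (rule global_type_Neg[OF q])
  then obtain \<phi> where \<phi>: "\<phi> \<in> formulas L (insert b B) {y}" "\<phi> \<notin> q" "sat1 y a \<phi>"
    using \<phi>' by (metis formulas_simps(1) sat.simps(3))
  have \<phi>U: "\<phi> \<in> formulas L (univ U) {y}" using \<phi>(1) bB by (rule formulas_params_mono)
  obtain s where s: "\<And>i. realizes U y (s i) (q \<restriction> (B \<union> s ` {..<i :: nat}))"
    using morley_exists[OF q B(3,4)] by blast
  have sU: "range s \<subseteq> univ U" using realizes_univ[OF s] by blast
  obtain d where d: "realizes U y d (q \<restriction> (B \<union> range s))"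
    using restriction_realized[OF q Un_least[OF B(3) sU] small_Un[OF B(4) small_range]] by blast
  define g where "g = id(b := d)"
  \<comment> \<open>First \<open>a\<close> is moved to \<open>s i\<close> over \<open>B\<close>;
    then the image of \<open>b\<close> is moved to \<open>d\<close> while \<open>s i\<close> is
    kept.\<close>
  have aut: "\<exists>m. aut_over B m \<and> m a = s i \<and> m b = d" for i
  proof -
    have "realizes U y (s i) (q \<restriction> B)" using realizes_restrict_mono[OF s[of i]] by blast
    then obtain h where h: "automorphism L U h" "\<And>c. c \<in> B \<Longrightarrow> h c = c" "h a = s i"
      using realizations_conjugate[OF q B(3,4) a] by metis
    have "h ` insert a B = insert (s i) B" using h by (auto simp: image_iff)
    then have "realizes U y (h b) (q \<restriction> (insert (s i) B))"
      using realizes_aut_over[OF q q_invariant N(1), of h "insert a B" b] h(1,2) B(1,3)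
        realizes_univ[OF a] realizes_univ[OF b] b by (simp add: subset_iff)
    moreover have "realizes U y d (q \<restriction> (insert (s i) B))"
      using d by (rule realizes_restrict_mono) blast
    moreover have "insert (s i) B \<subseteq> univ U" "small \<kappa> (insert (s i) B)"
      using B(3,4) sU small_insert by auto
    ultimately obtain k where k: "automorphism L U k" "\<And>c. c \<in> insert (s i) B \<Longrightarrow> k c = c"
      "k (h b) = d"
      using realizations_conjugate[OF q] by metis
    have "automorphism L U (k \<circ> h)" using h(1) k(1) automorphism_comp by blast
    then show ?thesis using h k by (intro exI[of _ "k \<circ> h"]) simp
  qed
  \<comment> \<open>The conjugate of \<open>\<phi>\<close> depends only on the image of
    \<open>b\<close>, so one and the same formula is tested at all \<open>s i\<close>.\<close>
  have g: "pmap m \<phi> = pmap g \<phi>" if "aut_over B m" "m b = d" for m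
    using that \<phi>(1) by (intro psub_cong) (auto simp: g_def formulas_def)
  obtain m where m: "aut_over B m" "m b = d" using aut by blast
  have "pmap g \<phi> \<notin> q"
    using invariant_automorphism[OF q_invariant N(1), of m \<phi>] m B(1) \<phi>U \<phi>(2) g[OF m] by auto
  moreover have "pmap g \<phi> \<in> formulas L (univ U) {y}"
    unfolding g[OF m, symmetric] using \<phi>U m automorphism_in automorphism_fst
    by (intro pmap_formulas) auto
  moreover have "realizes U y (s i) (q \<restriction> (A \<union> s ` {..<i}))" for i
    using s[of i] by (rule realizes_restrict_mono) (use B(2) in blast)
  ultimately have "finite {k. sat1 y (s k) (pmap g \<phi>)}" by (intro finite_nongeneric)
  moreover have "sat1 y (s k) (pmap g \<phi>)" for k
  proof -
    obtain m where m: "aut_over B m" "m a = s k" "m b = d" using aut by blast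
    have "sat1 y (m a) (pmap m \<phi>) \<longleftrightarrow> sat1 y a \<phi>"
      by (rule sat1_automorphism[OF conjunct1[OF m(1)] \<phi>U realizes_univ[OF a] realizes_sort[OF a]])
    then show ?thesis using \<phi>(3) unfolding g[OF m(1,3)] m(2) by blast
  qed
  ultimately show False by simp
qed

text \<open>
  A realization \<open>b\<close> of \<open>q \<restriction> B\<close> cannot depend both on \<open>a\<close> and on an element \<open>c\<close> whose type
  over \<open>B\<close> is orthogonal to that of \<open>a\<close>. Otherwise, moving \<open>c\<close> over \<open>Ba\<close> to elements that are
  independent from everything constructed before yields an infinite Morley sequence of
  realizations of \<open>q \<restriction> B\<close> that all depend on \<open>a\<close>.
\<close>

lemma no_double_dependence:
  assumes p: "global_type L U x p" "invariant_type L U N x p"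
    and B: "N \<subseteq> B" "A \<subseteq> B" "B \<subseteq> univ U" "small \<kappa> B"
    and regular: "\<And>C b c. B \<subseteq> C \<Longrightarrow> C \<subseteq> univ U \<Longrightarrow> small \<kappa> C \<Longrightarrow> realizes U y b (q \<restriction> B) \<Longrightarrow>
      \<not> realizes U y b (q \<restriction> C) \<Longrightarrow> realizes U y c (q \<restriction> C) \<Longrightarrow>
      realizes U y c (q \<restriction> (insert b C))"
    and dom: "\<And>a. realizes U x a (p \<restriction> B) \<Longrightarrow> realizes U x a (p \<restriction> (insert c B))"
    and c: "c \<in> univ U" and a: "realizes U x a (p \<restriction> B)" and b: "realizes U y b (q \<restriction> B)"
    and bc: "\<not> realizes U y b (q \<restriction> (insert c B))"
    and \<psi>: "\<psi> \<in> formulas L (insert a B) {y}" "sat1 y b \<psi>" "\<psi> \<notin> q"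
  shows False
proof -
  have aU: "a \<in> univ U" and bU: "b \<in> univ U" and b_sort: "fst b = fst y"
    using a b realizes_univ realizes_sort by metis+
  have aBU: "insert a B \<subseteq> univ U" using aU B(3) by simp
  have \<psi>U: "\<psi> \<in> formulas L (univ U) {y}" using \<psi>(1) aBU by (rule formulas_params_mono)
  have cB: "insert c B \<subseteq> univ U" "small \<kappa> (insert c B)" using c B(3,4) small_insert by auto
  \<comment> \<open>A next member must continue the Morley sequence over \<open>B\<close> and still
    depend on \<open>a\<close> through \<open>\<psi>\<close>.\<close>
  define Q where "Q S d \<longleftrightarrow> realizes U y d (q \<restriction> (B \<union> S)) \<and> sat1 y d \<psi>" for S d
  have "\<exists>d. Q (s ` {..<n}) d" if s: "\<And>i. i < n \<Longrightarrow> Q (s ` {..<i}) (s i)" for n :: nat and s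
  proof -
    have s_real: "realizes U y (s i) (q \<restriction> (B \<union> s ` {..<i}))" if "i < n" for i
      using s[OF that] by (simp add: Q_def)
    have sU: "s ` {..<n} \<subseteq> univ U" using realizes_univ[OF s_real] by blast
    \<comment> \<open>Independence is arranged backwards: a Morley sequence is built over
      \<open>Bc\<close> and then moved onto \<open>s\<close> over \<open>B\<close>. The image
      \<open>c'\<close> of \<open>c\<close> is an element over which \<open>s\<close> is still
      Morley.\<close>
    obtain t where t: "\<And>i. realizes U y (t i) (q \<restriction> (insert c B \<union> t ` {..<i :: nat}))"
      using morley_exists[OF q cB] by blast
    have tU: "t i \<in> univ U" for i using realizes_univ[OF t] .
    have "realizes U y (t i) (q \<restriction> (B \<union> t ` {..<i}))" for i
      using t[of i] by (rule realizes_restrict_mono) blast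
    then obtain h where h: "aut_over B h" "\<forall>i<n. h (t i) = s i"
      using morley_conjugate[OF q q_invariant B(1,3,4), of n t s] s_real by blast
    have hN: "aut_over N h" using h(1) B(1) by blast
    define c' where "c' = h c"
    have c'U: "c' \<in> univ U" using c h(1) automorphism_in by (simp add: c'_def)
    have c'B: "insert c' B \<subseteq> univ U" "small \<kappa> (insert c' B)"
      using c'U B(3,4) small_insert by auto
    have s_c': "realizes U y (s i) (q \<restriction> (insert c' B \<union> s ` {..<i}))" if i: "i < n" for i
    proof -
      have "h ` (insert c B \<union> t ` {..<i}) = insert c' B \<union> s ` {..<i}"
        using h i by (auto simp: c'_def image_Un image_image)
      moreover have "insert c B \<union> t ` {..<i} \<subseteq> univ U" using cB(1) tU by blast
      ultimately have "realizes U y (h (t i)) (q \<restriction> (insert c' B \<union> s ` {..<i})) \<longleftrightarrow>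
          realizes U y (t i) (q \<restriction> (insert c B \<union> t ` {..<i}))"
        by (intro realizes_aut_over[OF q q_invariant N(1) hN _ tU])
      then have "realizes U y (h (t i)) (q \<restriction> (insert c' B \<union> s ` {..<i}))" using t by blast
      then show ?thesis using h(2) i by simp
    qed
    have hB: "h ` B = B" using h(1) by simp
    \<comment> \<open>The implication \<open>dom\<close> is transferred from \<open>c\<close> to
      \<open>c'\<close> by pulling \<open>a\<close> back along \<open>h\<close>.\<close>
    have a_c': "realizes U x a (p \<restriction> (insert c' B))"
    proof -
      obtain a0 where a0: "a0 \<in> univ U" "h a0 = a" using automorphism_surj h(1) aU by blast
      then have "realizes U x a0 (p \<restriction> B)"
        using realizes_aut_over[OF p N(1) hN B(3) a0(1) hB] a by simp
      then have "realizes U x a0 (p \<restriction> (insert c B))" by (rule dom)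
      moreover have "h ` insert c B = insert c' B" using hB by (simp add: c'_def)
      ultimately show ?thesis
        using realizes_aut_over[OF p N(1) hN cB(1) a0(1)] a0(2) by simp
    qed
    \<comment> \<open>Both \<open>h a\<close> and \<open>a\<close> realize \<open>p\<close> over
      \<open>Bc'\<close>. Correcting \<open>h\<close> by an automorphism fixing \<open>Bc'\<close>
      yields \<open>m\<close>, which carries \<open>c\<close> to \<open>c'\<close> and fixes
      \<open>Ba\<close>; the image \<open>d\<close> of \<open>b\<close> thus depends on
      \<open>a\<close> as well as on \<open>c'\<close>.\<close>
    have "realizes U x (h a) (p \<restriction> (insert c' B))"
      using realizes_aut_over[OF p N(1) hN cB(1) aU, of "insert c' B"] dom[OF a] hB
      by (simp add: c'_def)
    then obtain k where k: "automorphism L U k" "\<And>d. d \<in> insert c' B \<Longrightarrow> k d = d" "k (h a) = a"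
      using realizations_conjugate[OF p(1) c'B _ a_c'] by metis
    define m where "m = k \<circ> h"
    have m: "automorphism L U m" "m c = c'" "m a = a" "\<And>d. d \<in> B \<Longrightarrow> m d = d"
      using automorphism_comp[of h k] h(1) k by (simp_all add: m_def c'_def)
    then have mN: "aut_over N m" using B(1) by blast
    have mB: "m ` B = B" using m(4) by simp
    define d where "d = m b"
    have d: "realizes U y d (q \<restriction> B)"
      using realizes_aut_over[OF q q_invariant N(1) mN B(3) bU mB] b by (simp add: d_def)
    have dc': "\<not> realizes U y d (q \<restriction> (insert c' B))"
      using realizes_aut_over[OF q q_invariant N(1) mN cB(1) bU, of "insert c' B"] bc mB m(2)
      by (simp add: d_def)
    have "pmap m \<psi> = \<psi>" using \<psi>(1) m(3,4) by (intro pmap_id) (auto simp: formulas_def)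
    then have d\<psi>: "sat1 y d \<psi>"
      using sat1_automorphism[OF m(1) \<psi>U bU b_sort] \<psi>(2) by (simp add: d_def)
    \<comment> \<open>The new element fails \<open>q\<close> over \<open>Bc'\<close>, while
      \<open>s i\<close> realizes it over \<open>Bc'\<close> and the earlier members; regularity
      then allows adding \<open>d\<close> to the base of \<open>s i\<close>.\<close>
    have s_d: "realizes U y (s i) (q \<restriction> (insert d (B \<union> s ` {..<i})))" if i: "i < n" for i
    proof -
      let ?C = "insert c' B \<union> s ` {..<i}"
      have "s ` {..<i} \<subseteq> s ` {..<n}" using i by auto
      then have C: "B \<subseteq> ?C" "?C \<subseteq> univ U" "small \<kappa> ?C"
        using c'B(1) sU small_Un[OF c'B(2) small_range] by auto
      have "\<not> realizes U y d (q \<restriction> ?C)"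
        using dc' realizes_restrict_mono[of y d q ?C "insert c' B"] by blast
      then have "realizes U y (s i) (q \<restriction> (insert d ?C))"
        using regular[OF C d _ s_c'[OF i]] by simp
      then show ?thesis by (rule realizes_restrict_mono) blast
    qed
    \<comment> \<open>Symmetry reverses this one member at a time: once \<open>d\<close> is
      independent from the first \<open>i\<close> members, it can be exchanged with
      \<open>s i\<close> over them.\<close>
    have "realizes U y d (q \<restriction> (B \<union> s ` {..<i}))" if "i \<le> n" for i
      using that
    proof (induction i)
      case 0
      then show ?case using d by simp
    next
      case (Suc i)
      then have i: "i < n" "realizes U y d (q \<restriction> (B \<union> s ` {..<i}))" by simp_all
      have "s ` {..<i} \<subseteq> s ` {..<n}" using i by auto
      then have C: "N \<subseteq> B \<union> s ` {..<i}" "A \<subseteq> B \<union> s ` {..<i}" "B \<union> s ` {..<i} \<subseteq> univ U"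
        "small \<kappa> (B \<union> s ` {..<i})"
        using B(1-3) sU small_Un[OF B(4) small_range] by auto
      have "realizes U y d (q \<restriction> (insert (s i) (B \<union> s ` {..<i})))"
        by (rule symmetry[OF C i(2) s_d[OF i(1)]])
      then show ?case by (rule realizes_restrict_mono) (auto simp: lessThan_Suc)
    qed
    then have "Q (s ` {..<n}) d" using d\<psi> by (simp add: Q_def)
    then show ?thesis by blast
  qed
  then obtain s :: "nat \<Rightarrow> ('s, 'a) elem" where s: "\<And>n. Q (s ` {..<n}) (s n)"
    using nat_history_choice[of Q] by blast
  have "realizes U y (s i) (q \<restriction> (A \<union> s ` {..<i}))" for i
    using s[of i] B(2) realizes_restrict_mono[of y "s i" q "B \<union> s ` {..<i}" "A \<union> s ` {..<i}"]
    by (auto simp: Q_def)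
  then have "finite {k. sat1 y (s k) \<psi>}" using \<psi>U \<psi>(3) by (rule finite_nongeneric)
  then show False using s by (simp add: Q_def)
qed

end

section \<open>Instances of a formula that belong to a global type\<close>

context monster
begin

text \<open>\<open>generic x p e \<phi>\<close> says \<open>\<phi>(x; e) \<in> p\<close>, where all variables other than \<open>x\<close> are evaluated by \<open>e\<close>.\<close>

definition generic ::
    "'s var \<Rightarrow> ('s, 'f, 'r, 'a) form set \<Rightarrow> ('s var \<Rightarrow> ('s, 'a) elem) \<Rightarrow>
     ('s, 'f, 'r, 'a) form \<Rightarrow> bool" where
  "generic x p e \<phi> \<longleftrightarrow> inst ((Some \<circ> e)(x := None)) \<phi> \<in> p"

lemma generic_formula:
  assumes "assignment U e" "\<phi> \<in> formulas L B X" "e ` (X - {x}) \<subseteq> B"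
  shows "inst ((Some \<circ> e)(x := None)) \<phi> \<in> formulas L B {x}"
proof (rule inst_formulas[OF assms(2)])
  fix v c assume v: "((Some \<circ> e)(x := None)) v = Some c"
  then have "v \<noteq> x" "c = e v" by (auto split: if_splits)
  then show "fst c = fst v" using assms(1) by (simp add: assignment_def)
  assume "v \<in> free_vars \<phi>"
  then have "v \<in> X" using assms(2) by (auto simp: formulas_def)
  then show "c \<in> B" using \<open>v \<noteq> x\<close> \<open>c = e v\<close> assms(3) by blast
qed (auto split: if_splits)

lemma generic_formula_univ:
  assumes "assignment U e" "\<phi> \<in> formulas L B X" "B \<subseteq> univ U"
  shows "inst ((Some \<circ> e)(x := None)) \<phi> \<in> formulas L (univ U) {x}"
  using formulas_params_mono[OF assms(2,3)] assms(1)
  by (intro generic_formula[OF assms(1)]) (auto simp: assignment_def)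

lemma sat_inst_assignment:
  "sat U e (inst ((Some \<circ> e')(x := None)) \<phi>) \<longleftrightarrow> sat U (e'(x := e x)) \<phi>"
proof -
  have "override e ((Some \<circ> e')(x := None)) = e'(x := e x)"
    by (auto simp: override_def fun_eq_iff)
  then show ?thesis by (simp only: sat_inst)
qed

lemma generic_iff_sat:
  assumes "global_type L U x p" "assignment U e" "\<phi> \<in> formulas L B X" "e ` (X - {x}) \<subseteq> B"
    and "B \<subseteq> univ U" "realizes U x b (p \<restriction> B)"
  shows "generic x p e \<phi> \<longleftrightarrow> sat U (e(x := b)) \<phi>"
  using realizes_sat1[OF assms(1,5,6) generic_formula[OF assms(2-4)]]
  unfolding generic_def sat_inst_assignment by simp

lemma generic_Neg:
  assumes "global_type L U x p" "assignment U e" "\<phi> \<in> formulas L B X" "B \<subseteq> univ U"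
  shows "generic x p e (Neg \<phi>) \<longleftrightarrow> \<not> generic x p e \<phi>"
  using global_type_Neg[OF assms(1) generic_formula_univ[OF assms(2-4)]]
  unfolding generic_def by simp

end

subsection \<open>Definability of generically stable types\<close>

context gs_type
begin

text \<open>
  If no formula in the type of \<open>e\<close> over \<open>N\<close> implied that \<open>\<phi>(y; \<cdot>)\<close> is generic, then by compactness
  some \<open>e'\<close> of the same type would satisfy \<open>\<not> \<phi>(s\<^sub>i; e')\<close> along a whole Morley sequence.
\<close>

lemma generic_open:
  assumes \<phi>: "\<phi> \<in> formulas L N (insert y Z)" and Z: "finite Z" "y \<notin> Z"
    and e: "assignment U e" "generic y q e \<phi>"
  shows "\<exists>\<chi>\<in>formulas L N Z. sat U e \<chi> \<and>
    (\<forall>e'. assignment U e' \<longrightarrow> sat U e' \<chi> \<longrightarrow> generic y q e' \<phi>)"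
proof (rule ccontr)
  assume contra: "\<not> ?thesis"
  define B where "B = A \<union> N"
  have B: "B \<subseteq> univ U" "small \<kappa> B" using A N small_Un by (auto simp: B_def)
  obtain s where s: "\<And>i. realizes U y (s i) (q \<restriction> (B \<union> s ` {..<i :: nat}))"
    using morley_exists[OF q B] by blast
  have sU: "s i \<in> univ U" for i using realizes_univ[OF s] .
  have s_sort: "fst (s i) = fst y" for i using realizes_sort[OF s] .
  \<comment> \<open>The type over \<open>N\<close> of the values of \<open>e\<close> on
    \<open>Z\<close>; the formulas \<open>\<theta> i\<close> add that \<open>\<phi>\<close> fails at
    each \<open>s i\<close>.\<close>
  define \<Sigma>1 where "\<Sigma>1 = {\<chi> \<in> formulas L N Z. sat U e \<chi>}"
  define \<theta> where "\<theta> i = inst [y \<mapsto> s i] (Neg \<phi>)" for i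
  have \<theta>_sat: "sat U e' (\<theta> i) \<longleftrightarrow> \<not> sat U (e'(y := s i)) \<phi>" for e' i
    by (simp add: \<theta>_def sat_inst override_single)
  have BsU: "B \<union> range s \<subseteq> univ U" "small \<kappa> (B \<union> range s)"
    using B sU small_Un[OF B(2) small_range] by auto
  have \<theta>: "\<theta> i \<in> formulas L (B \<union> range s) Z" for i
    unfolding \<theta>_def
  proof (rule inst_formulas)
    show "Neg \<phi> \<in> formulas L N (insert y Z)" using \<phi> by simp
    fix v c assume "[y \<mapsto> s i] v = Some c"
    then have "v = y" "c = s i" by (auto split: if_splits)
    then show "fst c = fst v" "c \<in> B \<union> range s" using s_sort by simp_all
  qed (auto simp: B_def)
  have sub: "\<Sigma>1 \<union> range \<theta> \<subseteq> formulas L (B \<union> range s) Z"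
    using \<theta> formulas_params_mono[of _ L N Z "B \<union> range s"] by (auto simp: \<Sigma>1_def B_def)
  have "finitely_satisfiable U (\<Sigma>1 \<union> range \<theta>)"
    unfolding finitely_satisfiable_def
  proof (intro allI impI)
    fix F assume F: "F \<subseteq> \<Sigma>1 \<union> range \<theta>" "finite F"
    have "\<exists>I. finite I \<and> F - \<Sigma>1 = \<theta> ` I"
      using finite_subset_image[of "F - \<Sigma>1" \<theta> UNIV] F by blast
    then obtain I where I: "finite I" "F - \<Sigma>1 = \<theta> ` I" by blast
    have "\<exists>n. \<forall>i\<in>I. i < n" using I(1) by (simp add: finite_nat_set_iff_bounded)
    then obtain n where n: "\<forall>i\<in>I. i < n" by blast
    obtain \<chi> where \<chi>: "\<chi> \<in> formulas L N Z"
      "\<forall>e. assignment U e \<longrightarrow> (sat U e \<chi> \<longleftrightarrow> (\<forall>\<psi>\<in>F \<inter> \<Sigma>1. sat U e \<psi>))"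
      using finite_conj[of "F \<inter> \<Sigma>1" N Z] F(2) by (auto simp: \<Sigma>1_def)
    have "sat U e \<chi>" using \<chi>(2) e(1) by (auto simp: \<Sigma>1_def)
    then obtain e' where e': "assignment U e'" "sat U e' \<chi>" "\<not> generic y q e' \<phi>"
      using contra \<chi>(1) by blast
    \<comment> \<open>A Morley sequence over the values of \<open>e'\<close> as well consists of
      failures of \<open>\<phi>\<close>, because \<open>\<phi>\<close> is not generic at
      \<open>e'\<close>.\<close>
    define C where "C = B \<union> e' ` Z"
    have C: "C \<subseteq> univ U" "small \<kappa> C"
      using B(1) e'(1) small_Un[OF B(2) small_finite[of "e' ` Z"]] Z(1)
      by (auto simp: C_def assignment_def)
    obtain t where t: "\<And>i. realizes U y (t i) (q \<restriction> (C \<union> t ` {..<i :: nat}))"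
      using morley_exists[OF q C] by blast
    have "realizes U y (t i) (q \<restriction> (B \<union> t ` {..<i}))" for i
      using t[of i] by (rule realizes_restrict_mono) (auto simp: C_def)
    moreover have "N \<subseteq> B" by (simp add: B_def)
    \<comment> \<open>Moving \<open>t\<close> onto the given \<open>s\<close> takes
      \<open>e'\<close> along, so the image of \<open>e'\<close> satisfies the finite part
      \<open>F\<close>.\<close>
    ultimately obtain h where h: "aut_over B h" "\<forall>i<n. h (t i) = s i"
      using morley_conjugate[OF q q_invariant _ B, of n t s] s by blast
    have h_fix: "pmap h \<psi> = \<psi>" if "\<psi> \<in> formulas L N X" for \<psi> X
      using that h(1) by (intro pmap_id) (auto simp: formulas_def B_def)
    have h_sat: "sat U (h \<circ> e'') \<psi> \<longleftrightarrow> sat U e'' \<psi>"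
      if "\<psi> \<in> formulas L N X" "assignment U e''" for \<psi> X e''
      using sat_automorphism[OF conjunct1[OF h(1)] that(2), of \<psi>] h_fix[OF that(1)] that(1) N(1)
      by (auto simp: formulas_def)
    have e'': "assignment U (h \<circ> e')" using automorphism_assignment h(1) e'(1) by blast
    have "sat U (h \<circ> e') (\<theta> i)" if "i < n" for i
    proof -
      have ti: "realizes U y (t i) (q \<restriction> C)"
        using t[of i] by (rule realizes_restrict_mono) blast
      have "\<phi> \<in> formulas L C (insert y Z)"
        using \<phi> by (rule formulas_params_mono) (auto simp: C_def B_def)
      then have "\<not> sat U (e'(y := t i)) \<phi>"
        using generic_iff_sat[OF q e'(1) _ _ C(1) ti] e'(3) by (auto simp: C_def)
      moreover have "assignment U (e'(y := t i))"
        by (rule assignment_upd[OF e'(1) realizes_univ[OF ti] realizes_sort[OF ti]])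
      ultimately have "\<not> sat U (h \<circ> e'(y := t i)) \<phi>" using h_sat[OF \<phi>] by simp
      moreover have "h \<circ> e'(y := t i) = (h \<circ> e')(y := s i)"
        using h(2) that by (auto simp: fun_eq_iff)
      ultimately show ?thesis by (simp only: \<theta>_sat not_False_eq_True)
    qed
    moreover have "sat U (h \<circ> e') \<psi>" if "\<psi> \<in> F \<inter> \<Sigma>1" for \<psi>
    proof -
      have "sat U (h \<circ> e') \<chi>" using h_sat[OF \<chi>(1) e'(1)] e'(2) by simp
      then show ?thesis using \<chi>(2) e'' that by blast
    qed
    ultimately have "sat U (h \<circ> e') \<psi>" if "\<psi> \<in> F" for \<psi>
    proof (cases "\<psi> \<in> \<Sigma>1")
      case False
      then have "\<psi> \<in> \<theta> ` I" using that I(2) by blast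
      then show ?thesis using n \<open>\<And>i. i < n \<Longrightarrow> sat U (h \<circ> e') (\<theta> i)\<close> by auto
    qed (use that in simp)
    then show "\<exists>e. assignment U e \<and> (\<forall>\<psi>\<in>F. sat U e \<psi>)" using e'' by blast
  qed
  then obtain e1 where e1: "assignment U e1" "\<forall>\<psi>\<in>\<Sigma>1 \<union> range \<theta>. sat U e1 \<psi>"
    using finitely_satisfiable_realized[OF Z(1) BsU sub] by blast
  have "generic y q e1 \<phi>"
  proof -
    \<comment> \<open>Invariance concerns finite tuples, so assignments are cut down to
      \<open>Z\<close>; this leaves \<open>y\<close> free.\<close>
    define b where "b = (\<lambda>e v. if v \<in> Z then Some (e v) else None :: ('s, 'a) elem option)"
    have dom_b: "dom (b e') = Z" for e' by (auto simp: b_def split: if_splits)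
    have inst_b: "inst (b e') \<phi> = inst ((Some \<circ> e')(y := None)) \<phi>" for e'
      using \<phi> Z(2) by (intro inst_cong) (auto simp: b_def formulas_def)
    have tuple_b: "tuple (univ U) (b e')" if "assignment U e'" for e'
      using that Z(1) unfolding tuple_def dom_b by (auto simp: b_def assignment_def split: if_splits)
    have holds_b: "U \<Turnstile> inst (b e') \<psi> \<longleftrightarrow> sat U e' \<psi>"
      if "assignment U e'" "\<psi> \<in> formulas L N Z" for e' \<psi>
    proof -
      have "inst (b e') \<psi> \<in> formulas L (univ U) {}"
        using tuple_b[OF that(1)] N(1)
        by (intro inst_formulas[OF that(2)]) (auto simp: tuple_def dom_b)
      moreover have "override e' (b e') = e'" by (auto simp: override_def b_def fun_eq_iff)
      ultimately show ?thesis using holds_iff[OF _ that(1)] by (simp add: sat_inst)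
    qed
    have imp: "sat U e1 \<psi>" if "\<psi> \<in> formulas L N Z" "sat U e \<psi>" for \<psi>
      using e1(2) that by (simp add: \<Sigma>1_def ball_Un)
    have "sat U e \<psi> \<longleftrightarrow> sat U e1 \<psi>" if "\<psi> \<in> formulas L N Z" for \<psi>
      using imp[of \<psi>] imp[of "Neg \<psi>"] that by auto
    then have "same_type L U N (b e) (b e1)"
      unfolding same_type_def dom_b using holds_b e(1) e1(1) by simp
    then have "inst (b e) \<phi> \<in> q \<longleftrightarrow> inst (b e1) \<phi> \<in> q"
      using q_invariant tuple_b[OF e(1)] tuple_b[OF e1(1)] Z(2) \<phi>
      unfolding invariant_type_def dom_b by (metis dom_b)
    then show ?thesis using e(2) by (simp add: generic_def inst_b)
  qed
  \<comment> \<open>By invariance \<open>\<phi>\<close> is generic at \<open>e1\<close>, so the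
    negation of its instance is outside \<open>q\<close>, yet it holds along the whole
    sequence.\<close>
  moreover have "\<not> sat1 y (s i) (inst ((Some \<circ> e1)(y := None)) \<phi>)" for i
  proof -
    have "sat U e1 (\<theta> i)" using e1(2) by simp
    then show ?thesis by (simp add: sat_inst_assignment \<theta>_sat)
  qed
  moreover have in_U: "inst ((Some \<circ> e1)(y := None)) \<phi> \<in> formulas L (univ U) {y}"
    using generic_formula_univ[OF e1(1) \<phi> N(1)] .
  moreover have "realizes U y (s i) (q \<restriction> (A \<union> s ` {..<i}))" for i
    using s[of i] by (rule realizes_restrict_mono) (auto simp: B_def)
  ultimately show False
    using finite_nongeneric[of s "Neg (inst ((Some \<circ> e1)(y := None)) \<phi>)"] global_type_Neg[OF q in_U]
    by (simp add: generic_def)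
qed

text \<open>By \<open>generic_open\<close>, applied to \<open>\<phi>\<close> and to its negation,
  the set of generic parameters and its complement are both unions of sets definable over
  \<open>N\<close>. Compactness leaves finitely many of them.\<close>

lemma generic_definable:
  assumes \<phi>: "\<phi> \<in> formulas L N (insert y Z)" and Z: "finite Z" "y \<notin> Z"
  shows "\<exists>\<delta>\<in>formulas L N Z. \<forall>e. assignment U e \<longrightarrow> (sat U e \<delta> \<longleftrightarrow> generic y q e \<phi>)"
proof -
  define P where "P \<psi> = {\<chi> \<in> formulas L N Z. \<forall>e. assignment U e \<longrightarrow> sat U e \<chi> \<longrightarrow> generic y q e \<psi>}" for \<psi>
  have Neg_\<phi>: "generic y q e (Neg \<phi>) \<longleftrightarrow> \<not> generic y q e \<phi>" if "assignment U e" for e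
    using generic_Neg[OF q that \<phi> N(1)] .
  \<comment> \<open>No assignment satisfies this set: one of \<open>\<phi>\<close> and
    \<open>Neg \<phi>\<close> is generic at it, and this is implied by a formula true there whose
    negation was included.\<close>
  define \<Sigma> where "\<Sigma> = Neg ` (P \<phi> \<union> P (Neg \<phi>))"
  have sub: "\<Sigma> \<subseteq> formulas L N Z" by (auto simp: \<Sigma>_def P_def)
  have "\<not> finitely_satisfiable U \<Sigma>"
  proof
    assume "finitely_satisfiable U \<Sigma>"
    then obtain e where e: "assignment U e" "\<forall>\<psi>\<in>\<Sigma>. sat U e \<psi>"
      using finitely_satisfiable_realized[OF Z(1) N sub] by blast
    obtain \<psi> where \<psi>: "\<psi> = \<phi> \<or> \<psi> = Neg \<phi>" "generic y q e \<psi>" using Neg_\<phi>[OF e(1)] by blast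
    then have "\<psi> \<in> formulas L N (insert y Z)" using \<phi> by auto
    then obtain \<chi> where \<chi>: "\<chi> \<in> P \<psi>" "sat U e \<chi>"
      using generic_open[OF _ Z e(1) \<psi>(2)] by (auto simp: P_def)
    then have "Neg \<chi> \<in> \<Sigma>" using \<psi>(1) by (auto simp: \<Sigma>_def)
    then show False using e(2) \<chi>(2) by fastforce
  qed
  then obtain F where F: "F \<subseteq> \<Sigma>" "finite F" "\<And>e. assignment U e \<Longrightarrow> \<not> (\<forall>\<psi>\<in>F. sat U e \<psi>)"
    unfolding finitely_satisfiable_def by blast
  \<comment> \<open>\<open>Neg \<chi>\<close> is the disjunction of those members of
    \<open>P \<phi>\<close> whose negations occur in \<open>F\<close>. Where it fails, a member of
    \<open>P (Neg \<phi>)\<close> holds.\<close>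
  obtain \<chi> where \<chi>: "\<chi> \<in> formulas L N Z"
    "\<forall>e. assignment U e \<longrightarrow> (sat U e \<chi> \<longleftrightarrow> (\<forall>\<psi>\<in>F \<inter> Neg ` P \<phi>. sat U e \<psi>))"
    using finite_conj[of "F \<inter> Neg ` P \<phi>" N Z] F(1,2) sub by blast
  have "sat U e (Neg \<chi>) \<longleftrightarrow> generic y q e \<phi>" if e: "assignment U e" for e
  proof
    assume "sat U e (Neg \<chi>)"
    then obtain \<psi> where "\<psi> \<in> P \<phi>" "sat U e \<psi>" using \<chi>(2) e by auto
    then show "generic y q e \<phi>" using e by (simp add: P_def)
  next
    assume gen: "generic y q e \<phi>"
    obtain \<psi> where \<psi>: "\<psi> \<in> F" "\<not> sat U e \<psi>" using F(3)[OF e] by blast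
    then obtain \<psi>' where \<psi>': "\<psi> = Neg \<psi>'" "\<psi>' \<in> P \<phi> \<union> P (Neg \<phi>)" using F(1) by (auto simp: \<Sigma>_def)
    then have "sat U e \<psi>'" using \<psi>(2) by simp
    then have "\<psi>' \<notin> P (Neg \<phi>)" using gen Neg_\<phi>[OF e] e by (auto simp: P_def)
    then have "\<psi> \<in> F \<inter> Neg ` P \<phi>" using \<psi>(1) \<psi>' by blast
    then show "sat U e (Neg \<chi>)" using \<chi>(2) e \<psi>(2) by auto
  qed
  then show ?thesis using \<chi>(1) by (intro bexI[of _ "Neg \<chi>"]) simp_all
qed

end

subsection \<open>Weak orthogonality\<close>

context monster
begin

text \<open>Definability and transfer to a submodel concern formulas over the small base. Parameters
  from outside it are turned into variables, to be assigned elements of the submodel later.\<close>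

lemma abstract_params:
  assumes "\<phi> \<in> formulas L B X" "\<And>c. fst (g c) = fst c" "\<And>c. g c \<notin> all_vars \<phi>"
  shows "psub (\<lambda>c. Var (g c)) \<phi> \<in> formulas L {} (X \<union> g ` params \<phi>)"
    and "(\<And>c. c \<in> params \<phi> \<Longrightarrow> e (g c) = c) \<Longrightarrow> sat U e (psub (\<lambda>c. Var (g c)) \<phi>) = sat U e \<phi>"
proof -
  have "wf_form L (psub (\<lambda>c. Var (g c)) \<phi>)"
    using assms(1,2) by (intro wf_psub) (auto simp: formulas_def)
  moreover have "free_vars (psub (\<lambda>c. Var (g c)) \<phi>) \<subseteq> X \<union> g ` params \<phi>"
    using assms(1) free_vars_psub[of "\<lambda>c. Var (g c)" \<phi>] by (auto simp: formulas_def)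
  ultimately show "psub (\<lambda>c. Var (g c)) \<phi> \<in> formulas L {} (X \<union> g ` params \<phi>)"
    by (simp add: formulas_def params_psub)
next
  assume e: "\<And>c. c \<in> params \<phi> \<Longrightarrow> e (g c) = c"
  have "sat U e (psub (\<lambda>c. Var (g c)) \<phi>) = sat U e (pmap (\<lambda>c. val U e (Var (g c))) \<phi>)"
    using assms(3) by (intro sat_psub) auto
  also have "pmap (\<lambda>c. val U e (Var (g c))) \<phi> = \<phi>" using e by (intro pmap_id) simp
  finally show "sat U e (psub (\<lambda>c. Var (g c)) \<phi>) = sat U e \<phi>" .
qed

lemma abstract_assignment:
  assumes "inj_on g P" "\<And>c. fst (g c) = fst c" "P \<subseteq> univ U"
  shows "\<exists>e. assignment U e \<and> (\<forall>c\<in>P. e (g c) = c)"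
proof (intro exI conjI ballI)
  let ?e = "\<lambda>v. if v \<in> g ` P then inv_into P g v else e0 v"
  show "?e (g c) = c" if "c \<in> P" for c using that assms(1) by simp
  show "assignment U ?e"
    unfolding assignment_def
  proof
    fix v
    show "?e v \<in> univ U \<and> fst (?e v) = fst v"
    proof (cases "v \<in> g ` P")
      case True
      then obtain c where "c \<in> P" "v = g c" by blast
      then show ?thesis using assms by auto
    next
      case False
      then show ?thesis using assignment_e0 by (simp add: assignment_def)
    qed
  qed
qed

end

section \<open>Existential closures and elementary submodels\<close>

lemma sat_foldr_Exists:
  "sat S e (foldr Exists vs \<phi>) \<longleftrightarrow>
    (\<exists>e'. (\<forall>v\<in>set vs. e' v \<in> univ S \<and> fst (e' v) = fst v) \<and> (\<forall>v. v \<notin> set vs \<longrightarrow> e' v = e v) \<and>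
      sat S e' \<phi>)"
proof (induction vs arbitrary: e)
  case Nil
  show ?case by (auto simp: fun_eq_iff[symmetric])
next
  case (Cons w vs)
  show ?case
  proof
    assume "sat S e (foldr Exists (w # vs) \<phi>)"
    then obtain c where c: "c \<in> univ S" "fst c = fst w" "sat S (e(w := c)) (foldr Exists vs \<phi>)"
      by auto
    then obtain e' where e': "\<forall>v\<in>set vs. e' v \<in> univ S \<and> fst (e' v) = fst v"
      "\<forall>v. v \<notin> set vs \<longrightarrow> e' v = (e(w := c)) v" "sat S e' \<phi>"
      using Cons.IH[of "e(w := c)"] by blast
    moreover have "e' w \<in> univ S \<and> fst (e' w) = fst w" using e'(1,2) c(1,2) by (cases "w \<in> set vs") auto
    moreover have "\<forall>v. v \<notin> set (w # vs) \<longrightarrow> e' v = e v" using e'(2) by simp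
    ultimately show "\<exists>e'. (\<forall>v\<in>set (w # vs). e' v \<in> univ S \<and> fst (e' v) = fst v) \<and>
        (\<forall>v. v \<notin> set (w # vs) \<longrightarrow> e' v = e v) \<and> sat S e' \<phi>"
      by (intro exI[of _ e']) simp
  next
    assume "\<exists>e'. (\<forall>v\<in>set (w # vs). e' v \<in> univ S \<and> fst (e' v) = fst v) \<and>
        (\<forall>v. v \<notin> set (w # vs) \<longrightarrow> e' v = e v) \<and> sat S e' \<phi>"
    then obtain e' where e': "\<forall>v\<in>set (w # vs). e' v \<in> univ S \<and> fst (e' v) = fst v"
      "\<forall>v. v \<notin> set (w # vs) \<longrightarrow> e' v = e v" "sat S e' \<phi>"
      by blast
    then have "sat S (e(w := e' w)) (foldr Exists vs \<phi>)"
      unfolding Cons.IH by (intro exI[of _ e']) simp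
    moreover have "e' w \<in> univ S" "fst (e' w) = fst w" using e'(1) by simp_all
    ultimately show "sat S e (foldr Exists (w # vs) \<phi>)" unfolding foldr.simps o_apply sat.simps by blast
  qed
qed

lemma foldr_Exists_formulas:
  "\<phi> \<in> formulas L A (X \<union> set vs) \<Longrightarrow> foldr Exists vs \<phi> \<in> formulas L A X"
  by (induction vs arbitrary: X) auto

lemma ex_assignment:
  assumes "is_structure L S"
  shows "\<exists>e. assignment S e"
proof -
  have "\<forall>v :: 'a \<times> nat. \<exists>c. c \<in> univ S \<and> fst c = fst v"
    using assms unfolding is_structure_def by blast
  then show ?thesis unfolding assignment_def by (rule choice)
qed

context monster
begin

text \<open>The existential closure transfers down to the submodel. A witness found there is
  inserted as parameters, and the resulting sentence over \<open>M\<close> transfers back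
  up.\<close>

lemma elementary_submodel_witness:
  assumes M: "elementary_submodel L M U" and \<chi>: "\<chi> \<in> formulas L M Z" "finite Z"
    and e: "assignment U e" "sat U e \<chi>"
  shows "\<exists>e'. assignment U e' \<and> (\<forall>v. e' v \<in> M) \<and> sat U e' \<chi>"
proof -
  let ?S = "U\<lparr>univ := M\<rparr>"
  have MU: "M \<subseteq> univ U" and S: "is_structure L ?S"
    and elem: "\<And>\<phi>. \<phi> \<in> formulas L M {} \<Longrightarrow> ?S \<Turnstile> \<phi> \<longleftrightarrow> U \<Turnstile> \<phi>"
    using M by (auto simp: elementary_submodel_def)
  obtain vs where vs: "set vs = Z" using finite_list[OF \<chi>(2)] by blast
  have \<sigma>: "foldr Exists vs \<chi> \<in> formulas L M {}"
    using \<chi>(1) by (intro foldr_Exists_formulas) (simp add: vs)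
  have "sat U e (foldr Exists vs \<chi>)"
    unfolding sat_foldr_Exists using e by (intro exI[of _ e]) (simp add: assignment_def)
  then have "U \<Turnstile> foldr Exists vs \<chi>" using holds_iff[OF \<sigma> e(1)] by simp
  then have "?S \<Turnstile> foldr Exists vs \<chi>" using elem[OF \<sigma>] by simp
  moreover obtain e1 where e1: "assignment ?S e1" using ex_assignment[OF S] by blast
  ultimately have "sat ?S e1 (foldr Exists vs \<chi>)" by (simp add: holds_def)
  then obtain e2 where e2: "\<forall>v\<in>set vs. e2 v \<in> M \<and> fst (e2 v) = fst v"
    "\<forall>v. v \<notin> set vs \<longrightarrow> e2 v = e1 v" "sat ?S e2 \<chi>"
    unfolding sat_foldr_Exists by auto
  have e2M: "e2 v \<in> M" "fst (e2 v) = fst v" for v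
    using e2(1,2) e1 by (cases "v \<in> set vs"; simp add: assignment_def)+
  have inst: "inst (Some \<circ> e2) \<chi> \<in> formulas L M {}"
  proof (rule inst_formulas[OF \<chi>(1)])
    fix v c assume "(Some \<circ> e2) v = Some c"
    then have "c = e2 v" by simp
    then show "fst c = fst v" "c \<in> M" using e2M by simp_all
  qed auto
  have ov: "override e' (Some \<circ> e2) = e2" for e' by (simp add: override_def fun_eq_iff)
  have "?S \<Turnstile> inst (Some \<circ> e2) \<chi>"
    unfolding holds_def sat_inst ov using e2(3) by blast
  then have "U \<Turnstile> inst (Some \<circ> e2) \<chi>" using elem[OF inst] by simp
  then have "sat U e2 \<chi>" using holds_iff[OF inst e(1)] unfolding sat_inst ov by simp
  moreover have "assignment U e2" using e2M MU by (auto simp: assignment_def)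
  ultimately show ?thesis using e2M by blast
qed

section \<open>Weak orthogonality and strong regularity in terms of assignments and
  realizations\<close>

lemma sat_restriction:
  assumes "global_type L U x p" "B \<subseteq> univ U" "realizes U x (e x) (p \<restriction> B)" "\<phi> \<in> p \<restriction> B"
  shows "sat U e \<phi>"
proof -
  have "\<phi> \<in> formulas L B {x}" using restrict_sub[OF global_type_sub[OF assms(1)]] assms(4) by blast
  then have "sat1 x (e x) \<phi>" "sat U (e(x := e x)) \<phi> \<longleftrightarrow> sat1 x (e x) \<phi>"
    using realizes_sat1[OF assms(1-3)] assms(4) sat1_iff[of \<phi> B x e "e x"]
    by (simp_all add: restrict_type_def)
  then show ?thesis by simp
qed

text \<open>Consistency is automatic because the variables are disjoint; what remains of
  completeness is that every formula is decided.\<close>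

lemma weakly_orthogonal_iff:
  assumes p: "global_type L U x p" and q: "global_type L U y q" and "x \<noteq> y"
  shows "weakly_orthogonal L U B x (p \<restriction> B) y (q \<restriction> B) \<longleftrightarrow>
    (\<forall>\<psi>\<in>formulas L B {x, y}. entails U (p \<restriction> B \<union> q \<restriction> B) \<psi> \<or> entails U (p \<restriction> B \<union> q \<restriction> B) (Neg \<psi>))"
proof -
  let ?\<Sigma> = "{\<psi>\<in>formulas L B {x, y}. entails U (p \<restriction> B \<union> q \<restriction> B) \<psi>}"
  have "finitely_satisfiable U ?\<Sigma>"
    unfolding finitely_satisfiable_def
  proof (intro allI impI)
    fix G assume G: "G \<subseteq> ?\<Sigma>" "finite G"
    then have "\<forall>\<psi>\<in>G. \<exists>F. F \<subseteq> p \<restriction> B \<union> q \<restriction> B \<and> finite F \<and>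
        (\<forall>e. assignment U e \<longrightarrow> (\<forall>\<phi>\<in>F. sat U e \<phi>) \<longrightarrow> sat U e \<psi>)"
      by (auto simp: entails_def)
    then obtain f where f: "\<forall>\<psi>\<in>G. f \<psi> \<subseteq> p \<restriction> B \<union> q \<restriction> B \<and> finite (f \<psi>) \<and>
        (\<forall>e. assignment U e \<longrightarrow> (\<forall>\<phi>\<in>f \<psi>. sat U e \<phi>) \<longrightarrow> sat U e \<psi>)"
      by (rule bchoice[THEN exE])
    define F where "F = (\<Union>\<psi>\<in>G. f \<psi>)"
    have F: "F \<subseteq> p \<union> q" "finite F" using f G(2) by (auto simp: F_def restrict_type_def)
    obtain e1 where e1: "assignment U e1" "\<forall>\<phi>\<in>F \<inter> p. sat U e1 \<phi>"
      using global_type_finite[OF p, of "F \<inter> p"] F(2) by blast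
    obtain e2 where e2: "assignment U e2" "\<forall>\<phi>\<in>F \<inter> q. sat U e2 \<phi>"
      using global_type_finite[OF q, of "F \<inter> q"] F(2) by blast
    \<comment> \<open>Formulas of \<open>p\<close> see only \<open>x\<close> and those of
      \<open>q\<close> only \<open>y\<close>, so solutions of the two finite parts can be
      glued.\<close>
    define e where "e = e1(y := e2 y)"
    have e: "assignment U e" using e1(1) e2(1) by (simp add: e_def assignment_def)
    have sat_F: "sat U e \<phi>" if "\<phi> \<in> F" for \<phi>
    proof (cases "\<phi> \<in> p")
      case True
      then have "free_vars \<phi> \<subseteq> {x}" using global_type_sub[OF p] by (auto simp: formulas_def)
      then have "sat U e \<phi> = sat U e1 \<phi>" using assms(3) by (intro sat_cong) (auto simp: e_def)
      then show ?thesis using True that e1(2) by blast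
    next
      case False
      then have "\<phi> \<in> q" using that F(1) by blast
      then have "free_vars \<phi> \<subseteq> {y}" using global_type_sub[OF q] by (auto simp: formulas_def)
      then have "sat U e \<phi> = sat U e2 \<phi>" by (intro sat_cong) (auto simp: e_def)
      then show ?thesis using \<open>\<phi> \<in> q\<close> that e2(2) by blast
    qed
    have "sat U e \<psi>" if "\<psi> \<in> G" for \<psi>
    proof -
      have "\<forall>\<phi>\<in>f \<psi>. sat U e \<phi>" using sat_F that by (simp add: F_def) blast
      then show ?thesis using bspec[OF f that] e by simp
    qed
    then show "\<exists>e. assignment U e \<and> (\<forall>\<psi>\<in>G. sat U e \<psi>)" using e by blast
  qed
  then show ?thesis unfolding weakly_orthogonal_def complete_type_def by auto
qed

lemma restrict_univ: "global_type L U x p \<Longrightarrow> p \<restriction> univ U = p"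
  using global_type_sub by (fastforce simp: restrict_type_def formulas_def)

text \<open>Entailment of the larger restriction is used only through realizations: what is
  independent over \<open>B\<close> stays so after adding an element of \<open>\<phi>\<close> that
  does not realize \<open>p\<close> over \<open>B\<close>.\<close>

lemma strongly_regular_witness:
  assumes "strongly_regular L \<kappa> U x p \<phi>" and p: "global_type L U x p"
  shows "\<exists>A\<subseteq>univ U. small \<kappa> A \<and> (\<forall>B a b. A \<subseteq> B \<longrightarrow> B \<subseteq> univ U \<longrightarrow> small \<kappa> B \<longrightarrow>
    realizes U x a {\<phi>} \<longrightarrow> \<not> realizes U x a (p \<restriction> B) \<longrightarrow> realizes U x b (p \<restriction> B) \<longrightarrow>
    realizes U x b (p \<restriction> (insert a B)))"
proof -
  obtain A where A: "A \<subseteq> univ U" "small \<kappa> A"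
    "\<forall>B a. A \<subseteq> B \<longrightarrow> B \<subseteq> univ U \<longrightarrow> small \<kappa> B \<longrightarrow> realizes U x a {\<phi>} \<longrightarrow>
      realizes U x a (p \<restriction> B) \<or> (\<forall>\<psi>\<in>p \<restriction> insert a B. entails U (p \<restriction> B) \<psi>)"
    using assms(1)[unfolded strongly_regular_def] by (elim exE conjE, intro that)
  have "realizes U x b (p \<restriction> (insert a B))"
    if B: "A \<subseteq> B" "B \<subseteq> univ U" "small \<kappa> B" "realizes U x a {\<phi>}" "\<not> realizes U x a (p \<restriction> B)"
      and b: "realizes U x b (p \<restriction> B)" for B a b
  proof -
    have b_univ: "b \<in> univ U" "fst b = fst x" using realizes_univ[OF b] realizes_sort[OF b] by auto
    have as: "assignment U (e0(x := b))" by (rule assignment_upd[OF assignment_e0 b_univ])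
    have "sat1 x b \<psi>" if "\<psi> \<in> p \<restriction> insert a B" for \<psi>
    proof -
      have "entails U (p \<restriction> B) \<psi>" using A(3) B that by blast
      then obtain F where F: "F \<subseteq> p \<restriction> B"
        "\<forall>e. assignment U e \<longrightarrow> (\<forall>\<phi>\<in>F. sat U e \<phi>) \<longrightarrow> sat U e \<psi>"
        unfolding entails_def by (elim exE conjE, intro that)
      have "sat1 x b \<theta>" if "\<theta> \<in> F" for \<theta>
        using sat_restriction[OF p B(2), of "e0(x := b)" \<theta>] b F(1) that by auto
      then show ?thesis using F(2) as by blast
    qed
    moreover have "p \<restriction> insert a B \<subseteq> formulas L (insert a B) {x}"
      using restrict_sub[OF global_type_sub[OF p]] .
    ultimately show ?thesis using realizes_iff[OF _ assignment_e0, of "p \<restriction> insert a B"] b_univ by simp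
  qed
  then show ?thesis using A(1,2) by (intro exI[of _ A]) simp
qed

end

section \<open>Weak orthogonality over \<open>C\<close> excludes dependence over
  \<open>B\<close>\<close>

context gs_type
begin

text \<open>
  The witness \<open>d\<close> of the dependence of \<open>a\<close> and \<open>b\<close> is replaced by a tuple \<open>m\<close> from the model: by
  definability, \<open>b\<close> depends on some \<open>a'\<close> in \<open>\<phi>\<^sub>p\<close> through \<open>\<psi>(x, y, m)\<close>. If \<open>a'\<close> does not realize
  \<open>p \<restriction> B\<close>, strong regularity makes \<open>a'\<close> and \<open>a\<close> orthogonal over \<open>B\<close>, although \<open>b\<close> depends on both.
\<close>

lemma weakly_orthogonal_no_dependence:
  assumes M: "elementary_submodel L N U"
    and p: "global_type L U x p" "invariant_type L U N x p" and "x \<noteq> y"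
    and \<phi>p: "\<phi>\<^sub>p \<in> p \<restriction> N" and \<phi>q: "\<phi>\<^sub>q \<in> q \<restriction> N"
    and regular_p: "\<And>C a b. B \<subseteq> C \<Longrightarrow> C \<subseteq> univ U \<Longrightarrow> small \<kappa> C \<Longrightarrow> realizes U x a {\<phi>\<^sub>p} \<Longrightarrow>
      \<not> realizes U x a (p \<restriction> C) \<Longrightarrow> realizes U x b (p \<restriction> C) \<Longrightarrow>
      realizes U x b (p \<restriction> (insert a C))"
    and regular_q: "\<And>C a b. B \<subseteq> C \<Longrightarrow> C \<subseteq> univ U \<Longrightarrow> small \<kappa> C \<Longrightarrow> realizes U y a {\<phi>\<^sub>q} \<Longrightarrow>
      \<not> realizes U y a (q \<restriction> C) \<Longrightarrow> realizes U y b (q \<restriction> C) \<Longrightarrow>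
      realizes U y b (q \<restriction> (insert a C))"
    and C: "N \<subseteq> C" "C \<subseteq> B" "weakly_orthogonal L U C x (p \<restriction> C) y (q \<restriction> C)"
    and B: "A \<subseteq> B" "B \<subseteq> univ U" "small \<kappa> B" "params \<psi> \<subseteq> B"
    and \<psi>: "\<psi> \<in> formulas L (univ U) {x, y}" "inst [x \<mapsto> a] \<psi> \<notin> q"
    and a: "realizes U x a (p \<restriction> B)" and b: "realizes U y b (q \<restriction> B)"
    and sat: "sat U (e0(x := a, y := b)) \<psi>"
  shows False
proof -
  have NB: "N \<subseteq> B" using C by blast
  have aU: "a \<in> univ U" "fst a = fst x" and bU: "b \<in> univ U" "fst b = fst y"
    using a b realizes_univ realizes_sort by metis+
  have aB: "insert a B \<subseteq> univ U" "small \<kappa> (insert a B)" using aU(1) B(2,3) small_insert by auto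
  have \<psi>a: "inst [x \<mapsto> a] \<psi> \<in> formulas L (insert a B) {y}"
  proof (rule inst_formulas)
    show "\<psi> \<in> formulas L B {x, y}" using \<psi>(1) B(4) by (simp add: formulas_def)
  qed (use aU in \<open>auto split: if_splits\<close>)
  have sat_\<psi>a: "sat1 y d (inst [x \<mapsto> a] \<psi>) \<longleftrightarrow> sat U (e0(x := a, y := d)) \<psi>" for d
    using \<open>x \<noteq> y\<close> by (simp add: sat_inst override_single fun_upd_twist)
  obtain g where g: "inj_on g (params \<psi>)" "\<And>c. fst (g c) = fst c"
    "\<And>c. g c \<notin> {x, y} \<union> all_vars \<psi>"
    using fresh_variables[of "params \<psi>" "{x, y} \<union> all_vars \<psi>"] finite_params[of \<psi>]
      finite_all_vars[of \<psi>] by auto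
  define Z where "Z = g ` params \<psi>"
  have Z: "finite Z" "x \<notin> Z" "y \<notin> Z" using finite_params g(3) by (auto simp: Z_def)
  obtain d where d: "assignment U d" "\<forall>c\<in>params \<psi>. d (g c) = c"
    using abstract_assignment[OF g(1,2)] \<psi>(1) by (auto simp: formulas_def)
  define \<psi>0 where "\<psi>0 = psub (\<lambda>c. Var (g c)) \<psi>"
  have g_\<psi>: "g c \<notin> all_vars \<psi>" for c using g(3) by blast
  have "\<psi>0 \<in> formulas L {} ({x, y} \<union> Z)"
    unfolding \<psi>0_def Z_def by (rule abstract_params(1)[OF \<psi>(1) g(2) g_\<psi>])
  then have \<psi>0: "\<psi>0 \<in> formulas L N (insert y (insert x Z))"
    by (auto simp: formulas_def)
  have sat_\<psi>0: "sat U (d(x := u, y := v)) \<psi>0 \<longleftrightarrow> sat U (e0(x := u, y := v)) \<psi>" for u v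
  proof -
    have "(d(x := u, y := v)) (g c) = c" if "c \<in> params \<psi>" for c
      using d(2) that g(3)[of c] by auto
    then have "sat U (d(x := u, y := v)) \<psi>0 \<longleftrightarrow> sat U (d(x := u, y := v)) \<psi>"
      unfolding \<psi>0_def by (rule abstract_params(2)[OF \<psi>(1) g(2) g_\<psi>])
    also have "\<dots> \<longleftrightarrow> sat U (e0(x := u, y := v)) \<psi>"
      using \<psi>(1) by (intro sat_cong) (auto simp: formulas_def)
    finally show ?thesis .
  qed
  obtain \<delta> where \<delta>: "\<delta> \<in> formulas L N (insert x Z)"
    "\<And>e. assignment U e \<Longrightarrow> sat U e \<delta> \<longleftrightarrow> generic y q e \<psi>0"
    using generic_definable[OF \<psi>0] Z \<open>x \<noteq> y\<close> by auto
  \<comment> \<open>This says that \<open>y\<close> depends on some element of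
    \<open>\<phi>\<^sub>p\<close>: the instance of \<open>\<psi>0\<close> there holds at
    \<open>y\<close> but is not generic for \<open>q\<close>, as expressed by
    \<open>\<delta>\<close>.\<close>
  define \<chi> where "\<chi> = Exists x (Conj \<phi>\<^sub>p (Conj \<psi>0 (Neg \<delta>)))"
  have \<phi>p_form: "\<phi>\<^sub>p \<in> formulas L N {x}"
    using \<phi>p restrict_sub[OF global_type_sub[OF p(1)]] by blast
  have \<phi>q_form: "\<phi>\<^sub>q \<in> formulas L N {y}"
    using \<phi>q restrict_sub[OF global_type_sub[OF q]] by blast
  have \<chi>: "\<chi> \<in> formulas L N (insert y Z)"
    using \<phi>p_form \<psi>0 \<delta>(1) by (auto simp: \<chi>_def formulas_def)
  \<comment> \<open>Definability is used a second time, now to eliminate \<open>y\<close>. The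
    condition on the former parameters becomes a formula over \<open>N\<close>, which elementarity
    can transfer.\<close>
  obtain \<epsilon> where \<epsilon>: "\<epsilon> \<in> formulas L N Z"
    "\<And>e. assignment U e \<Longrightarrow> sat U e \<epsilon> \<longleftrightarrow> generic y q e \<chi>"
    using generic_definable[OF \<chi> Z(1,3)] by auto
  have sat_\<phi>p: "sat U (e(x := u)) \<phi>\<^sub>p \<longleftrightarrow> sat1 x u \<phi>\<^sub>p" for e u
    by (rule sat1_iff[OF \<phi>p_form])
  have in_B: "\<theta> \<in> formulas L D X" if "\<theta> \<in> formulas L N X" "B \<subseteq> D" for \<theta> X D
    using that(1) by (rule formulas_params_mono) (use that(2) NB in blast)
  \<comment> \<open>For the original parameters, \<open>b\<close> satisfies \<open>\<chi>\<close>
    with \<open>a\<close> as witness; as \<open>b\<close> realizes \<open>q\<close> over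
    \<open>B\<close>, this makes \<open>\<chi>\<close> generic.\<close>
  have "sat U d \<epsilon>"
  proof -
    let ?e = "d(y := b, x := a)"
    have as: "assignment U ?e" using d(1) aU bU by (intro assignment_upd)
    obtain b' where b': "realizes U y b' (q \<restriction> (insert a B))"
      using restriction_realized[OF q aB] by blast
    have eZ: "d ` Z \<subseteq> B" using d(2) B(4) by (auto simp: Z_def)
    have "\<not> sat1 y b' (inst [x \<mapsto> a] \<psi>)" using realizes_sat1[OF q aB(1) b' \<psi>a] \<psi>(2) by simp
    then have "\<not> sat U (d(x := a, y := b')) \<psi>0" using sat_\<psi>0 sat_\<psi>a by simp
    moreover have "?e(y := b') = d(x := a, y := b')" using \<open>x \<noteq> y\<close> by (auto simp: fun_eq_iff)
    moreover have "generic y q ?e \<psi>0 \<longleftrightarrow> sat U (?e(y := b')) \<psi>0"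
      using eZ Z by (intro generic_iff_sat[OF q as in_B[OF \<psi>0] _ aB(1) b']) auto
    ultimately have "sat U ?e (Neg \<delta>)" using \<delta>(2)[OF as] by simp
    moreover have "sat U ?e \<psi>0"
      using sat_\<psi>0[of a b] sat \<open>x \<noteq> y\<close> by (simp add: fun_upd_twist)
    moreover have "sat U ?e \<phi>\<^sub>p"
    proof -
      have "\<phi>\<^sub>p \<in> p \<restriction> B" using \<phi>p restrict_mono[OF NB] by blast
      then show ?thesis using sat_restriction[OF p(1) B(2), of ?e \<phi>\<^sub>p] a by simp
    qed
    ultimately have "sat U (d(y := b)) \<chi>" unfolding \<chi>_def using aU by auto
    moreover have "generic y q d \<chi> \<longleftrightarrow> sat U (d(y := b)) \<chi>"
      using eZ Z by (intro generic_iff_sat[OF q d(1) in_B[OF \<chi>] _ B(2) b]) auto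
    ultimately show ?thesis using \<epsilon>(2)[OF d(1)] by simp
  qed
  \<comment> \<open>The parameters now lie in \<open>N\<close>. Since \<open>b\<close> realizes
    \<open>q\<close> over \<open>B\<close>, which contains \<open>N\<close>, it still satisfies
    \<open>\<chi>\<close> for them.\<close>
  then obtain m where m: "assignment U m" "\<forall>v. m v \<in> N" "sat U m \<epsilon>"
    using elementary_submodel_witness[OF M \<epsilon>(1) Z(1) d(1)] by blast
  have mB: "m ` X \<subseteq> B" for X using m(2) NB by blast
  have "generic y q m \<chi> \<longleftrightarrow> sat U (m(y := b)) \<chi>"
    by (rule generic_iff_sat[OF q m(1) in_B[OF \<chi>] mB B(2) b]) simp
  then have "sat U (m(y := b)) \<chi>" using \<epsilon>(2)[OF m(1)] m(3) by simp
  then obtain a' where a': "a' \<in> univ U" "fst a' = fst x" "sat U (m(y := b, x := a')) \<phi>\<^sub>p"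
    "sat U (m(y := b, x := a')) \<psi>0" "\<not> sat U (m(y := b, x := a')) \<delta>"
    unfolding \<chi>_def by auto
  let ?e = "m(y := b, x := a')"
  have as: "assignment U ?e" using m(1) a'(1,2) bU by (intro assignment_upd)
  have not_gen: "\<not> generic y q ?e \<psi>0" using \<delta>(2)[OF as] a'(5) by simp
  have a'B: "insert a' B \<subseteq> univ U" "small \<kappa> (insert a' B)" using a'(1) B(2,3) small_insert by auto
  have gen_iff: "generic y q ?e \<psi>0 \<longleftrightarrow> sat U (?e(y := b')) \<psi>0"
    if "realizes U y b' (q \<restriction> (insert a' B))" for b'
    using mB[of UNIV] by (intro generic_iff_sat[OF q as in_B[OF \<psi>0] _ a'B(1) that]) auto
  have e_triv: "?e(y := b) = ?e" using \<open>x \<noteq> y\<close> by (auto simp: fun_eq_iff)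
  have b_a': "\<not> realizes U y b (q \<restriction> (insert a' B))"
    using gen_iff[of b] not_gen a'(4) unfolding e_triv by blast
  show False
  proof (cases "realizes U x a' (p \<restriction> C)")
    case True
    \<comment> \<open>Both \<open>b\<close> and \<open>b'\<close> realize \<open>q\<close> over
      \<open>C\<close>. Weak orthogonality would give them the same type together with
      \<open>a'\<close>, but \<open>\<psi>0\<close> at \<open>m\<close> holds for \<open>b\<close>
      and fails for the generic \<open>b'\<close>.\<close>
    obtain b' where b': "realizes U y b' (q \<restriction> (insert a' B))"
      using restriction_realized[OF q a'B] by blast
    let ?e' = "?e(y := b')"
    have as': "assignment U ?e'"
      using as by (rule assignment_upd) (use b' realizes_univ realizes_sort in metis)+
    have CU: "C \<subseteq> univ U" using C(2) B(2) by blast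
    have bC: "realizes U y b (q \<restriction> C)" using b C(2) by (rule realizes_restrict_mono)
    have b'C: "realizes U y b' (q \<restriction> C)" using b' by (rule realizes_restrict_mono) (use C(2) in blast)
    define \<psi>m where "\<psi>m = inst (((Some \<circ> m)(x := None))(y := None)) \<psi>0"
    have "\<psi>m \<in> formulas L C {x, y}"
      unfolding \<psi>m_def
    proof (rule inst_formulas[OF \<psi>0])
      fix v c assume "(((Some \<circ> m)(x := None))(y := None)) v = Some c"
      then have "c = m v" by (auto split: if_splits)
      then show "fst c = fst v" "c \<in> C" using m(1,2) C(1) by (auto simp: assignment_def)
    qed (use C(1) in \<open>auto split: if_splits\<close>)
    then have "entails U (p \<restriction> C \<union> q \<restriction> C) \<psi>m \<or> entails U (p \<restriction> C \<union> q \<restriction> C) (Neg \<psi>m)"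
      using C(3) weakly_orthogonal_iff[OF p(1) q \<open>x \<noteq> y\<close>] by blast
    moreover have "sat U e \<theta>" if "entails U (p \<restriction> C \<union> q \<restriction> C) \<theta>" "assignment U e" "e x = a'"
      "e y = b \<or> e y = b'" for e \<theta>
    proof -
      have "sat U e \<phi>" if "\<phi> \<in> p \<restriction> C \<union> q \<restriction> C" for \<phi>
        using that sat_restriction[OF p(1) CU, of e \<phi>] sat_restriction[OF q CU, of e \<phi>]
          True bC b'C \<open>e x = a'\<close> \<open>e y = b \<or> e y = b'\<close> by auto
      then show ?thesis using that(1,2) unfolding entails_def by (meson subsetD)
    qed
    moreover have "?e x = a'" "?e y = b" "?e' x = a'" "?e' y = b'" using \<open>x \<noteq> y\<close> by auto
    ultimately have "sat U ?e \<psi>m \<longleftrightarrow> sat U ?e' \<psi>m"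
      using as as' by (metis sat.simps(3))
    moreover have "sat U e \<psi>m \<longleftrightarrow> sat U (m(x := e x, y := e y)) \<psi>0" for e
    proof -
      have "override e (((Some \<circ> m)(x := None))(y := None)) = m(x := e x, y := e y)"
        by (auto simp: override_def fun_eq_iff)
      then show ?thesis by (simp only: \<psi>m_def sat_inst)
    qed
    moreover have "m(x := ?e x, y := ?e y) = ?e" "m(x := ?e' x, y := ?e' y) = ?e'"
      using \<open>x \<noteq> y\<close> by (auto simp: fun_eq_iff)
    ultimately have "sat U ?e \<psi>0 \<longleftrightarrow> sat U ?e' \<psi>0" by metis
    then show False using gen_iff[OF b'] not_gen a'(4) by simp
  next
    case False
    have a'\<phi>: "realizes U x a' {\<phi>\<^sub>p}"
    proof -
      have "sat1 x a' \<phi>\<^sub>p" using a'(3) by (rule sat_\<phi>p[THEN iffD1])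
      then show ?thesis
        using realizes_iff[of "{\<phi>\<^sub>p}" N x, OF _ assignment_e0] \<phi>p_form a'(1,2) by simp
    qed
    \<comment> \<open>Not realizing \<open>p\<close> persists from \<open>C\<close> to the larger
      \<open>B\<close>, which contains the base of strong regularity.\<close>
    have "\<not> realizes U x a' (p \<restriction> B)" using False realizes_restrict_mono C(2) by metis
    then have dom: "realizes U x u (p \<restriction> (insert a' B))" if "realizes U x u (p \<restriction> B)" for u
      using regular_p[OF subset_refl B(2,3) a'\<phi>] that by blast
    have "realizes U y u {\<phi>\<^sub>q}" if "realizes U y u (q \<restriction> B)" for u
      using that by (rule realizes_mono) (use \<phi>q restrict_mono[OF NB] in blast)
    then have reg: "realizes U y v (q \<restriction> (insert u D))"
      if "B \<subseteq> D" "D \<subseteq> univ U" "small \<kappa> D" "realizes U y u (q \<restriction> B)"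
        "\<not> realizes U y u (q \<restriction> D)" "realizes U y v (q \<restriction> D)" for D u v
      using regular_q that by blast
    have "sat1 y b (inst [x \<mapsto> a] \<psi>)" using sat sat_\<psi>a by simp
    then show False
      using no_double_dependence[OF p NB B(1-3) reg dom a'(1) a b b_a' \<psi>a _ \<psi>(2)] by blast
  qed
qed

end

section \<open>The two implications between global and local orthogonality\<close>

context monster
begin

lemma gs_type_exists:
  assumes "global_type L U x p" "invariant_type L U N x p" "N \<subseteq> univ U" "small \<kappa> N"
    and gs: "generically_stable L \<kappa> U x p"
  shows "\<exists>A. gs_type L T \<kappa> U x p N A"
proof -
  obtain A where A: "A \<subseteq> univ U" "small \<kappa> A"
    "\<forall>(r :: ('s, 'a) elem rel) a.
       Well_order r \<longrightarrow> infinite (Field r) \<longrightarrow> morley_sequence U A x p r a \<longrightarrow>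
       (\<forall>\<phi>\<in>formulas L (univ U) {x}.
          finite {i\<in>Field r. U \<Turnstile> inst [x \<mapsto> a i] \<phi>} \<or>
          finite (Field r - {i\<in>Field r. U \<Turnstile> inst [x \<mapsto> a i] \<phi>}))"
    using gs[unfolded generically_stable_def] by (elim exE conjE, intro that)
  obtain \<chi> :: "('s, 'f, 'r, 'a) form" where \<chi>: "\<chi> \<in> formulas L (univ U) {x}"
    "\<forall>e. assignment U e \<longrightarrow> sat U e \<chi>"
    using ex_true_formula by blast
  \<comment> \<open>Non-algebraicity of a formula true everywhere shows that there are infinitely
    many elements, as is needed to index the sequences.\<close>
  have "\<chi> \<in> p" by (rule global_type_closed[OF assms(1), of "{}"]) (use \<chi> in auto)
  then have "infinite {a. realizes U x a {\<chi>}}"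
    using gs unfolding generically_stable_def nonalgebraic_def by blast
  then have "infinite (UNIV :: ('s, 'a) elem set)" using finite_subset subset_UNIV by blast
  then have "gs_type L T \<kappa> U x p N A"
    using assms(1-4) A by unfold_locales simp_all
  then show ?thesis by blast
qed

lemma orthogonal_iff:
  assumes "global_type L U x p" "global_type L U y q" "x \<noteq> y"
  shows "orthogonal L U x p y q \<longleftrightarrow>
    (\<forall>\<psi>\<in>formulas L (univ U) {x, y}. entails U (p \<union> q) \<psi> \<or> entails U (p \<union> q) (Neg \<psi>))"
  using weakly_orthogonal_iff[OF assms, of "univ U"] assms(1,2)
  by (simp add: orthogonal_def restrict_univ)

text \<open>An undecided formula is realized positively and negatively by independent-looking pairs
  over \<open>B\<close>. Without dependence, \<open>q\<close> would contain its instance at one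
  first coordinate and the negated instance at the other, although these coordinates are conjugate
  over \<open>B\<close> and \<open>q\<close> is invariant.\<close>

lemma weakly_orthogonal_imp_orthogonal:
  assumes M: "elementary_submodel L M U" "small \<kappa> M" and "x \<noteq> y"
    and p: "global_type L U x p" and q: "global_type L U y q"
    and inv_p: "invariant_pair L U M x p \<phi>\<^sub>p" and inv_q: "invariant_pair L U M y q \<phi>\<^sub>q"
    and reg_p: "strongly_regular L \<kappa> U x p \<phi>\<^sub>p" and reg_q: "strongly_regular L \<kappa> U y q \<phi>\<^sub>q"
    and gs: "generically_stable L \<kappa> U y q"
    and C: "M \<subseteq> C" "C \<subseteq> univ U" "small \<kappa> C" "weakly_orthogonal L U C x (p \<restriction> C) y (q \<restriction> C)"
  shows "orthogonal L U x p y q"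
  unfolding orthogonal_iff[OF p q \<open>x \<noteq> y\<close>]
proof (rule ballI, rule ccontr)
  fix \<psi> assume \<psi>: "\<psi> \<in> formulas L (univ U) {x, y}"
    and undecided: "\<not> (entails U (p \<union> q) \<psi> \<or> entails U (p \<union> q) (Neg \<psi>))"
  have MU: "M \<subseteq> univ U" using M by (simp add: elementary_submodel_def)
  have inv: "invariant_type L U M x p" "\<phi>\<^sub>p \<in> p \<restriction> M" "invariant_type L U M y q" "\<phi>\<^sub>q \<in> q \<restriction> M"
    using inv_p inv_q by (auto simp: invariant_pair_def)
  obtain A where "gs_type L T \<kappa> U y q M A"
    using gs_type_exists[OF q inv(3) MU M(2) gs] by blast
  then interpret Q: gs_type L T \<kappa> U y q M A .
  obtain Bp where Bp: "Bp \<subseteq> univ U" "small \<kappa> Bp"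
    "\<forall>B a b. Bp \<subseteq> B \<longrightarrow> B \<subseteq> univ U \<longrightarrow> small \<kappa> B \<longrightarrow>
      realizes U x a {\<phi>\<^sub>p} \<longrightarrow> \<not> realizes U x a (p \<restriction> B) \<longrightarrow> realizes U x b (p \<restriction> B) \<longrightarrow>
      realizes U x b (p \<restriction> (insert a B))"
    using strongly_regular_witness[OF reg_p p] by (elim exE conjE, intro that)
  obtain Bq where Bq: "Bq \<subseteq> univ U" "small \<kappa> Bq"
    "\<forall>B a b. Bq \<subseteq> B \<longrightarrow> B \<subseteq> univ U \<longrightarrow> small \<kappa> B \<longrightarrow>
      realizes U y a {\<phi>\<^sub>q} \<longrightarrow> \<not> realizes U y a (q \<restriction> B) \<longrightarrow> realizes U y b (q \<restriction> B) \<longrightarrow>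
      realizes U y b (q \<restriction> (insert a B))"
    using strongly_regular_witness[OF reg_q q] by (elim exE conjE, intro that)
  define B where "B = A \<union> Bp \<union> Bq \<union> C \<union> params \<psi>"
  have BU: "B \<subseteq> univ U" using Q.A(1) Bp(1) Bq(1) C(2) \<psi> by (auto simp: B_def formulas_def)
  have B_small: "small \<kappa> B" unfolding B_def
    by (intro small_Un Q.A(2) Bp(2) Bq(2) C(3) small_finite finite_params)
  have sub: "C \<subseteq> B" "A \<subseteq> B" "params \<psi> \<subseteq> B" "Bp \<subseteq> B" "Bq \<subseteq> B" by (auto simp: B_def)
  have realized: "\<exists>e. assignment U e \<and> realizes U x (e x) (p \<restriction> B) \<and> realizes U y (e y) (q \<restriction> B) \<and>
      sat U e \<theta>"
    if \<theta>: "\<theta> \<in> formulas L B {x, y}" "\<not> entails U (p \<union> q) (Neg \<theta>)" for \<theta>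
  proof -
    let ?\<Sigma> = "insert \<theta> (p \<restriction> B \<union> q \<restriction> B)"
    have pq: "p \<restriction> B \<subseteq> formulas L B {x}" "q \<restriction> B \<subseteq> formulas L B {y}"
      using restrict_sub global_type_sub p q by metis+
    then have "?\<Sigma> \<subseteq> formulas L B {x, y}" using \<theta>(1) by (auto simp: formulas_def)
    moreover have "finitely_satisfiable U ?\<Sigma>"
      unfolding finitely_satisfiable_def
    proof (intro allI impI)
      fix F assume F: "F \<subseteq> ?\<Sigma>" "finite F"
      then have "F - {\<theta>} \<subseteq> p \<union> q" "finite (F - {\<theta>})" by (auto simp: restrict_type_def)
      then obtain e where "assignment U e" "\<forall>\<phi>\<in>F - {\<theta>}. sat U e \<phi>" "\<not> sat U e (Neg \<theta>)"
        using \<theta>(2) unfolding entails_def by metis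
      then show "\<exists>e. assignment U e \<and> (\<forall>\<phi>\<in>F. sat U e \<phi>)" by (intro exI[of _ e]) auto
    qed
    ultimately obtain e where e: "assignment U e" "\<forall>\<phi>\<in>?\<Sigma>. sat U e \<phi>"
      using finitely_satisfiable_realized[OF _ BU B_small, of "{x, y}" ?\<Sigma>] by auto
    have ex: "e x \<in> univ U" "fst (e x) = fst x" "e y \<in> univ U" "fst (e y) = fst y"
      using e(1) by (simp_all add: assignment_def)
    have "realizes U x (e x) (p \<restriction> B)"
      using realizes_iff[OF pq(1) e(1)] ex e(2) by simp
    moreover have "realizes U y (e y) (q \<restriction> B)"
      using realizes_iff[OF pq(2) e(1)] ex e(2) by simp
    ultimately show ?thesis using e by blast
  qed
  have no_dep: False
    if "\<theta> \<in> formulas L (univ U) {x, y}" "params \<theta> \<subseteq> B" "inst [x \<mapsto> e x] \<theta> \<notin> q"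
      "realizes U x (e x) (p \<restriction> B)" "realizes U y (e y) (q \<restriction> B)" "sat U e \<theta>" for \<theta> e
  proof -
    have "sat U (e0(x := e x, y := e y)) \<theta> \<longleftrightarrow> sat U e \<theta>"
      using that(1) by (intro sat_cong) (auto simp: formulas_def)
    then have sat: "sat U (e0(x := e x, y := e y)) \<theta>" using that(6) by simp
    have regular_p: "realizes U x b (p \<restriction> (insert a D))"
      if "B \<subseteq> D" "D \<subseteq> univ U" "small \<kappa> D" "realizes U x a {\<phi>\<^sub>p}" "\<not> realizes U x a (p \<restriction> D)"
        "realizes U x b (p \<restriction> D)" for D a b
      using Bp(3) that sub(4) by (meson subset_trans)
    have regular_q: "realizes U y b (q \<restriction> (insert a D))"
      if "B \<subseteq> D" "D \<subseteq> univ U" "small \<kappa> D" "realizes U y a {\<phi>\<^sub>q}" "\<not> realizes U y a (q \<restriction> D)"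
        "realizes U y b (q \<restriction> D)" for D a b
      using Bq(3) that sub(5) by (meson subset_trans)
    show False
      by (rule Q.weakly_orthogonal_no_dependence[OF M(1) p inv(1) \<open>x \<noteq> y\<close> inv(2,4)
        regular_p regular_q C(1) sub(1) C(4) sub(2) BU B_small that(2,1,3,4,5) sat])
  qed
  have \<psi>B: "\<psi> \<in> formulas L B {x, y}" using \<psi> sub(3) by (simp add: formulas_def)
  have "\<not> entails U (p \<union> q) (Neg (Neg \<psi>))" using undecided by (simp add: entails_def)
  then obtain e1 where e1: "realizes U x (e1 x) (p \<restriction> B)" "realizes U y (e1 y) (q \<restriction> B)"
    "sat U e1 (Neg \<psi>)"
    using realized[of "Neg \<psi>"] \<psi>B by auto
  obtain e2 where e2: "realizes U x (e2 x) (p \<restriction> B)" "realizes U y (e2 y) (q \<restriction> B)" "sat U e2 \<psi>"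
    using realized[OF \<psi>B] undecided by auto
  \<comment> \<open>Otherwise the pair given by \<open>e2\<close> would be a forbidden
    dependence.\<close>
  have q2: "inst [x \<mapsto> e2 x] \<psi> \<in> q" using no_dep[of \<psi> e2] \<psi> sub(3) e2 by blast
  obtain h where h: "automorphism L U h" "\<And>c. c \<in> B \<Longrightarrow> h c = c" "h (e2 x) = e1 x"
    using realizations_conjugate[OF p BU B_small e2(1) e1(1)] by metis
  have inst_q: "inst [x \<mapsto> a] \<psi> \<in> formulas L (univ U) {y}"
    if "realizes U x a (p \<restriction> B)" for a
    using realizes_univ[OF that] realizes_sort[OF that]
    by (intro inst_formulas[OF \<psi>]) (auto split: if_splits)
  have "pmap h (inst [x \<mapsto> e2 x] \<psi>) = inst [x \<mapsto> e1 x] \<psi>"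
  proof -
    have "pmap h \<psi> = \<psi>" using h(2) sub(3) by (intro pmap_id) blast
    moreover have "map_option h \<circ> [x \<mapsto> e2 x] = [x \<mapsto> e1 x]" using h(3) by (auto simp: fun_eq_iff)
    ultimately show ?thesis by (simp only: pmap_inst)
  qed
  moreover have "pmap h (inst [x \<mapsto> e2 x] \<psi>) \<in> q \<longleftrightarrow> inst [x \<mapsto> e2 x] \<psi> \<in> q"
    by (rule invariant_automorphism[OF inv(3) MU h(1) _ inst_q[OF e2(1)]])
      (use h(2) C(1) sub(1) in blast)
  ultimately have "inst [x \<mapsto> e1 x] \<psi> \<in> q" using q2 by simp
  then have "inst [x \<mapsto> e1 x] (Neg \<psi>) \<notin> q"
    using global_type_Neg[OF q inst_q[OF e1(1)]] by simp
  then show False using no_dep[of "Neg \<psi>" e1] \<psi> sub(3) e1 by simp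
qed

text \<open>
  By definability over \<open>M\<close>, the parameters in an entailment \<open>p \<union> q \<turnstile> \<psi>\<close> can be moved into \<open>M\<close>.
\<close>

lemma entails_descends:
  assumes P: "gs_type L T \<kappa> U x p M A" and Q: "gs_type L T \<kappa> U y q M A'"
    and M: "elementary_submodel L M U" and "x \<noteq> y"
    and \<psi>: "\<psi> \<in> formulas L M {x, y}" and ent: "entails U (p \<union> q) \<psi>"
  shows "entails U (p \<restriction> M \<union> q \<restriction> M) \<psi>"
proof -
  interpret P: gs_type L T \<kappa> U x p M A by (rule P)
  interpret Q: gs_type L T \<kappa> U y q M A' by (rule Q)
  have MU: "M \<subseteq> univ U" using M by (simp add: elementary_submodel_def)
  obtain F where F: "F \<subseteq> p \<union> q" "finite F"
    "\<forall>e. assignment U e \<longrightarrow> (\<forall>\<phi>\<in>F. sat U e \<phi>) \<longrightarrow> sat U e \<psi>"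
    using ent[unfolded entails_def] by (elim exE conjE, intro that)
  have subs: "F \<inter> p \<subseteq> formulas L (univ U) {x}" "F \<inter> q \<subseteq> formulas L (univ U) {y}"
    using global_type_sub[OF P.q] global_type_sub[OF Q.q] by auto
  obtain \<theta>1 where \<theta>1: "\<theta>1 \<in> formulas L (univ U) {x}"
    "\<forall>e. assignment U e \<longrightarrow> (sat U e \<theta>1 \<longleftrightarrow> (\<forall>\<phi>\<in>F \<inter> p. sat U e \<phi>))"
    using finite_conj[OF _ subs(1)] F(2) by auto
  obtain \<theta>2 where \<theta>2: "\<theta>2 \<in> formulas L (univ U) {y}"
    "\<forall>e. assignment U e \<longrightarrow> (sat U e \<theta>2 \<longleftrightarrow> (\<forall>\<phi>\<in>F \<inter> q. sat U e \<phi>))"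
    using finite_conj[OF _ subs(2)] F(2) by auto
  have \<theta>1p: "\<theta>1 \<in> p"
    using F(2) \<theta>1(2) by (intro global_type_closed[OF P.q _ _ \<theta>1(1), of "F \<inter> p"]) auto
  have \<theta>2q: "\<theta>2 \<in> q"
    using F(2) \<theta>2(2) by (intro global_type_closed[OF Q.q _ _ \<theta>2(1), of "F \<inter> q"]) auto
  have \<theta>_\<psi>: "sat U e \<psi>" if "assignment U e" "sat U e \<theta>1" "sat U e \<theta>2" for e
  proof -
    have "sat U e \<phi>" if "\<phi> \<in> F" for \<phi>
      using that F(1) \<theta>1(2) \<theta>2(2) \<open>assignment U e\<close> \<open>sat U e \<theta>1\<close> \<open>sat U e \<theta>2\<close> by auto
    then show ?thesis using F(3) that(1) by simp
  qed
  \<comment> \<open>\<open>\<theta>1\<close> and \<open>\<theta>2\<close> may share parameters, so a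
    single injection abstracts both.\<close>
  define D where "D = params \<theta>1 \<union> params \<theta>2"
  have D: "finite D" "D \<subseteq> univ U"
    using finite_params \<theta>1(1) \<theta>2(1) by (auto simp: D_def formulas_def)
  obtain g where g: "inj_on g D" "\<And>c. fst (g c) = fst c"
    "\<And>c. g c \<notin> {x, y} \<union> all_vars \<theta>1 \<union> all_vars \<theta>2"
    using fresh_variables[of D "{x, y} \<union> all_vars \<theta>1 \<union> all_vars \<theta>2"] D(1)
      finite_all_vars[of \<theta>1] finite_all_vars[of \<theta>2] by auto
  define Z where "Z = g ` D"
  have Z: "finite Z" "x \<notin> Z" "y \<notin> Z" using D(1) g(3) by (auto simp: Z_def)
  obtain d where d: "assignment U d" "\<forall>c\<in>D. d (g c) = c"
    using abstract_assignment[OF g(1,2) D(2)] by blast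
  have g_\<theta>: "g c \<notin> all_vars \<theta>1" "g c \<notin> all_vars \<theta>2" for c using g(3)[of c] by auto
  define \<eta>1 where "\<eta>1 = psub (\<lambda>c. Var (g c)) \<theta>1"
  define \<eta>2 where "\<eta>2 = psub (\<lambda>c. Var (g c)) \<theta>2"
  have "\<eta>1 \<in> formulas L {} ({x} \<union> g ` params \<theta>1)"
    unfolding \<eta>1_def by (rule abstract_params(1)[OF \<theta>1(1) g(2) g_\<theta>(1)])
  then have \<eta>1: "\<eta>1 \<in> formulas L M (insert x Z)" by (auto simp: formulas_def Z_def D_def)
  have "\<eta>2 \<in> formulas L {} ({y} \<union> g ` params \<theta>2)"
    unfolding \<eta>2_def by (rule abstract_params(1)[OF \<theta>2(1) g(2) g_\<theta>(2)])
  then have \<eta>2: "\<eta>2 \<in> formulas L M (insert y Z)" by (auto simp: formulas_def Z_def D_def)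
  have \<eta>_sat: "sat U e \<eta>1 \<longleftrightarrow> sat U e \<theta>1" "sat U e \<eta>2 \<longleftrightarrow> sat U e \<theta>2"
    if "\<forall>v\<in>Z. e v = d v" for e
  proof -
    have "e (g c) = c" if "c \<in> D" for c using that d(2) \<open>\<forall>v\<in>Z. e v = d v\<close> by (simp add: Z_def)
    then show "sat U e \<eta>1 \<longleftrightarrow> sat U e \<theta>1" "sat U e \<eta>2 \<longleftrightarrow> sat U e \<theta>2"
      unfolding \<eta>1_def \<eta>2_def D_def
      by (auto intro!: abstract_params(2)[OF \<theta>1(1) g(2) g_\<theta>(1)]
        abstract_params(2)[OF \<theta>2(1) g(2) g_\<theta>(2)])
  qed
  obtain \<delta>1 where \<delta>1: "\<delta>1 \<in> formulas L M Z"
    "\<And>e. assignment U e \<Longrightarrow> sat U e \<delta>1 \<longleftrightarrow> generic x p e \<eta>1"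
    using P.generic_definable[OF \<eta>1 Z(1,2)] by auto
  obtain \<delta>2 where \<delta>2: "\<delta>2 \<in> formulas L M Z"
    "\<And>e. assignment U e \<Longrightarrow> sat U e \<delta>2 \<longleftrightarrow> generic y q e \<eta>2"
    using Q.generic_definable[OF \<eta>2 Z(1,3)] by auto
  \<comment> \<open>The negation of \<open>\<rho>\<close> expresses the entailment of
    \<open>\<psi>\<close> as a condition on the former parameters alone.\<close>
  define \<rho> where "\<rho> = Exists x (Exists y (Conj \<eta>1 (Conj \<eta>2 (Neg \<psi>))))"
  have \<rho>: "\<rho> \<in> formulas L M Z" using \<eta>1 \<eta>2 \<psi> by (auto simp: \<rho>_def formulas_def)
  have generic_d: "generic w r d \<eta>"
    if r: "global_type L U w r" and \<eta>: "\<eta> \<in> formulas L M (insert w Z)" "w \<notin> Z"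
      and \<theta>: "\<theta> \<in> r" "params \<theta> \<subseteq> D"
      and iff: "\<And>u. sat U (d(w := u)) \<eta> \<longleftrightarrow> sat U (d(w := u)) \<theta>" for w r \<eta> \<theta>
  proof -
    have MD: "M \<union> D \<subseteq> univ U" "small \<kappa> (M \<union> D)"
      using MU D(2) small_Un[OF P.N(2) small_finite[OF D(1)]] by auto
    obtain u where u: "realizes U w u (r \<restriction> (M \<union> D))" using restriction_realized[OF r MD] by blast
    have "\<theta> \<in> r \<restriction> (M \<union> D)" using \<theta> by (auto simp: restrict_type_def)
    then have "sat U (d(w := u)) \<theta>"
      using sat_restriction[OF r MD(1), of "d(w := u)" \<theta>] u by simp
    moreover have "generic w r d \<eta> \<longleftrightarrow> sat U (d(w := u)) \<eta>"
    proof (rule generic_iff_sat[OF r d(1) _ _ MD(1) u])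
      show "\<eta> \<in> formulas L (M \<union> D) (insert w Z)" using \<eta>(1) by (rule formulas_params_mono) blast
      show "d ` (insert w Z - {w}) \<subseteq> M \<union> D" using d(2) by (auto simp: Z_def)
    qed
    ultimately show ?thesis using iff by simp
  qed
  have "generic x p d \<eta>1"
    using Z(2) by (intro generic_d[OF P.q \<eta>1 Z(2) \<theta>1p] \<eta>_sat) (auto simp: D_def)
  then have d1: "sat U d \<delta>1" using \<delta>1(2)[OF d(1)] by simp
  have "generic y q d \<eta>2"
    using Z(3) by (intro generic_d[OF Q.q \<eta>2 Z(3) \<theta>2q] \<eta>_sat) (auto simp: D_def)
  then have d2: "sat U d \<delta>2" using \<delta>2(2)[OF d(1)] by simp
  have "\<not> sat U d \<rho>"
  proof
    assume "sat U d \<rho>"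
    then obtain u v where uv: "u \<in> univ U" "fst u = fst x" "v \<in> univ U" "fst v = fst y"
      "sat U (d(x := u, y := v)) \<eta>1" "sat U (d(x := u, y := v)) \<eta>2"
      "\<not> sat U (d(x := u, y := v)) \<psi>"
      unfolding \<rho>_def by auto
    have "assignment U (d(x := u, y := v))" using d(1) uv(1-4) by (intro assignment_upd)
    moreover have "\<forall>w\<in>Z. (d(x := u, y := v)) w = d w" using Z by auto
    ultimately show False using \<theta>_\<psi> \<eta>_sat uv(5-7) by blast
  qed
  \<comment> \<open>Genericity of both formulas and the entailment are now one formula over
    \<open>M\<close>, so they hold simultaneously for some \<open>m\<close> in
    \<open>M\<close>.\<close>
  then have "sat U d (Conj \<delta>1 (Conj \<delta>2 (Neg \<rho>)))" using d1 d2 by simp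
  moreover have "Conj \<delta>1 (Conj \<delta>2 (Neg \<rho>)) \<in> formulas L M Z" using \<delta>1(1) \<delta>2(1) \<rho> by simp
  ultimately obtain m where m: "assignment U m" "\<forall>v. m v \<in> M"
    "sat U m (Conj \<delta>1 (Conj \<delta>2 (Neg \<rho>)))"
    using elementary_submodel_witness[OF M _ Z(1) d(1)] by blast
  define \<mu>1 where "\<mu>1 = inst ((Some \<circ> m)(x := None)) \<eta>1"
  define \<mu>2 where "\<mu>2 = inst ((Some \<circ> m)(y := None)) \<eta>2"
  have "\<mu>1 \<in> formulas L M {x}" "\<mu>2 \<in> formulas L M {y}"
    unfolding \<mu>1_def \<mu>2_def
    using m(2) by (auto intro!: generic_formula[OF m(1) \<eta>1] generic_formula[OF m(1) \<eta>2])
  moreover have "\<mu>1 \<in> p" "\<mu>2 \<in> q"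
    using m(3) \<delta>1(2)[OF m(1)] \<delta>2(2)[OF m(1)] by (simp_all add: generic_def \<mu>1_def \<mu>2_def)
  ultimately have "{\<mu>1, \<mu>2} \<subseteq> p \<restriction> M \<union> q \<restriction> M" by (auto simp: restrict_type_def formulas_def)
  moreover have "sat U e \<psi>" if e: "assignment U e" "sat U e \<mu>1" "sat U e \<mu>2" for e
  proof -
    let ?m = "m(x := e x, y := e y)"
    have "sat U ?m \<eta>1 \<longleftrightarrow> sat U (m(x := e x)) \<eta>1" "sat U ?m \<eta>2 \<longleftrightarrow> sat U (m(y := e y)) \<eta>2"
      using \<eta>1 \<eta>2 Z \<open>x \<noteq> y\<close> by (auto intro!: sat_cong simp: formulas_def)
    then have "sat U ?m \<eta>1" "sat U ?m \<eta>2"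
      using e(2,3) unfolding \<mu>1_def \<mu>2_def sat_inst_assignment by simp_all
    moreover have "e x \<in> univ U" "fst (e x) = fst x" "e y \<in> univ U" "fst (e y) = fst y"
      using e(1) by (simp_all add: assignment_def)
    moreover have "\<not> sat U m \<rho>" using m(3) by simp
    ultimately have "sat U ?m \<psi>" unfolding \<rho>_def by auto
    moreover have "sat U ?m \<psi> \<longleftrightarrow> sat U e \<psi>"
      using \<psi> by (intro sat_cong) (auto simp: formulas_def)
    ultimately show ?thesis by simp
  qed
  ultimately show ?thesis unfolding entails_def by (intro exI[of _ "{\<mu>1, \<mu>2}"]) auto
qed

end

theorem theorem3:
  fixes L :: "('s, 'f, 'r) language"
    and T :: "('s, 'f, 'r, 'a) form set"
    and \<kappa> :: "'k rel"
    and U :: "('s, 'f, 'r, 'a) struct"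
    and M :: "('s, 'a) elem set"
    and x y :: "'s var"
    and p q :: "('s, 'f, 'r, 'a) form set"
    and \<phi>\<^sub>p \<phi>\<^sub>q :: "('s, 'f, 'r, 'a) form"
  assumes "complete_theory L T"
    and "monster_model L T \<kappa> U"
    and "elementary_submodel L M U" and "small \<kappa> M"
    and "x \<noteq> y"
    and "global_type L U x p" and "global_type L U y q"
    and "invariant_pair L U M x p \<phi>\<^sub>p" and "invariant_pair L U M y q \<phi>\<^sub>q"
    and "strongly_regular L \<kappa> U x p \<phi>\<^sub>p" and "strongly_regular L \<kappa> U y q \<phi>\<^sub>q"
    and "generically_stable L \<kappa> U x p" and "generically_stable L \<kappa> U y q"
  shows "(orthogonal L U x p y q \<longleftrightarrow> weakly_orthogonal L U M x (p \<restriction> M) y (q \<restriction> M)) \<and>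
    (weakly_orthogonal L U M x (p \<restriction> M) y (q \<restriction> M) \<longleftrightarrow>
      (\<exists>C. M \<subseteq> C \<and> C \<subseteq> univ U \<and> small \<kappa> C \<and>
         weakly_orthogonal L U C x (p \<restriction> C) y (q \<restriction> C)))"
proof -
  interpret monster L T \<kappa> U by unfold_locales (rule assms(2))
  have MU: "M \<subseteq> univ U" using assms(3) by (simp add: elementary_submodel_def)
  have inv: "invariant_type L U M x p" "invariant_type L U M y q"
    using assms(8,9) by (simp_all add: invariant_pair_def)
  have "weakly_orthogonal L U M x (p \<restriction> M) y (q \<restriction> M)" if "orthogonal L U x p y q"
    unfolding weakly_orthogonal_iff[OF assms(6,7,5)]
  proof
    fix \<psi> assume \<psi>: "\<psi> \<in> formulas L M {x, y}"
    obtain A where A: "gs_type L T \<kappa> U x p M A"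
      using gs_type_exists[OF assms(6) inv(1) MU assms(4,12)] by blast
    obtain A' where A': "gs_type L T \<kappa> U y q M A'"
      using gs_type_exists[OF assms(7) inv(2) MU assms(4,13)] by blast
    have "entails U (p \<union> q) \<psi> \<or> entails U (p \<union> q) (Neg \<psi>)"
      using that formulas_params_mono[OF \<psi> MU] unfolding orthogonal_iff[OF assms(6,7,5)] by blast
    then show "entails U (p \<restriction> M \<union> q \<restriction> M) \<psi> \<or> entails U (p \<restriction> M \<union> q \<restriction> M) (Neg \<psi>)"
      using entails_descends[OF A A' assms(3,5)] \<psi> by auto
  qed
  moreover have "orthogonal L U x p y q"
    if "M \<subseteq> C" "C \<subseteq> univ U" "small \<kappa> C" "weakly_orthogonal L U C x (p \<restriction> C) y (q \<restriction> C)" for C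
    by (rule weakly_orthogonal_imp_orthogonal[OF assms(3-11,13) that])
  \<comment> \<open>The circle closes with \<open>M\<close> itself as the set
    \<open>C\<close>.\<close>
  ultimately show ?thesis using MU assms(4) by blast
qed

end
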